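(* Let $\mathcal A$ be a Poincaré covariant net on two-dimensional Minkowski space satisfying the Bisognano–Wichmann property. Let $\mathcal N_+^{\mathrm{out}}$ be the von Neumann algebra generated by $\Phi_+^{\mathrm{out}}(x)$ with $x\in\mathcal A(O)$, $O\subset W_R$, $O$ bounded. Then the map $\Phi_+^{\mathrm{out}}$ is (extends from local operators localized in $W_R$ to) a conditional expectation from $\mathcal A(W_R)$ onto $\mathcal N_+^{\mathrm{out}}$ which preserves the vacuum state $\omega=\langle\Omega,\cdot\,\Omega\rangle$.
   Context: **Poincaré covariant net.** Points of $\mathbb R^2$ are $(a_0,a_1)$ ($a_0$ time). A (local) Poincaré covariant net $\mathcal A$ assigns to each open bounded $O\subset\mathbb R^2$ a von Neumann algebra $\mathcal A(O)$ on a common separable Hilbert space $\mathcal H$ such that: (1) $O_1\subset O_2\Rightarrow\mathcal A(O_1)\subset\mathcal A(O_2)$; (2) $[\mathcal A(O_1),\mathcal A(O_2)]=0$ if $O_1,O_2$ are spacelike separated; (3) $O=\bigcup_iO_i\Rightarrow\mathcal A(O)=\bigvee_i\mathcal A(O_i)$; (4) there is a strongly continuous unitary representation $U$ of the proper orthochronous Poincaré group $\mathcal P_+^\uparrow$ with $U(g)\mathcal A(O)U(g)^*=\mathcal A(gO)$; (5) the joint spectrum of translations in $U$ lies in $\{(p_0,p_1):p_0+p_1\ge0,\ p_0-p_1\ge0\}$; (6) there is a unique (up to phase) unit vector $\Omega\in\mathcal H$ invariant under $U$, and it is cyclic for $\bigvee_O\mathcal A(O)$. **Wedge and Bisognano–Wichmann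 property.** $W_R=\{(t_0,t_1):t_0<t_1,\ t_0>-t_1\}$ and $\mathcal A(W_R)=\bigvee_{D\subset W_R}\mathcal A(D)$ ($D$ bounded); $\Omega$ is cyclic and separating for $\mathcal A(W_R)$. Bisognano–Wichmann property: the modular group $\Delta^{it}$ of $\mathcal A(W_R)$ with respect to $\Omega$ equals $U(\Lambda(-2\pi t))$, where $\Lambda(t)=\begin{pmatrix}\cosh t&\sinh t\\ \sinh t&\cosh t\end{pmatrix}$. **Asymptotic field.** $T(a)$ is the representative of translation by $a\in\mathbb R^2$; for a local operator $x$ (an element of some $\mathcal A(O)$, $O$ bounded) put $x(a)=T(a)xT(a)^*$. Fix $0<\varepsilon<1$ and a nonnegative symmetric smooth $h$ on $\mathbb R$ with $\int h=1$; put $h_{\mathcal T}(t)=|\mathcal T|^{-\varepsilon}h(|\mathcal T|^{-\varepsilon}(t-\mathcal T))$. The strong limit $\Phi^{\mathrm{out}}_+(x)=\lim_{\mathcal T\to+\infty}\int dt\,h_{\mathcal T}(t)\,x(t,t)$ exists (Buchholz), and satisfies $\Phi^{\mathrm{out}}_+(x)\Omega=P_+x\Omega$, where $P_+$ is the projection onto $\{\xi:T(t,t)\xi=\xi\ \forall t\in\mathbb R\}$. **Conditional expectation.** A linear map $E:\mathcal M\to\mathcal N$ from a von Neumann algebra onto a von Neumann subalgebra with $E(x)=x$ for $x\in\mathcal N$; $E(xyz)=xE(y)z$ for $x,z\in\mathcal N$, $y\in\mathcal M$; $E(x)^*E(x)\le E(x^*x)$ for $x\in\mathcal M$. *)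

theory Defs
  imports "HOL-Analysis.Analysis"
begin

section \<open>Complex Hilbert spaces and their operators\<close>

text \<open>The inner product is linear in its second argument.\<close>

class complex_hilbert = banach +
  fixes scaleC :: "complex \<Rightarrow> 'a \<Rightarrow> 'a" (infixr \<open>*\<^sub>C\<close> 75)
    and cinner :: "'a \<Rightarrow> 'a \<Rightarrow> complex"
  assumes scaleC_add_right: "c *\<^sub>C (x + y) = c *\<^sub>C x + c *\<^sub>C y"
    and scaleC_add_left: "(c + d) *\<^sub>C x = c *\<^sub>C x + d *\<^sub>C x"
    and scaleC_scaleC: "c *\<^sub>C (d *\<^sub>C x) = (c * d) *\<^sub>C x"
    and scaleR_scaleC: "r *\<^sub>R x = complex_of_real r *\<^sub>C x"
    and cinner_commute: "cinner x y = cnj (cinner y x)"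
    and cinner_add_right: "cinner x (y + z) = cinner x y + cinner x z"
    and cinner_scaleC_right: "cinner x (c *\<^sub>C y) = c * cinner x y"
    and norm_eq_sqrt_cinner: "norm x = sqrt (Re (cinner x x))"

text \<open>Bounded operators are functions satisfying the following predicate.  Products are
  composition; sums and multiples are written pointwise.\<close>

definition bounded_clinear :: "('a::complex_hilbert \<Rightarrow> 'a) \<Rightarrow> bool" where
  "bounded_clinear x \<longleftrightarrow> bounded_linear x \<and> (\<forall>c \<xi>. x (c *\<^sub>C \<xi>) = c *\<^sub>C x \<xi>)"

definition cadjoint :: "('a::complex_hilbert \<Rightarrow> 'a) \<Rightarrow> ('a \<Rightarrow> 'a)" where
  "cadjoint x = (THE y. \<forall>\<xi> \<eta>. cinner (x \<xi>) \<eta> = cinner \<xi> (y \<eta>))"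

definition unitary_op :: "('a::complex_hilbert \<Rightarrow> 'a) \<Rightarrow> bool" where
  "unitary_op u \<longleftrightarrow> bounded_clinear u \<and> u \<circ> cadjoint u = id \<and> cadjoint u \<circ> u = id"

definition op_le :: "('a::complex_hilbert \<Rightarrow> 'a) \<Rightarrow> ('a \<Rightarrow> 'a) \<Rightarrow> bool" where
  "op_le x y \<longleftrightarrow> (\<forall>\<xi>. cinner \<xi> (y \<xi> - x \<xi>) \<in> \<real>\<^sub>\<ge>\<^sub>0)"


section \<open>Von Neumann algebras\<close>

definition commutant :: "('a::complex_hilbert \<Rightarrow> 'a) set \<Rightarrow> ('a \<Rightarrow> 'a) set" where
  "commutant S = {x. bounded_clinear x \<and> (\<forall>y\<in>S. x \<circ> y = y \<circ> x)}"

text \<open>Being an algebra with unit follows from \<^prop>\<open>commutant (commutant M) = M\<close>.\<close>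

definition von_neumann_algebra :: "('a::complex_hilbert \<Rightarrow> 'a) set \<Rightarrow> bool" where
  "von_neumann_algebra M \<longleftrightarrow>
     (\<forall>x\<in>M. bounded_clinear x \<and> cadjoint x \<in> M) \<and> commutant (commutant M) = M"

definition vn_generated :: "('a::complex_hilbert \<Rightarrow> 'a) set \<Rightarrow> ('a \<Rightarrow> 'a) set" where
  "vn_generated S = commutant (commutant (S \<union> cadjoint ` S))"

definition cyclic_vector :: "('a::complex_hilbert \<Rightarrow> 'a) set \<Rightarrow> 'a \<Rightarrow> bool" where
  "cyclic_vector M \<xi> \<longleftrightarrow> closure ((\<lambda>x. x \<xi>) ` M) = UNIV"

definition conditional_expectation ::
    "('a::complex_hilbert \<Rightarrow> 'a) set \<Rightarrow> ('a \<Rightarrow> 'a) set \<Rightarrow> (('a \<Rightarrow> 'a) \<Rightarrow> ('a \<Rightarrow> 'a)) \<Rightarrow> bool" where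
  "conditional_expectation M N E \<longleftrightarrow>
     von_neumann_algebra M \<and> von_neumann_algebra N \<and> N \<subseteq> M \<and> E ` M = N \<and>
     (\<forall>x\<in>M. \<forall>y\<in>M. E (\<lambda>\<xi>. x \<xi> + y \<xi>) = (\<lambda>\<xi>. E x \<xi> + E y \<xi>)) \<and>
     (\<forall>c. \<forall>x\<in>M. E (\<lambda>\<xi>. c *\<^sub>C x \<xi>) = (\<lambda>\<xi>. c *\<^sub>C E x \<xi>)) \<and>
     (\<forall>x\<in>N. E x = x) \<and>
     (\<forall>x\<in>N. \<forall>y\<in>M. \<forall>z\<in>N. E (x \<circ> y \<circ> z) = x \<circ> E y \<circ> z) \<and>
     (\<forall>x\<in>M. op_le (cadjoint (E x) \<circ> E x) (E (cadjoint x \<circ> x)))"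


section \<open>Spectral measures\<close>

definition projection_valued_measure ::
    "('p::topological_space set \<Rightarrow> ('a::complex_hilbert \<Rightarrow> 'a)) \<Rightarrow> bool" where
  "projection_valued_measure E \<longleftrightarrow>
     (\<forall>B\<in>sets borel. bounded_clinear (E B) \<and> E B \<circ> E B = E B \<and> cadjoint (E B) = E B) \<and>
     E UNIV = id \<and>
     (\<forall>B. range B \<subseteq> sets borel \<and> disjoint_family B \<longrightarrow>
        (\<forall>\<xi>. (\<lambda>n::nat. E (B n) \<xi>) sums E (\<Union>n. B n) \<xi>))"

definition scalar_measure ::
    "('p::topological_space set \<Rightarrow> ('a::complex_hilbert \<Rightarrow> 'a)) \<Rightarrow> 'a \<Rightarrow> 'p measure" where
  "scalar_measure E \<xi> = measure_of UNIV (sets borel) (\<lambda>B. ennreal (Re (cinner \<xi> (E B \<xi>))))"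

text \<open>The operator \<open>\<integral> f dE\<close> for bounded Borel \<open>f\<close>, determined by its quadratic form.\<close>

definition has_spectral_integral ::
    "('p::topological_space set \<Rightarrow> ('a::complex_hilbert \<Rightarrow> 'a)) \<Rightarrow> ('p \<Rightarrow> complex) \<Rightarrow> ('a \<Rightarrow> 'a) \<Rightarrow> bool" where
  "has_spectral_integral E f x \<longleftrightarrow>
     bounded_clinear x \<and> (\<forall>\<xi>. cinner \<xi> (x \<xi>) = (\<integral>p. f p \<partial>scalar_measure E \<xi>))"

text \<open>The graph of the (in general unbounded) self-adjoint operator \<open>\<integral> \<lambda> dE(\<lambda>)\<close>.\<close>

definition spectral_graph :: "(real set \<Rightarrow> ('a::complex_hilbert \<Rightarrow> 'a)) \<Rightarrow> ('a \<times> 'a) set" where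
  "spectral_graph E =
     {(\<xi>, \<eta>). integrable (scalar_measure E \<xi>) (\<lambda>l. l\<^sup>2) \<and>
        (\<exists>x. (\<forall>n. has_spectral_integral E
                 (\<lambda>l. complex_of_real (indicator {- real n..real n} l * l)) (x n)) \<and>
             (\<lambda>n. x n \<xi>) \<longlonglongrightarrow> \<eta>)}"

definition spectral_support :: "('p::topological_space set \<Rightarrow> ('a::complex_hilbert \<Rightarrow> 'a)) \<Rightarrow> 'p set" where
  "spectral_support E = {p. \<forall>S. open S \<and> p \<in> S \<longrightarrow> (\<exists>\<xi>. E S \<xi> \<noteq> 0)}"


section \<open>Modular theory\<close>

text \<open>Unbounded operators are represented by their graphs.  The Tomita operator is the closure of
  \<open>x \<Omega> \<mapsto> x\<^sup>* \<Omega>\<close>; the adjoint of an antilinear operator \<open>S\<close> satisfies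
  \<open>\<langle>S \<xi>, \<eta>\<rangle> = \<langle>S\<^sup>* \<eta>, \<xi>\<rangle>\<close>; the modular operator is \<open>S\<^sup>* S\<close>.\<close>

definition tomita_operator :: "('a::complex_hilbert \<Rightarrow> 'a) set \<Rightarrow> 'a \<Rightarrow> ('a \<times> 'a) set" where
  "tomita_operator M \<Omega> = closure ((\<lambda>x. (x \<Omega>, cadjoint x \<Omega>)) ` M)"

definition antilinear_adjoint :: "('a::complex_hilbert \<times> 'a) set \<Rightarrow> ('a \<times> 'a) set" where
  "antilinear_adjoint S = {(\<eta>, \<zeta>). \<forall>(\<xi>, \<xi>')\<in>S. cinner \<xi>' \<eta> = cinner \<zeta> \<xi>}"

definition modular_operator :: "('a::complex_hilbert \<Rightarrow> 'a) set \<Rightarrow> 'a \<Rightarrow> ('a \<times> 'a) set" where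
  "modular_operator M \<Omega> = tomita_operator M \<Omega> O antilinear_adjoint (tomita_operator M \<Omega>)"

text \<open>\<open>\<sigma> t = \<Delta>\<^sup>i\<^sup>t\<close>, by the functional calculus of the spectral measure of \<open>\<Delta>\<close>.\<close>

definition is_modular_group ::
    "('a::complex_hilbert \<Rightarrow> 'a) set \<Rightarrow> 'a \<Rightarrow> (real \<Rightarrow> 'a \<Rightarrow> 'a) \<Rightarrow> bool" where
  "is_modular_group M \<Omega> \<sigma> \<longleftrightarrow>
     (\<exists>E. projection_valued_measure E \<and> spectral_graph E = modular_operator M \<Omega> \<and>
        (\<forall>t. has_spectral_integral E (\<lambda>l. complex_of_real l powr (\<i> * complex_of_real t)) (\<sigma> t)))"


section \<open>Two-dimensional Minkowski space and the Poincare group\<close>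

type_synonym point = "real \<times> real"

definition spacelike_separated :: "point set \<Rightarrow> point set \<Rightarrow> bool" where
  "spacelike_separated O1 O2 \<longleftrightarrow>
     (\<forall>a\<in>O1. \<forall>b\<in>O2. (fst a - fst b)\<^sup>2 < (snd a - snd b)\<^sup>2)"

definition boost :: "real \<Rightarrow> point \<Rightarrow> point" where
  "boost s a = (cosh s * fst a + sinh s * snd a, sinh s * fst a + cosh s * snd a)"

text \<open>In two dimensions the proper orthochronous Lorentz group is exactly the one-parameter group
  of boosts, with the rapidity as a global coordinate.\<close>

lemma boost_inj: "inj boost"
proof (rule injI)
  fix s t assume "boost s = boost t"
  then have "boost s (1, 0) = boost t (1, 0)" by simp
  then show "s = t" by (simp add: boost_def sinh_real_eq_iff)
qed

lemma proper_orthochronous_iff_boost: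
  fixes L :: "point \<Rightarrow> point"
  shows "(linear L \<and> (\<forall>a. (fst (L a))\<^sup>2 - (snd (L a))\<^sup>2 = (fst a)\<^sup>2 - (snd a)\<^sup>2) \<and>
          fst (L (1, 0)) * snd (L (0, 1)) - fst (L (0, 1)) * snd (L (1, 0)) = 1 \<and>
          fst (L (1, 0)) > 0)
         \<longleftrightarrow> (\<exists>s. L = boost s)"
proof
  assume "linear L \<and> (\<forall>a. (fst (L a))\<^sup>2 - (snd (L a))\<^sup>2 = (fst a)\<^sup>2 - (snd a)\<^sup>2) \<and>
          fst (L (1, 0)) * snd (L (0, 1)) - fst (L (0, 1)) * snd (L (1, 0)) = 1 \<and>
          fst (L (1, 0)) > 0"
  then have lin: "linear L" and form: "\<And>a. (fst (L a))\<^sup>2 - (snd (L a))\<^sup>2 = (fst a)\<^sup>2 - (snd a)\<^sup>2"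
    and det: "fst (L (1, 0)) * snd (L (0, 1)) - fst (L (0, 1)) * snd (L (1, 0)) = 1"
    and pos: "fst (L (1, 0)) > 0" by auto
  obtain p q where pq: "L (1, 0) = (p, q)" by fastforce
  obtain r w where rw: "L (0, 1) = (r, w)" by fastforce
  have L: "L (a, b) = (p * a + r * b, q * a + w * b)" for a b
  proof -
    have "L (a, b) = L (a *\<^sub>R (1, 0) + b *\<^sub>R (0, 1))" by simp
    also have "\<dots> = a *\<^sub>R L (1, 0) + b *\<^sub>R L (0, 1)"
      by (simp only: linear_add[OF lin] linear_cmul[OF lin])
    finally show ?thesis by (simp add: pq rw mult.commute)
  qed
  have 1: "p\<^sup>2 - q\<^sup>2 = 1" using form[of "(1, 0)"] pq by simp
  have 2: "r\<^sup>2 - w\<^sup>2 = -1" using form[of "(0, 1)"] rw by simp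
  have 3: "p * r = q * w"
    using form[of "(1, 1)"] 1 2 by (simp add: L power2_eq_square algebra_simps)
  have 4: "p * w - r * q = 1" using det pq rw by simp
  have "w = w * (p\<^sup>2 - q\<^sup>2)" using 1 by simp
  also have "\<dots> = p * (p * w - r * q) + q * (p * r - q * w)" by (simp add: power2_eq_square algebra_simps)
  also have "\<dots> = p" using 3 4 by simp
  finally have w: "w = p" .
  have r: "r = q" using 3 w pos pq by simp
  have sq: "sinh (arsinh q) = q" by simp
  have "(cosh (arsinh q))\<^sup>2 = p\<^sup>2" using 1 by (simp add: cosh_square_eq)
  then have "cosh (arsinh q) = p" using pos pq by (simp add: power2_eq_iff_nonneg)
  then have "L = boost (arsinh q)" using sq by (auto simp: fun_eq_iff L boost_def w r)
  then show "\<exists>s. L = boost s" ..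
next
  assume "\<exists>s. L = boost s"
  then obtain s where s: "L = boost s" ..
  have c: "(cosh s)\<^sup>2 - (sinh s)\<^sup>2 = 1" by (simp add: cosh_square_eq)
  have "linear (boost s)" by (rule linearI) (simp_all add: boost_def algebra_simps)
  moreover have "(fst (boost s a))\<^sup>2 - (snd (boost s a))\<^sup>2 = (fst a)\<^sup>2 - (snd a)\<^sup>2" for a
  proof -
    have "(fst (boost s a))\<^sup>2 - (snd (boost s a))\<^sup>2
        = ((cosh s)\<^sup>2 - (sinh s)\<^sup>2) * ((fst a)\<^sup>2 - (snd a)\<^sup>2)"
      by (simp add: boost_def power2_eq_square algebra_simps)
    then show ?thesis by (simp add: c)
  qed
  ultimately show "linear L \<and> (\<forall>a. (fst (L a))\<^sup>2 - (snd (L a))\<^sup>2 = (fst a)\<^sup>2 - (snd a)\<^sup>2) \<and>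
          fst (L (1, 0)) * snd (L (0, 1)) - fst (L (0, 1)) * snd (L (1, 0)) = 1 \<and>
          fst (L (1, 0)) > 0"
    using c by (simp add: s) (simp add: boost_def power2_eq_square)
qed

text \<open>The element \<open>(s, a)\<close> acts as \<open>b \<mapsto> \<Lambda>(s) b + a\<close>.\<close>

type_synonym poincare = "real \<times> point"

definition poincare_act :: "poincare \<Rightarrow> point \<Rightarrow> point" where
  "poincare_act g b = boost (fst g) b + snd g"

definition poincare_mult :: "poincare \<Rightarrow> poincare \<Rightarrow> poincare" where
  "poincare_mult g g' = (fst g + fst g', snd g + boost (fst g) (snd g'))"

lemma poincare_act_mult: "poincare_act (poincare_mult g g') b = poincare_act g (poincare_act g' b)"
  by (simp add: poincare_act_def poincare_mult_def boost_def cosh_add sinh_add algebra_simps prod_eq_iff)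

definition right_wedge :: "point set" where
  "right_wedge = {(t0, t1). t0 < t1 \<and> t0 > - t1}"

definition forward_cone :: "point set" where
  "forward_cone = {(p0, p1). p0 + p1 \<ge> 0 \<and> p0 - p1 \<ge> 0}"


section \<open>Poincare covariant nets\<close>

definition region :: "point set \<Rightarrow> bool" where
  "region R \<longleftrightarrow> open R \<and> bounded R"

definition unitary_representation :: "(poincare \<Rightarrow> 'a::complex_hilbert \<Rightarrow> 'a) \<Rightarrow> bool" where
  "unitary_representation U \<longleftrightarrow>
     (\<forall>g. unitary_op (U g)) \<and>
     (\<forall>g g'. U (poincare_mult g g') = U g \<circ> U g') \<and>
     (\<forall>\<xi>. continuous_on UNIV (\<lambda>g. U g \<xi>))"

definition translation :: "(poincare \<Rightarrow> 'a::complex_hilbert \<Rightarrow> 'a) \<Rightarrow> point \<Rightarrow> 'a \<Rightarrow> 'a" where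
  "translation U a = U (0, a)"

text \<open>The joint spectrum of the translations is the support of the joint spectral measure of their
  generators, \<open>T(a) = \<integral> exp (i (a\<^sub>0 p\<^sub>0 - a\<^sub>1 p\<^sub>1)) dE(p)\<close>.\<close>

definition spectrum_condition :: "(poincare \<Rightarrow> 'a::complex_hilbert \<Rightarrow> 'a) \<Rightarrow> bool" where
  "spectrum_condition U \<longleftrightarrow>
     (\<exists>E. projection_valued_measure E \<and>
        (\<forall>a. has_spectral_integral E (\<lambda>p. cis (fst a * fst p - snd a * snd p)) (translation U a)) \<and>
        spectral_support E \<subseteq> forward_cone)"

definition poincare_net ::
    "(point set \<Rightarrow> ('a::complex_hilbert \<Rightarrow> 'a) set) \<Rightarrow> (poincare \<Rightarrow> 'a \<Rightarrow> 'a) \<Rightarrow> 'a \<Rightarrow> bool" where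
  "poincare_net \<A> U \<Omega> \<longleftrightarrow>
     (\<forall>R. region R \<longrightarrow> von_neumann_algebra (\<A> R)) \<and>
     (\<forall>R1 R2. region R1 \<and> region R2 \<and> R1 \<subseteq> R2 \<longrightarrow> \<A> R1 \<subseteq> \<A> R2) \<and>
     (\<forall>R1 R2. region R1 \<and> region R2 \<and> spacelike_separated R1 R2 \<longrightarrow>
        (\<forall>x\<in>\<A> R1. \<forall>y\<in>\<A> R2. x \<circ> y = y \<circ> x)) \<and>
     (\<forall>R \<R>. region R \<and> (\<forall>D\<in>\<R>. region D) \<and> R = \<Union>\<R> \<longrightarrow> \<A> R = vn_generated (\<Union>D\<in>\<R>. \<A> D)) \<and>
     unitary_representation U \<and>
     (\<forall>g R. region R \<longrightarrow> (\<lambda>x. U g \<circ> x \<circ> cadjoint (U g)) ` \<A> R = \<A> (poincare_act g ` R)) \<and>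
     spectrum_condition U \<and>
     norm \<Omega> = 1 \<and> (\<forall>g. U g \<Omega> = \<Omega>) \<and>
     (\<forall>\<psi>. norm \<psi> = 1 \<and> (\<forall>g. U g \<psi> = \<psi>) \<longrightarrow> (\<exists>c. cmod c = 1 \<and> \<psi> = c *\<^sub>C \<Omega>)) \<and>
     cyclic_vector (vn_generated (\<Union>D\<in>{D. region D}. \<A> D)) \<Omega>"

definition wedge_algebra ::
    "(point set \<Rightarrow> ('a::complex_hilbert \<Rightarrow> 'a) set) \<Rightarrow> ('a \<Rightarrow> 'a) set" where
  "wedge_algebra \<A> = vn_generated (\<Union>D\<in>{D. region D \<and> D \<subseteq> right_wedge}. \<A> D)"

definition bisognano_wichmann ::
    "(point set \<Rightarrow> ('a::complex_hilbert \<Rightarrow> 'a) set) \<Rightarrow> (poincare \<Rightarrow> 'a \<Rightarrow> 'a) \<Rightarrow> 'a \<Rightarrow> bool" where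
  "bisognano_wichmann \<A> U \<Omega> \<longleftrightarrow>
     is_modular_group (wedge_algebra \<A>) \<Omega> (\<lambda>t. U (- 2 * pi * t, 0))"


section \<open>Asymptotic fields\<close>

definition smooth_function :: "(real \<Rightarrow> real) \<Rightarrow> bool" where
  "smooth_function h \<longleftrightarrow>
     (\<exists>D. D 0 = h \<and> (\<forall>n t. (D n has_real_derivative D (Suc n) t) (at t)))"

definition averaging_function :: "(real \<Rightarrow> real) \<Rightarrow> bool" where
  "averaging_function h \<longleftrightarrow>
     smooth_function h \<and> (\<forall>t. 0 \<le> h t) \<and> (\<forall>t. h (- t) = h t) \<and> has_bochner_integral lborel h 1"

definition rescaled :: "(real \<Rightarrow> real) \<Rightarrow> real \<Rightarrow> real \<Rightarrow> real \<Rightarrow> real" where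
  "rescaled h \<epsilon> T t = \<bar>T\<bar> powr (- \<epsilon>) * h (\<bar>T\<bar> powr (- \<epsilon>) * (t - T))"

definition translated :: "(poincare \<Rightarrow> 'a::complex_hilbert \<Rightarrow> 'a) \<Rightarrow> point \<Rightarrow> ('a \<Rightarrow> 'a) \<Rightarrow> ('a \<Rightarrow> 'a)" where
  "translated U a x = translation U a \<circ> x \<circ> cadjoint (translation U a)"

text \<open>\<open>y\<close> is the strong limit \<open>\<Phi>\<^sub>+\<^sup>o\<^sup>u\<^sup>t(x)\<close>; strong limits are unique, so this relation is
  single-valued.\<close>

definition has_asymptotic_field ::
    "(poincare \<Rightarrow> 'a::{complex_hilbert, second_countable_topology} \<Rightarrow> 'a) \<Rightarrow> (real \<Rightarrow> real) \<Rightarrow> real \<Rightarrow>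
     ('a \<Rightarrow> 'a) \<Rightarrow> ('a \<Rightarrow> 'a) \<Rightarrow> bool" where
  "has_asymptotic_field U h \<epsilon> x y \<longleftrightarrow>
     (\<forall>\<xi>. ((\<lambda>T. \<integral>t. rescaled h \<epsilon> T t *\<^sub>R translated U (t, t) x \<xi> \<partial>lborel) \<longlongrightarrow> y \<xi>) at_top)"

definition asymptotic_algebra ::
    "(point set \<Rightarrow> ('a::{complex_hilbert, second_countable_topology} \<Rightarrow> 'a) set) \<Rightarrow>
     (poincare \<Rightarrow> 'a \<Rightarrow> 'a) \<Rightarrow> (real \<Rightarrow> real) \<Rightarrow> real \<Rightarrow> ('a \<Rightarrow> 'a) set" where
  "asymptotic_algebra \<A> U h \<epsilon> =
     vn_generated {y. \<exists>D x. region D \<and> D \<subseteq> right_wedge \<and> x \<in> \<A> D \<and> has_asymptotic_field U h \<epsilon> x y}"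

end

(*
  All that matters about the net is that the lightlike translations V(t) = T(t,t) leave Omega fixed
  and map M = A(W_R) into itself for t >= 0.  The Bisognano-Wichmann property is used only to see that
  Omega is cyclic and separating for M: a kernel of the Tomita operator would be a kernel of the
  modular operator, on which its imaginary powers vanish instead of being unitary.

  Hence M'Omega is dense.  For x in M and y in M' the averages of x(t,t) y Omega equal, up to the
  negligible contribution of t < 0, y applied to the averages of V(t) x Omega, which converge to
  P_+ x Omega by the mean ergodic theorem.  So the strong limit E(x) exists for every x in M, it is
  the unique element of M with E(x) Omega = P_+ x Omega, and E is a conditional expectation onto the
  fixed point algebra F of M under V.  Finally F is generated by the images of the local operators,
  as matrix elements of E(x) are controlled by x Omega and x* Omega and hence continuous enough to
  apply the bicommutant theorem.
*)

theory Submission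
  imports Defs
begin

section \<open>Complex Hilbert spaces\<close>

text \<open>The obstacle is that no continuity of E in its argument is available beforehand: the
  bicommutant theorem supplies approximants of an element of M without any bound on their norms. So
  E is built on all of M at once instead of being extended from local operators, and its algebraic
  properties are passed to the limit from finite T or read off from E(x) Omega. The time windows are
  handled by the substitution t = T + T^eps u, after which the weight is the fixed function h: eps <
  1 sends every fixed u to infinite time, and eps > 0 turns a time shift s into the shift s T^(-eps)
  of u, which tends to 0. As h may have unbounded support, negative times occur; there V(t) x V(-t)
  may leave M, so only the limit is shown to lie in M, not the averages. In a matrix element of
  [z, E(a)] between vectors of M'Omega, one term evaluates E(a) on the right vector and the other
  its adjoint on the left vector. Hence two vectors must be approximated at once, and the
  bicommutant theorem is proved for pairs, on the direct sum of the Hilbert space with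
  itself.\<close>

lemma scaleC_minus_one: "(- 1) *\<^sub>C x = - (x::'a::complex_hilbert)"
  using scaleR_scaleC[of "-1" x] by simp

lemma cinner_add_left: "cinner (x + y) z = cinner x z + cinner (y::'a::complex_hilbert) z"
  by (metis cinner_add_right cinner_commute complex_cnj_add)

lemma cinner_scaleC_left: "cinner (c *\<^sub>C x) y = cnj c * cinner (x::'a::complex_hilbert) y"
  by (metis cinner_scaleC_right cinner_commute complex_cnj_mult)

lemma cinner_scaleR_left: "cinner (r *\<^sub>R x) y = r *\<^sub>R cinner (x::'a::complex_hilbert) y"
  by (simp add: scaleR_scaleC cinner_scaleC_left scaleR_conv_of_real)

lemma cinner_scaleR_right: "cinner x (r *\<^sub>R y) = r *\<^sub>R cinner (x::'a::complex_hilbert) y"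
  by (simp add: scaleR_scaleC cinner_scaleC_right scaleR_conv_of_real)

lemma cinner_self: "cinner x x = complex_of_real ((norm (x::'a::complex_hilbert))\<^sup>2)"
proof -
  have "Im (cinner x x) = 0"
    by (metis add.inverse_neutral cinner_commute complex_cnj cnj.sel(2) equal_neg_zero)
  moreover have "Re (cinner x x) \<ge> 0"
    using norm_ge_zero[of x] unfolding norm_eq_sqrt_cinner by simp
  ultimately show ?thesis
    by (simp add: norm_eq_sqrt_cinner complex_eq_iff)
qed

lemma cinner_zero_right [simp]: "cinner x 0 = (0::complex)" for x :: "'a::complex_hilbert"
  using cinner_add_right[of x 0 0] by simp

lemma cinner_zero_left [simp]: "cinner 0 x = (0::complex)" for x :: "'a::complex_hilbert"
  using cinner_add_left[of 0 0 x] by simp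

lemma cinner_minus_right: "cinner x (- y) = - cinner x y" for x :: "'a::complex_hilbert"
  using cinner_scaleR_right[of x "-1" y] by simp

lemma norm_add_square:
  "(norm (x + y))\<^sup>2 = (norm x)\<^sup>2 + 2 * Re (cinner x y) + (norm y)\<^sup>2" for x :: "'a::complex_hilbert"
proof -
  have "complex_of_real ((norm (x + y))\<^sup>2) = cinner (x + y) (x + y)" by (simp only: cinner_self)
  also have "\<dots> = of_real ((norm x)\<^sup>2) + (cinner x y + cinner y x) + of_real ((norm y)\<^sup>2)"
    unfolding cinner_self[symmetric] by (simp add: cinner_add_left cinner_add_right)
  also have "cinner x y + cinner y x = of_real (2 * Re (cinner x y))"
    using complex_add_cnj[of "cinner x y"] cinner_commute[of y x] by simp
  finally show ?thesis
    by (metis of_real_add of_real_eq_iff)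
qed

lemma norm_scaleC: "norm (c *\<^sub>C x) = cmod c * norm x" for x :: "'a::complex_hilbert"
proof -
  have "complex_of_real ((norm (c *\<^sub>C x))\<^sup>2) = c * cnj c * of_real ((norm x)\<^sup>2)"
    unfolding cinner_self[symmetric] by (simp add: cinner_scaleC_left cinner_scaleC_right)
  also have "\<dots> = complex_of_real ((cmod c * norm x)\<^sup>2)"
    unfolding power_mult_distrib of_real_mult complex_norm_square ..
  finally have "(norm (c *\<^sub>C x))\<^sup>2 = (cmod c * norm x)\<^sup>2" by (simp only: of_real_eq_iff)
  then show ?thesis by simp
qed

text \<open>The coefficient is the one that makes the difference orthogonal to \<open>x\<close>.
  Nonnegativity of the left side is the Cauchy-Schwarz inequality; the exact value reappears in the
  minimality argument of \<open>orthogonal_decomposition\<close>.\<close>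

lemma norm_diff_projection_square:
  fixes x y :: "'a::complex_hilbert"
  assumes "x \<noteq> 0"
  shows "(norm (y - (cinner x y / of_real ((norm x)\<^sup>2)) *\<^sub>C x))\<^sup>2
           = (norm y)\<^sup>2 - (cmod (cinner x y))\<^sup>2 / (norm x)\<^sup>2"
proof -
  define c where "c = - (cinner x y / of_real ((norm x)\<^sup>2))"
  have n: "norm x \<noteq> 0" using assms by simp
  have e: "y - (cinner x y / of_real ((norm x)\<^sup>2)) *\<^sub>C x = y + c *\<^sub>C x"
    unfolding c_def using scaleC_scaleC[of "-1"] by (metis diff_conv_add_uminus mult_minus1 scaleC_minus_one)
  have "cinner y (c *\<^sub>C x) = c * cnj (cinner x y)"
    using cinner_commute[of y x] by (simp add: cinner_scaleC_right)
  also have "\<dots> = - (of_real ((cmod (cinner x y))\<^sup>2 / (norm x)\<^sup>2))"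
    unfolding c_def of_real_divide complex_norm_square by simp
  finally have "Re (cinner y (c *\<^sub>C x)) = - ((cmod (cinner x y))\<^sup>2 / (norm x)\<^sup>2)" by simp
  moreover have "(norm (c *\<^sub>C x))\<^sup>2 = (cmod (cinner x y))\<^sup>2 / (norm x)\<^sup>2"
    using n unfolding norm_scaleC c_def
    by (simp add: norm_divide norm_mult norm_power power_mult_distrib power_divide field_simps power2_eq_square)
  ultimately show ?thesis unfolding e norm_add_square by simp
qed

lemma cinner_norm_le: "cmod (cinner x y) \<le> norm x * norm y" for x :: "'a::complex_hilbert"
proof (cases "x = 0")
  case False
  have "0 \<le> (norm y)\<^sup>2 - (cmod (cinner x y))\<^sup>2 / (norm x)\<^sup>2"
    unfolding norm_diff_projection_square[OF False, symmetric] by simp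
  then have "(cmod (cinner x y))\<^sup>2 \<le> (norm x * norm y)\<^sup>2"
    using False by (simp add: field_simps power_mult_distrib)
  then show ?thesis by (rule power2_le_imp_le) simp
qed simp

text \<open>Antilinearity in the first argument is still real linearity, so the library of real
  bilinear maps supplies limits, continuity and difference rules for both arguments.\<close>

interpretation cinner: bounded_bilinear "cinner :: 'a::complex_hilbert \<Rightarrow> 'a \<Rightarrow> complex"
  by unfold_locales
     (auto simp: cinner_add_left cinner_add_right cinner_scaleR_left cinner_scaleR_right
       intro!: exI[of _ 1] cinner_norm_le)

lemma cinner_ext: "(\<And>\<xi>. cinner \<xi> a = cinner \<xi> b) \<Longrightarrow> a = b" for a :: "'a::complex_hilbert"
  using cinner_self[of "a - b"] by (simp add: cinner.diff_right)

lemma scaleC_diff_right: "c *\<^sub>C (x - y) = c *\<^sub>C x - c *\<^sub>C y" for x :: "'a::complex_hilbert"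
  by (rule cinner_ext) (simp add: cinner.diff_right cinner_scaleC_right algebra_simps)

lemma scaleC_zero_right [simp]: "c *\<^sub>C 0 = (0::'a::complex_hilbert)"
  using scaleC_diff_right[of c 0 0] by simp

lemma scaleC_zero_left [simp]: "0 *\<^sub>C x = (0::'a::complex_hilbert)"
  by (rule cinner_ext) (simp add: cinner_scaleC_right)

lemma bounded_linear_scaleC: "bounded_linear (\<lambda>x. c *\<^sub>C (x::'a::complex_hilbert))"
  by (rule bounded_linear_intro[where K = "cmod c"])
     (simp_all add: scaleC_add_right scaleR_scaleC scaleC_scaleC norm_scaleC mult.commute)

lemma bounded_clinear_scaleC: "bounded_clinear (\<lambda>x. c *\<^sub>C (x::'a::complex_hilbert))"
  by (simp add: bounded_clinear_def bounded_linear_scaleC scaleC_scaleC mult.commute)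

lemma bounded_clinear_intro:
  fixes x :: "'a::complex_hilbert \<Rightarrow> 'a"
  assumes "\<And>\<xi> \<eta>. x (\<xi> + \<eta>) = x \<xi> + x \<eta>" "\<And>c \<xi>. x (c *\<^sub>C \<xi>) = c *\<^sub>C x \<xi>"
    "\<And>\<xi>. norm (x \<xi>) \<le> norm \<xi> * K"
  shows "bounded_clinear x"
  unfolding bounded_clinear_def using assms
  by (auto intro!: bounded_linear_intro[where K = K] simp: scaleR_scaleC)

context
  fixes x :: "'a::complex_hilbert \<Rightarrow> 'a"
  assumes x: "bounded_clinear x"
begin

lemma bounded_clinear_imp_bounded_linear: "bounded_linear x"
  using x by (simp add: bounded_clinear_def)

lemma bounded_clinear_add: "x (\<xi> + \<eta>) = x \<xi> + x \<eta>"
  using bounded_clinear_imp_bounded_linear by (rule bounded_linear.linear[THEN linear_add])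

lemma bounded_clinear_diff: "x (\<xi> - \<eta>) = x \<xi> - x \<eta>"
  using bounded_clinear_imp_bounded_linear by (rule bounded_linear.linear[THEN linear_diff])

lemma bounded_clinear_scaleC_apply: "x (c *\<^sub>C \<xi>) = c *\<^sub>C x \<xi>"
  using x by (simp add: bounded_clinear_def)

lemma bounded_clinear_zero: "x 0 = 0"
  using bounded_clinear_diff[of 0 0] by simp

lemma bounded_clinear_bound: obtains K where "K \<ge> 0" "\<And>\<xi>. norm (x \<xi>) \<le> norm \<xi> * K"
  using bounded_linear.nonneg_bounded[OF bounded_clinear_imp_bounded_linear] by blast

lemma bounded_clinear_continuous: "continuous_on A x"
  using bounded_clinear_imp_bounded_linear by (simp add: linear_continuous_on)

lemma bounded_clinear_tendsto: "(f \<longlongrightarrow> l) F \<Longrightarrow> ((\<lambda>t. x (f t)) \<longlongrightarrow> x l) F"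
  using bounded_clinear_imp_bounded_linear by (rule bounded_linear.tendsto)

end

lemma bounded_clinear_id: "bounded_clinear (id :: 'a::complex_hilbert \<Rightarrow> 'a)"
  by (rule bounded_clinear_intro[where K = 1]) auto

lemma bounded_clinear_comp:
  fixes x y :: "'a::complex_hilbert \<Rightarrow> 'a"
  assumes "bounded_clinear x" "bounded_clinear y"
  shows "bounded_clinear (x \<circ> y)"
  using assms unfolding bounded_clinear_def
  by (auto simp: comp_def intro: bounded_linear_compose)

lemma bounded_clinear_plus:
  fixes x y :: "'a::complex_hilbert \<Rightarrow> 'a"
  assumes "bounded_clinear x" "bounded_clinear y"
  shows "bounded_clinear (\<lambda>\<xi>. x \<xi> + y \<xi>)"
  using assms unfolding bounded_clinear_def
  by (auto simp: scaleC_add_right intro: bounded_linear_add)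

subsection \<open>Orthogonal projections\<close>

definition complex_subspace :: "'a::complex_hilbert set \<Rightarrow> bool" where
  "complex_subspace K \<longleftrightarrow>
     0 \<in> K \<and> (\<forall>x\<in>K. \<forall>y\<in>K. x + y \<in> K) \<and> (\<forall>c. \<forall>x\<in>K. c *\<^sub>C x \<in> K)"

lemma complex_subspaceD:
  assumes "complex_subspace K"
  shows "0 \<in> K" "\<And>x y. x \<in> K \<Longrightarrow> y \<in> K \<Longrightarrow> x + y \<in> K" "\<And>c x. x \<in> K \<Longrightarrow> c *\<^sub>C x \<in> K"
    "\<And>x y. x \<in> K \<Longrightarrow> y \<in> K \<Longrightarrow> x - y \<in> K"
proof -
  show a: "0 \<in> K" "\<And>x y. x \<in> K \<Longrightarrow> y \<in> K \<Longrightarrow> x + y \<in> K" "\<And>c x. x \<in> K \<Longrightarrow> c *\<^sub>C x \<in> K"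
    using assms by (auto simp: complex_subspace_def)
  show "x - y \<in> K" if "x \<in> K" "y \<in> K" for x y
    using a(2)[OF that(1) a(3)[OF that(2), of "-1"]] by (simp add: scaleC_minus_one)
qed

lemma closure_invariant:
  assumes "continuous_on (closure S) f" "\<And>x. x \<in> S \<Longrightarrow> f x \<in> closure S" "x \<in> closure S"
  shows "f x \<in> closure S"
  using image_closure_subset[OF assms(1) closed_closure] assms(2,3) by blast

lemma complex_subspace_closure:
  fixes K :: "'a::complex_hilbert set"
  assumes K: "complex_subspace K"
  shows "complex_subspace (closure K)"
proof -
  note k = complex_subspaceD[OF K]
  have 1: "x + y \<in> closure K" if "x \<in> K" "y \<in> closure K" for x y
    by (rule closure_invariant[OF _ _ that(2)]) (use k(2)[OF that(1)] closure_subset in \<open>auto intro!: continuous_intros\<close>)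
  have 2: "x + y \<in> closure K" if "x \<in> closure K" "y \<in> closure K" for x y
    by (rule closure_invariant[OF _ _ that(1)]) (use 1[OF _ that(2)] in \<open>auto intro!: continuous_intros\<close>)
  have 3: "c *\<^sub>C x \<in> closure K" if "x \<in> closure K" for x c
    by (rule closure_invariant[OF _ _ that])
       (use k(3) closure_subset in \<open>auto intro!: linear_continuous_on bounded_linear_scaleC\<close>)
  show ?thesis
    unfolding complex_subspace_def using k(1) closure_subset 2 3 by blast
qed

text \<open>A minimizing sequence for the distance from \<open>\<xi>\<close> to \<open>K\<close> is
  Cauchy by the parallelogram law. At its limit no correction along an element of \<open>K\<close>
  can shorten the residual, which forces orthogonality.\<close>

lemma orthogonal_decomposition:
  fixes K :: "'a::complex_hilbert set"
  assumes K: "complex_subspace K" and "closed K"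
  shows "\<exists>p\<in>K. \<forall>k\<in>K. cinner k (\<xi> - p) = 0"
proof -
  note k = complex_subspaceD[OF K]
  define d where "d = infdist \<xi> K"
  have ne: "K \<noteq> {}" using k(1) by auto
  have d0: "d \<ge> 0" by (simp add: d_def infdist_nonneg)
  have dle: "d \<le> norm (\<xi> - p)" if "p \<in> K" for p
    using infdist_le[OF that, of \<xi>] by (simp add: d_def dist_norm)
  have "\<exists>p\<in>K. norm (\<xi> - p) < d + inverse (real (Suc n))" for n
  proof -
    have "\<exists>p\<in>K. dist \<xi> p < d + inverse (real (Suc n))"
      using ne unfolding d_def infdist_def
      by (subst cINF_less_iff[symmetric]) (auto intro: bdd_belowI[of _ 0])
    then show ?thesis by (simp add: dist_norm)
  qed
  then obtain p where pK: "\<And>n. p n \<in> K" and pd: "\<And>n. norm (\<xi> - p n) < d + inverse (real (Suc n))"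
    by metis
  \<comment> \<open>The midpoint of \<open>p n\<close> and \<open>p m\<close> lies in
    \<open>K\<close>, so the sum of the two residuals, twice the residual of the midpoint, has norm
    at least \<open>2 * d\<close>.\<close>
  have par: "(norm (p n - p m))\<^sup>2 \<le> 2 * (norm (\<xi> - p n))\<^sup>2 + 2 * (norm (\<xi> - p m))\<^sup>2 - 4 * d\<^sup>2" for n m
  proof -
    let ?a = "\<xi> - p m" and ?b = "\<xi> - p n"
    have "(norm (?a - ?b))\<^sup>2 = 2 * (norm ?a)\<^sup>2 + 2 * (norm ?b)\<^sup>2 - (norm (?a + ?b))\<^sup>2"
      using norm_add_square[of ?a ?b] norm_add_square[of ?a "- ?b"]
      by (simp only: cinner_minus_right norm_minus_cancel diff_conv_add_uminus) simp
    moreover have "?a - ?b = p n - p m" by simp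
    moreover have "2 * d \<le> norm (?a + ?b)"
    proof -
      have "(1/2) *\<^sub>R (p n + p m) \<in> K" unfolding scaleR_scaleC using pK k by blast
      from dle[OF this] have "2 * d \<le> norm (2 *\<^sub>R (\<xi> - (1/2) *\<^sub>R (p n + p m)))" by simp
      also have "2 *\<^sub>R (\<xi> - (1/2) *\<^sub>R (p n + p m)) = ?a + ?b"
        by (simp add: scaleR_right_diff_distrib scaleR_2)
      finally show ?thesis .
    qed
    then have "(2 * d)\<^sup>2 \<le> (norm (?a + ?b))\<^sup>2" using d0 by (intro power_mono) auto
    ultimately show ?thesis by (simp add: power_mult_distrib)
  qed
  have lim: "(\<lambda>n. norm (\<xi> - p n)) \<longlonglongrightarrow> d"
  proof (rule tendsto_sandwich[of "\<lambda>_. d" _ _ "\<lambda>n. d + inverse (real (Suc n))"])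
    show "(\<lambda>n. d + inverse (real (Suc n))) \<longlonglongrightarrow> d"
      using tendsto_add[OF tendsto_const LIMSEQ_inverse_real_of_nat] by simp
  qed (use dle pK pd in \<open>auto intro!: always_eventually less_imp_le\<close>)
  have "Cauchy p"
  proof (rule metric_CauchyI)
    fix e :: real assume e: "e > 0"
    have "(\<lambda>n. (norm (\<xi> - p n))\<^sup>2) \<longlonglongrightarrow> d\<^sup>2" using lim by (intro tendsto_intros)
    moreover have "d\<^sup>2 < d\<^sup>2 + e\<^sup>2 / 4" using e by simp
    ultimately have "\<forall>\<^sub>F n in sequentially. (norm (\<xi> - p n))\<^sup>2 < d\<^sup>2 + e\<^sup>2 / 4"
      by (rule order_tendstoD(2))
    then obtain N where N: "\<And>n. n \<ge> N \<Longrightarrow> (norm (\<xi> - p n))\<^sup>2 < d\<^sup>2 + e\<^sup>2 / 4"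
      by (auto simp: eventually_sequentially)
    have "dist (p m) (p n) < e" if "m \<ge> N" "n \<ge> N" for m n
    proof -
      have "(norm (p m - p n))\<^sup>2 < e\<^sup>2" using par[of m n] N[OF that(1)] N[OF that(2)] by linarith
      then show ?thesis unfolding dist_norm using e by (simp add: power_less_imp_less_base)
    qed
    then show "\<exists>M. \<forall>m\<ge>M. \<forall>n\<ge>M. dist (p m) (p n) < e" by blast
  qed
  then obtain q where q: "p \<longlonglongrightarrow> q" using Cauchy_convergent_iff convergent_def by blast
  have qK: "q \<in> K" using closed_sequentially[OF \<open>closed K\<close> _ q] pK by blast
  have qd: "norm (\<xi> - q) = d"
    by (rule LIMSEQ_unique[OF _ lim]) (intro tendsto_intros q)
  have "cinner a (\<xi> - q) = 0" if "a \<in> K" for a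
  proof (cases "a = 0")
    case False
    \<comment> \<open>The optimal correction of \<open>q\<close> along \<open>a\<close>: it would
      lower the squared distance by the last term of \<open>norm_diff_projection_square\<close>, so
      that term must vanish.\<close>
    let ?c = "cinner a (\<xi> - q) / of_real ((norm a)\<^sup>2)"
    have "q + ?c *\<^sub>C a \<in> K" using k qK that by blast
    from dle[OF this] have "d\<^sup>2 \<le> (norm ((\<xi> - q) - ?c *\<^sub>C a))\<^sup>2"
      using d0 by (intro power_mono) (simp_all add: diff_diff_eq)
    then have "(cmod (cinner a (\<xi> - q)))\<^sup>2 / (norm a)\<^sup>2 \<le> 0"
      unfolding norm_diff_projection_square[OF False] qd by simp
    then show ?thesis using False by (simp add: divide_le_0_iff)
  qed simp
  with qK show ?thesis by blast
qed

text \<open>Choice suffices because \<open>proj_eqI\<close> identifies any candidate once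
  \<open>K\<close> is a closed complex subspace; for other sets the value carries no
  information.\<close>

definition proj :: "'a::complex_hilbert set \<Rightarrow> 'a \<Rightarrow> 'a" where
  "proj K \<xi> = (SOME p. p \<in> K \<and> (\<forall>k\<in>K. cinner k (\<xi> - p) = 0))"

context
  fixes K :: "'a::complex_hilbert set"
  assumes K: "complex_subspace K" and clK: "closed K"
begin

lemma proj_mem: "proj K \<xi> \<in> K"
  and proj_orthogonal: "k \<in> K \<Longrightarrow> cinner k (\<xi> - proj K \<xi>) = 0"
  using someI_ex[of "\<lambda>p. p \<in> K \<and> (\<forall>k\<in>K. cinner k (\<xi> - p) = 0)"]
    orthogonal_decomposition[OF K clK, of \<xi>]
  unfolding proj_def by blast+

lemma proj_eqI:
  assumes "p \<in> K" "\<And>k. k \<in> K \<Longrightarrow> cinner k (\<xi> - p) = 0"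
  shows "proj K \<xi> = p"
proof -
  let ?k = "proj K \<xi> - p"
  have "?k \<in> K" using complex_subspaceD(4)[OF K] proj_mem assms(1) by blast
  then have "cinner ?k (\<xi> - p) - cinner ?k (\<xi> - proj K \<xi>) = 0"
    using assms(2) proj_orthogonal by simp
  then have "cinner ?k ?k = 0" by (simp add: cinner.diff_right)
  then show ?thesis by (simp add: cinner_self)
qed

lemma proj_id: "\<xi> \<in> K \<Longrightarrow> proj K \<xi> = \<xi>"
  by (rule proj_eqI) auto

lemma norm_proj_le: "norm (proj K \<xi>) \<le> norm \<xi>"
proof -
  define p q where "p = proj K \<xi>" and "q = \<xi> - proj K \<xi>"
  have "cinner p q = 0" unfolding p_def q_def by (rule proj_orthogonal[OF proj_mem])
  then have "(norm (p + q))\<^sup>2 = (norm p)\<^sup>2 + (norm q)\<^sup>2" by (simp add: norm_add_square)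
  then have "(norm p)\<^sup>2 \<le> (norm (p + q))\<^sup>2" by simp
  then have "norm p \<le> norm (p + q)" by (rule power2_le_imp_le) simp
  then show ?thesis by (simp add: p_def q_def)
qed

lemma bounded_clinear_proj: "bounded_clinear (proj K)"
proof (rule bounded_clinear_intro[where K = 1])
  note k = complex_subspaceD[OF K]
  show "proj K (\<xi> + \<eta>) = proj K \<xi> + proj K \<eta>" for \<xi> \<eta>
  proof (rule proj_eqI)
    show "cinner k (\<xi> + \<eta> - (proj K \<xi> + proj K \<eta>)) = 0" if "k \<in> K" for k
      using proj_orthogonal[OF that, of \<xi>] proj_orthogonal[OF that, of \<eta>]
      by (simp add: cinner.diff_right cinner.add_right)
  qed (simp add: k proj_mem)
  show "proj K (c *\<^sub>C \<xi>) = c *\<^sub>C proj K \<xi>" for c \<xi>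
  proof (rule proj_eqI)
    show "cinner k (c *\<^sub>C \<xi> - c *\<^sub>C proj K \<xi>) = 0" if "k \<in> K" for k
      using proj_orthogonal[OF that, of \<xi>]
      by (simp add: cinner.diff_right cinner_scaleC_right)
  qed (simp add: k proj_mem)
qed (simp add: norm_proj_le)

lemma proj_selfadjoint: "cinner (proj K \<xi>) \<eta> = cinner \<xi> (proj K \<eta>)"
proof -
  have "cinner (proj K \<xi>) \<eta> = cinner (proj K \<xi>) (proj K \<eta>)"
    using proj_orthogonal[OF proj_mem, of \<xi> \<eta>] by (simp add: cinner.diff_right)
  also have "\<dots> = cinner \<xi> (proj K \<eta>)"
    using proj_orthogonal[OF proj_mem, of \<eta> \<xi>] cinner_commute[of "\<xi> - proj K \<xi>" "proj K \<eta>"]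
    by (simp add: cinner.diff_left)
  finally show ?thesis .
qed

end

lemma dense_if_orthogonal_zero:
  fixes K :: "'a::complex_hilbert set"
  assumes "complex_subspace K" "\<And>\<xi>. (\<And>k. k \<in> K \<Longrightarrow> cinner k \<xi> = 0) \<Longrightarrow> \<xi> = 0"
  shows "closure K = UNIV"
proof -
  have "\<xi> \<in> closure K" for \<xi>
  proof -
    obtain p where p: "p \<in> closure K" "\<forall>k\<in>closure K. cinner k (\<xi> - p) = 0"
      using orthogonal_decomposition[OF complex_subspace_closure[OF assms(1)] closed_closure] by blast
    then have "\<xi> - p = 0" using closure_subset by (intro assms(2)) blast
    with p show ?thesis by simp
  qed
  then show ?thesis by auto
qed

subsection \<open>Adjoints\<close>

text \<open>Off the trivial case the kernel has codimension one, so its orthogonal complement is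
  spanned by the residual \<open>q\<close> of any vector outside it. Subtracting the right multiple
  of \<open>q\<close> puts \<open>\<xi>\<close> into the kernel, and pairing with \<open>q\<close>
  gives the coefficient.\<close>

lemma riesz_representation:
  fixes f :: "'a::complex_hilbert \<Rightarrow> complex"
  assumes bl: "bounded_linear f" and sc: "\<And>c \<xi>. f (c *\<^sub>C \<xi>) = c * f \<xi>"
  shows "\<exists>y. \<forall>\<xi>. f \<xi> = cinner y \<xi>"
proof (cases "\<forall>\<xi>. f \<xi> = 0")
  case True
  then show ?thesis by (intro exI[of _ 0]) simp
next
  case False
  then obtain \<xi>0 where \<xi>0: "f \<xi>0 \<noteq> 0" by blast
  define K where "K = {\<xi>. f \<xi> = 0}"
  note add = linear_add[OF bounded_linear.linear[OF bl]] and diff = linear_diff[OF bounded_linear.linear[OF bl]]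
  have K: "complex_subspace K"
    unfolding K_def complex_subspace_def using linear_0[OF bounded_linear.linear[OF bl]]
    by (auto simp: add sc)
  have clK: "closed K"
    unfolding K_def by (intro closed_Collect_eq linear_continuous_on bl continuous_on_const)
  define q where "q = \<xi>0 - proj K \<xi>0"
  have fq: "f q = f \<xi>0"
    unfolding q_def diff using proj_mem[OF K clK, of \<xi>0] by (simp add: K_def)
  have q0: "q \<noteq> 0" using fq \<xi>0 linear_0[OF bounded_linear.linear[OF bl]] by auto
  have "f \<xi> = cinner ((cnj (f q) / of_real ((norm q)\<^sup>2)) *\<^sub>C q) \<xi>" for \<xi>
  proof -
    let ?k = "\<xi> - (f \<xi> / f q) *\<^sub>C q"
    have "?k \<in> K" using fq \<xi>0 by (simp add: K_def diff sc)
    then have "cinner ?k q = 0" unfolding q_def by (rule proj_orthogonal[OF K clK])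
    then have "cinner q ?k = 0" using cinner_commute[of q ?k] by simp
    then have "cinner q \<xi> = (f \<xi> / f q) * of_real ((norm q)\<^sup>2)"
      by (simp add: cinner.diff_right cinner_scaleC_right cinner_self)
    then show ?thesis using fq \<xi>0 q0 by (simp add: cinner_scaleC_left)
  qed
  then show ?thesis by blast
qed

text \<open>Nondegeneracy of the inner product makes the description by \<open>THE\<close> unique.
  All concrete adjoints are computed through this rule, which asks for no boundedness.\<close>

lemma cadjoint_eqI:
  fixes x y :: "'a::complex_hilbert \<Rightarrow> 'a"
  assumes "\<And>\<xi> \<eta>. cinner (x \<xi>) \<eta> = cinner \<xi> (y \<eta>)"
  shows "cadjoint x = y"
  unfolding cadjoint_def
proof (rule the_equality)
  show "z = y" if "\<forall>\<xi> \<eta>. cinner (x \<xi>) \<eta> = cinner \<xi> (z \<eta>)" for z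
  proof
    show "z \<eta> = y \<eta>" for \<eta> by (rule cinner_ext) (metis assms that)
  qed
qed (use assms in blast)

context
  fixes x :: "'a::complex_hilbert \<Rightarrow> 'a"
  assumes x: "bounded_clinear x"
begin

lemma cinner_cadjoint: "cinner (x \<xi>) \<eta> = cinner \<xi> (cadjoint x \<eta>)"
proof -
  have "\<exists>z. \<forall>\<xi>. cinner \<eta> (x \<xi>) = cinner z \<xi>" for \<eta>
    by (rule riesz_representation)
       (auto simp: bounded_clinear_scaleC_apply[OF x] cinner_scaleC_right
         intro: bounded_linear_compose[OF cinner.bounded_linear_right bounded_clinear_imp_bounded_linear[OF x]])
  then obtain y where y: "\<And>\<xi> \<eta>. cinner \<eta> (x \<xi>) = cinner (y \<eta>) \<xi>" by metis
  then have "\<And>\<xi> \<eta>. cinner (x \<xi>) \<eta> = cinner \<xi> (y \<eta>)" by (metis cinner_commute)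
  then show ?thesis using cadjoint_eqI[of x y] by simp
qed

lemma cinner_cadjoint_left: "cinner (cadjoint x \<xi>) \<eta> = cinner \<xi> (x \<eta>)"
  by (metis cinner_cadjoint cinner_commute)

lemma bounded_clinear_cadjoint: "bounded_clinear (cadjoint x)"
proof -
  obtain K where K: "K \<ge> 0" "\<And>\<xi>. norm (x \<xi>) \<le> norm \<xi> * K" using bounded_clinear_bound[OF x] by blast
  show ?thesis
  proof (rule bounded_clinear_intro[where K = K])
    show "cadjoint x (\<xi> + \<eta>) = cadjoint x \<xi> + cadjoint x \<eta>" for \<xi> \<eta>
      by (rule cinner_ext) (simp add: cinner_cadjoint[symmetric] cinner_add_right)
    show "cadjoint x (c *\<^sub>C \<xi>) = c *\<^sub>C cadjoint x \<xi>" for c \<xi>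
      by (rule cinner_ext) (simp add: cinner_cadjoint[symmetric] cinner_scaleC_right)
    show "norm (cadjoint x \<xi>) \<le> norm \<xi> * K" for \<xi>
    proof (cases "cadjoint x \<xi> = 0")
      case False
      have "(norm (cadjoint x \<xi>))\<^sup>2 = cmod (cinner (cadjoint x \<xi>) (cadjoint x \<xi>))"
        unfolding cinner_self by (simp only: norm_of_real abs_power2 norm_ge_zero abs_of_nonneg zero_le_power2)
      also have "\<dots> = cmod (cinner (x (cadjoint x \<xi>)) \<xi>)" by (simp add: cinner_cadjoint)
      also have "\<dots> \<le> norm (x (cadjoint x \<xi>)) * norm \<xi>" by (rule cinner_norm_le)
      also have "\<dots> \<le> norm (cadjoint x \<xi>) * K * norm \<xi>" by (intro mult_right_mono K) simp
      finally show ?thesis using False by (simp add: power2_eq_square mult_ac)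
    qed (simp add: K)
  qed
qed

lemma cadjoint_cadjoint: "cadjoint (cadjoint x) = x"
  by (rule cadjoint_eqI) (rule cinner_cadjoint_left)

end

lemma cadjoint_comp:
  fixes x y :: "'a::complex_hilbert \<Rightarrow> 'a"
  assumes "bounded_clinear x" "bounded_clinear y"
  shows "cadjoint (x \<circ> y) = cadjoint y \<circ> cadjoint x"
  by (rule cadjoint_eqI) (simp add: assms cinner_cadjoint)

section \<open>Commutants\<close>

lemma commutant_antimono: "S \<subseteq> T \<Longrightarrow> commutant T \<subseteq> commutant S"
  by (auto simp: commutant_def)

lemma commutantD:
  assumes "x \<in> commutant S"
  shows "bounded_clinear x" "\<And>y. y \<in> S \<Longrightarrow> x \<circ> y = y \<circ> x" "\<And>y \<xi>. y \<in> S \<Longrightarrow> x (y \<xi>) = y (x \<xi>)"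
proof -
  show a: "bounded_clinear x" "\<And>y. y \<in> S \<Longrightarrow> x \<circ> y = y \<circ> x"
    using assms by (auto simp: commutant_def)
  show "x (y \<xi>) = y (x \<xi>)" if "y \<in> S" for y \<xi> using a(2)[OF that] by (metis comp_apply)
qed

lemma commutantI:
  "bounded_clinear x \<Longrightarrow> (\<And>y \<xi>. y \<in> S \<Longrightarrow> x (y \<xi>) = y (x \<xi>)) \<Longrightarrow> x \<in> commutant S"
  by (auto simp: commutant_def fun_eq_iff)

lemma subset_bicommutant:
  assumes "\<And>x. x \<in> S \<Longrightarrow> bounded_clinear x"
  shows "S \<subseteq> commutant (commutant S)"
proof
  fix x assume x: "x \<in> S"
  show "x \<in> commutant (commutant S)"
    by (rule commutantI[OF assms[OF x]]) (rule commutantD(3)[OF _ x, symmetric])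
qed

lemma commutant_bicommutant:
  assumes "\<And>x. x \<in> S \<Longrightarrow> bounded_clinear x"
  shows "commutant (commutant (commutant S)) = commutant S"
proof
  show "commutant (commutant (commutant S)) \<subseteq> commutant S"
    by (rule commutant_antimono[OF subset_bicommutant[OF assms]])
  show "commutant S \<subseteq> commutant (commutant (commutant S))"
    by (rule subset_bicommutant) (rule commutantD(1))
qed

lemma cadjoint_mem_commutant:
  assumes "\<And>y. y \<in> S \<Longrightarrow> bounded_clinear y \<and> cadjoint y \<in> S" "x \<in> commutant S"
  shows "cadjoint x \<in> commutant S"
proof (rule commutantI)
  note x = commutantD[OF assms(2)]
  show "bounded_clinear (cadjoint x)" using x(1) by (rule bounded_clinear_cadjoint)
  fix y \<xi> assume y: "y \<in> S"
  then have "cadjoint (x \<circ> cadjoint y) = cadjoint (cadjoint y \<circ> x)"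
    using assms(1) x(2) by auto
  then have "y \<circ> cadjoint x = cadjoint x \<circ> y"
    using y assms(1) x(1) by (simp add: cadjoint_comp cadjoint_cadjoint)
  then show "cadjoint x (y \<xi>) = y (cadjoint x \<xi>)" by (metis comp_apply)
qed

lemma von_neumann_algebra_commutant:
  assumes "\<And>y. y \<in> S \<Longrightarrow> bounded_clinear y \<and> cadjoint y \<in> S"
  shows "von_neumann_algebra (commutant S)"
  unfolding von_neumann_algebra_def
proof (intro conjI ballI)
  show "commutant (commutant (commutant S)) = commutant S"
    by (rule commutant_bicommutant) (rule conjunct1[OF assms])
qed (use commutantD(1) cadjoint_mem_commutant[OF assms] in auto)

lemma bounded_clinear_cadjoint_union:
  fixes S :: "('a::complex_hilbert \<Rightarrow> 'a) set"
  assumes "\<And>x. x \<in> S \<Longrightarrow> bounded_clinear x" "y \<in> S \<union> cadjoint ` S"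
  shows "bounded_clinear y \<and> cadjoint y \<in> S \<union> cadjoint ` S"
  using assms by (auto simp: bounded_clinear_cadjoint cadjoint_cadjoint)

lemma von_neumann_algebra_vn_generated:
  assumes "\<And>x. x \<in> S \<Longrightarrow> bounded_clinear x"
  shows "von_neumann_algebra (vn_generated S)"
  unfolding vn_generated_def
  using commutantD(1) cadjoint_mem_commutant[OF bounded_clinear_cadjoint_union[OF assms]]
  by (intro von_neumann_algebra_commutant) blast

context
  fixes M :: "('a::complex_hilbert \<Rightarrow> 'a) set"
  assumes M: "von_neumann_algebra M"
begin

lemma von_neumann_algebra_bounded_clinear: "x \<in> M \<Longrightarrow> bounded_clinear x"
  and von_neumann_algebra_cadjoint: "x \<in> M \<Longrightarrow> cadjoint x \<in> M"
  and von_neumann_algebra_bicommutant: "commutant (commutant M) = M"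
  using M by (auto simp: von_neumann_algebra_def)

lemma von_neumann_algebra_memI:
  "bounded_clinear x \<Longrightarrow> (\<And>y \<xi>. y \<in> commutant M \<Longrightarrow> x (y \<xi>) = y (x \<xi>)) \<Longrightarrow> x \<in> M"
  by (metis von_neumann_algebra_bicommutant commutantI)

lemma von_neumann_algebra_id: "id \<in> M"
  by (rule von_neumann_algebra_memI) (simp_all add: bounded_clinear_id)

lemma von_neumann_algebra_comp:
  assumes "x \<in> M" "y \<in> M"
  shows "x \<circ> y \<in> M"
proof (rule von_neumann_algebra_memI)
  show "bounded_clinear (x \<circ> y)"
    using assms by (intro bounded_clinear_comp von_neumann_algebra_bounded_clinear)
  show "(x \<circ> y) (z \<xi>) = z ((x \<circ> y) \<xi>)" if "z \<in> commutant M" for z \<xi>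
    using commutantD(3)[OF that assms(1)] commutantD(3)[OF that assms(2)] by simp
qed

lemma von_neumann_algebra_plus:
  assumes "x \<in> M" "y \<in> M"
  shows "(\<lambda>\<xi>. x \<xi> + y \<xi>) \<in> M"
proof (rule von_neumann_algebra_memI)
  show "bounded_clinear (\<lambda>\<xi>. x \<xi> + y \<xi>)"
    using assms by (intro bounded_clinear_plus von_neumann_algebra_bounded_clinear)
  show "x (z \<xi>) + y (z \<xi>) = z (x \<xi> + y \<xi>)" if "z \<in> commutant M" for z \<xi>
    using commutantD(3)[OF that assms(1)] commutantD(3)[OF that assms(2)]
      bounded_clinear_add[OF commutantD(1)[OF that]] by simp
qed

lemma von_neumann_algebra_scaleC:
  assumes "x \<in> M"
  shows "(\<lambda>\<xi>. c *\<^sub>C x \<xi>) \<in> M"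
proof (rule von_neumann_algebra_memI)
  show "bounded_clinear (\<lambda>\<xi>. c *\<^sub>C x \<xi>)"
    using bounded_clinear_comp[OF bounded_clinear_scaleC von_neumann_algebra_bounded_clinear[OF assms]]
    by (simp add: comp_def)
  show "c *\<^sub>C x (z \<xi>) = z (c *\<^sub>C x \<xi>)" if "z \<in> commutant M" for z \<xi>
    using commutantD(3)[OF that assms] bounded_clinear_scaleC_apply[OF commutantD(1)[OF that]] by simp
qed

lemma von_neumann_algebra_commutant': "von_neumann_algebra (commutant M)"
  by (rule von_neumann_algebra_commutant)
     (simp add: von_neumann_algebra_bounded_clinear von_neumann_algebra_cadjoint)

lemma vn_generated_subset: "S \<subseteq> M \<Longrightarrow> vn_generated S \<subseteq> M"
  unfolding vn_generated_def
  by (subst von_neumann_algebra_bicommutant[symmetric], intro commutant_antimono)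
     (auto intro: von_neumann_algebra_cadjoint)

lemma complex_subspace_orbit: "complex_subspace ((\<lambda>x. x \<xi>) ` M)"
  unfolding complex_subspace_def
proof (intro conjI ballI allI)
  have "0 *\<^sub>C id \<xi> \<in> (\<lambda>x. x \<xi>) ` M"
    by (rule image_eqI[OF _ von_neumann_algebra_scaleC[OF von_neumann_algebra_id]]) (rule refl)
  then show "0 \<in> (\<lambda>x. x \<xi>) ` M" by simp
next
  fix u v assume "u \<in> (\<lambda>x. x \<xi>) ` M" "v \<in> (\<lambda>x. x \<xi>) ` M"
  then obtain x y where "x \<in> M" "y \<in> M" "u = x \<xi>" "v = y \<xi>" by blast
  then show "u + v \<in> (\<lambda>x. x \<xi>) ` M"
    by (intro image_eqI[OF _ von_neumann_algebra_plus[of x y]]) auto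
next
  fix c u assume "u \<in> (\<lambda>x. x \<xi>) ` M"
  then obtain x where "x \<in> M" "u = x \<xi>" by blast
  then show "c *\<^sub>C u \<in> (\<lambda>x. x \<xi>) ` M"
    by (intro image_eqI[OF _ von_neumann_algebra_scaleC[of x c]]) auto
qed

end

text \<open>As the adjoint of \<open>b\<close> also preserves \<open>K\<close>, \<open>b\<close>
  preserves the orthogonal complement as well; so it maps the decomposition of \<open>\<xi>\<close>
  to that of \<open>b \<xi>\<close>.\<close>

lemma proj_mem_commutant:
  assumes K: "complex_subspace K" "closed K"
    and B: "\<And>b. b \<in> B \<Longrightarrow> bounded_clinear b \<and> cadjoint b \<in> B"
    and inv: "\<And>b \<xi>. b \<in> B \<Longrightarrow> \<xi> \<in> K \<Longrightarrow> b \<xi> \<in> K"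
  shows "proj K \<in> commutant B"
proof (rule commutantI)
  show "proj K (b \<xi>) = b (proj K \<xi>)" if b: "b \<in> B" for b \<xi>
  proof (rule proj_eqI[OF K])
    show "b (proj K \<xi>) \<in> K" using inv[OF b proj_mem[OF K]] .
    fix k assume k: "k \<in> K"
    have "cinner k (b \<xi> - b (proj K \<xi>)) = cinner (cadjoint b k) (\<xi> - proj K \<xi>)"
      using B[OF b] by (simp add: cinner_cadjoint_left cinner.diff_right)
    also have "\<dots> = 0" using proj_orthogonal[OF K] inv B[OF b] k by blast
    finally show "cinner k (b \<xi> - b (proj K \<xi>)) = 0" .
  qed
qed (rule bounded_clinear_proj[OF K])

text \<open>The projection onto the closure of M'Omega commutes with M', hence belongs to M by the
  bicommutant property. It fixes Omega, so its complement is an element of M that kills Omega and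
  must be zero.\<close>

lemma cyclic_commutant_if_separating:
  assumes M: "von_neumann_algebra M"
    and sep: "\<And>x. x \<in> M \<Longrightarrow> x \<Omega> = 0 \<Longrightarrow> x = (\<lambda>_. 0)"
  shows "closure ((\<lambda>x. x \<Omega>) ` commutant M) = UNIV"
proof -
  note M' = von_neumann_algebra_commutant'[OF M]
  let ?S = "(\<lambda>x. x \<Omega>) ` commutant M"
  let ?K = "closure ?S"
  have K: "complex_subspace ?K" "closed ?K"
    by (auto intro: complex_subspace_closure complex_subspace_orbit[OF M'])
  have "proj ?K \<in> commutant (commutant M)"
  proof (rule proj_mem_commutant[OF K])
    show "bounded_clinear b \<and> cadjoint b \<in> commutant M" if "b \<in> commutant M" for b
      using von_neumann_algebra_bounded_clinear[OF M' that] von_neumann_algebra_cadjoint[OF M' that] by simp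
    show "b \<xi> \<in> ?K" if b: "b \<in> commutant M" and \<xi>: "\<xi> \<in> ?K" for b \<xi>
    proof (rule closure_invariant[OF _ _ \<xi>])
      fix \<eta> assume "\<eta> \<in> ?S"
      then obtain y where y: "y \<in> commutant M" "\<eta> = y \<Omega>" by blast
      have "b \<eta> \<in> ?S"
        by (rule image_eqI[OF _ von_neumann_algebra_comp[OF M' b y(1)]]) (simp add: y(2))
      then show "b \<eta> \<in> ?K" by (rule subsetD[OF closure_subset])
    qed (use von_neumann_algebra_bounded_clinear[OF M' b] bounded_clinear_continuous in blast)
  qed
  then have pM: "proj ?K \<in> M" by (simp add: von_neumann_algebra_bicommutant[OF M])
  have "\<Omega> \<in> ?S" by (rule image_eqI[OF _ von_neumann_algebra_id[OF M']]) simp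
  then have p\<Omega>: "proj ?K \<Omega> = \<Omega>" by (intro proj_id[OF K] subsetD[OF closure_subset])
  \<comment> \<open>The complementary projection, spelled as a sum and a multiple so that the
    closure rules for von Neumann algebras apply literally.\<close>
  define q where "q \<xi> = id \<xi> + (- 1) *\<^sub>C proj ?K \<xi>" for \<xi>
  have "q \<in> M" unfolding q_def[abs_def]
    using von_neumann_algebra_plus[OF M von_neumann_algebra_id[OF M] von_neumann_algebra_scaleC[OF M pM]] .
  moreover have "q \<Omega> = 0" by (simp add: q_def p\<Omega> scaleC_minus_one)
  ultimately have "q = (\<lambda>_. 0)" by (rule sep)
  then have q0: "q \<xi> = 0" for \<xi> by (rule fun_cong)
  have "\<xi> = proj ?K \<xi>" for \<xi>
    using q0[of \<xi>] unfolding q_def scaleC_minus_one by simp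
  then have "\<xi> \<in> ?K" for \<xi> using proj_mem[OF K, of \<xi>] by (rule ssubst)
  then show ?thesis by (rule UNIV_eq_I[symmetric])
qed

subsection \<open>Density of a unital *-algebra in its bicommutant\<close>

text \<open>On the direct sum a pair of vectors is one vector, and an operator acts diagonally; this
  is the amplification used for the bicommutant theorem with two vectors.\<close>

instantiation prod :: (complex_hilbert, complex_hilbert) complex_hilbert
begin

definition "c *\<^sub>C p = (c *\<^sub>C fst p, c *\<^sub>C snd p)"

definition "cinner p q = cinner (fst p) (fst q) + cinner (snd p) (snd q)"

instance
proof
  fix p q r :: "'a \<times> 'b" and c d :: complex and s :: real
  show "c *\<^sub>C (p + q) = c *\<^sub>C p + c *\<^sub>C q" by (simp add: scaleC_prod_def scaleC_add_right)
  show "(c + d) *\<^sub>C p = c *\<^sub>C p + d *\<^sub>C p" by (simp add: scaleC_prod_def scaleC_add_left)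
  show "c *\<^sub>C (d *\<^sub>C p) = (c * d) *\<^sub>C p" by (simp add: scaleC_prod_def scaleC_scaleC)
  show "s *\<^sub>R p = complex_of_real s *\<^sub>C p" by (simp add: scaleC_prod_def scaleR_prod_def scaleR_scaleC)
  show "cinner p q = cnj (cinner q p)"
    unfolding cinner_prod_def complex_cnj_add by (metis cinner_commute)
  show "cinner p (q + r) = cinner p q + cinner p r" by (simp add: cinner_prod_def cinner_add_right)
  show "cinner p (c *\<^sub>C q) = c * cinner p q"
    by (simp add: cinner_prod_def scaleC_prod_def cinner_scaleC_right distrib_left)
  show "norm p = sqrt (Re (cinner p p))" by (simp add: cinner_prod_def norm_prod_def cinner_self)
qed

end

lemma bounded_clinear_diagonal:
  assumes b: "bounded_clinear b"
  shows "bounded_clinear (map_prod b b)"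
proof -
  obtain K where K: "K \<ge> 0" "\<And>\<xi>. norm (b \<xi>) \<le> norm \<xi> * K" using bounded_clinear_bound[OF b] by blast
  show ?thesis
  proof (rule bounded_clinear_intro[where K = K])
    show "norm (map_prod b b p) \<le> norm p * K" for p
    proof (rule power2_le_imp_le)
      have "(norm (b (fst p)))\<^sup>2 + (norm (b (snd p)))\<^sup>2 \<le> (norm (fst p) * K)\<^sup>2 + (norm (snd p) * K)\<^sup>2"
        by (intro add_mono power_mono K norm_ge_zero)
      then show "(norm (map_prod b b p))\<^sup>2 \<le> (norm p * K)\<^sup>2"
        by (simp add: norm_prod_def map_prod_def split_beta power_mult_distrib distrib_right)
    qed (use K in simp)
  qed (auto simp: map_prod_def split_beta scaleC_prod_def bounded_clinear_add[OF b]
        bounded_clinear_scaleC_apply[OF b])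
qed

lemma cadjoint_diagonal:
  assumes "bounded_clinear b"
  shows "cadjoint (map_prod b b) = map_prod (cadjoint b) (cadjoint b)"
  by (rule cadjoint_eqI) (simp add: cinner_prod_def map_prod_def split_beta cinner_cadjoint[OF assms])

text \<open>The double commutant theorem in dual form: \<open>(a \<xi>1, a \<xi>2)\<close> lies in
  the closure of the diagonal orbit of \<open>(\<xi>1, \<xi>2)\<close> under \<open>B\<close>, so a
  functional vanishing on that orbit vanishes there too. The projection onto the closed orbit
  commutes with the diagonal action of \<open>B\<close>, hence with that of
  \<open>a\<close>.\<close>

lemma bicommutant_two_vectors:
  fixes B :: "('a::complex_hilbert \<Rightarrow> 'a) set"
  assumes B: "\<And>b. b \<in> B \<Longrightarrow> bounded_clinear b \<and> cadjoint b \<in> B"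
    and id: "id \<in> B"
    and comp: "\<And>b c. b \<in> B \<Longrightarrow> c \<in> B \<Longrightarrow> b \<circ> c \<in> B"
    and plus: "\<And>b c. b \<in> B \<Longrightarrow> c \<in> B \<Longrightarrow> (\<lambda>\<xi>. b \<xi> + c \<xi>) \<in> B"
    and scaleC: "\<And>b c. b \<in> B \<Longrightarrow> (\<lambda>\<xi>. c *\<^sub>C b \<xi>) \<in> B"
    and a: "a \<in> commutant (commutant B)"
    and van: "\<And>b. b \<in> B \<Longrightarrow> cinner \<zeta>1 (b \<xi>1) + cinner \<zeta>2 (b \<xi>2) = 0"
  shows "cinner \<zeta>1 (a \<xi>1) + cinner \<zeta>2 (a \<xi>2) = 0"
proof -
  define S where "S = (\<lambda>b. (b \<xi>1, b \<xi>2)) ` B"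
  define D where "D b = map_prod b b" for b :: "'a \<Rightarrow> 'a"
  have DB: "c \<in> D ` B \<Longrightarrow> bounded_clinear c \<and> cadjoint c \<in> D ` B" for c
    using B by (auto simp: D_def bounded_clinear_diagonal cadjoint_diagonal)
  have "complex_subspace S"
    unfolding complex_subspace_def
  proof (intro conjI ballI allI)
    show "0 \<in> S" unfolding S_def
      by (rule image_eqI[OF _ scaleC[OF id, of 0]]) (simp add: zero_prod_def)
  next
    fix u v assume "u \<in> S" "v \<in> S"
    then obtain b c where "b \<in> B" "c \<in> B" "u = (b \<xi>1, b \<xi>2)" "v = (c \<xi>1, c \<xi>2)"
      unfolding S_def by blast
    then show "u + v \<in> S" unfolding S_def
      by (intro image_eqI[OF _ plus[of b c]]) auto
  next
    fix c u assume "u \<in> S"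
    then obtain b where "b \<in> B" "u = (b \<xi>1, b \<xi>2)" unfolding S_def by blast
    then show "c *\<^sub>C u \<in> S" unfolding S_def
      by (intro image_eqI[OF _ scaleC[of b c]]) (auto simp: scaleC_prod_def)
  qed
  then have K: "complex_subspace (closure S)" "closed (closure S)"
    by (auto intro: complex_subspace_closure)
  let ?p = "proj (closure S)"
  have "?p \<in> commutant (D ` B)"
  proof (rule proj_mem_commutant[OF K])
    show "bounded_clinear c \<and> cadjoint c \<in> D ` B" if "c \<in> D ` B" for c using that by (rule DB)
    fix c \<xi> assume c: "c \<in> D ` B" and \<xi>: "\<xi> \<in> closure S"
    then obtain b where b: "b \<in> B" "c = D b" by blast
    show "c \<xi> \<in> closure S"
    proof (rule closure_invariant[OF _ _ \<xi>])
      show "continuous_on (closure S) c" using DB[OF c] by (intro bounded_clinear_continuous) simp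
      fix \<eta> assume "\<eta> \<in> S"
      then obtain b' where b': "b' \<in> B" "\<eta> = (b' \<xi>1, b' \<xi>2)" unfolding S_def by blast
      have "c \<eta> \<in> S" unfolding S_def
        by (rule image_eqI[OF _ comp[OF b(1) b'(1)]]) (simp add: b b' D_def)
      then show "c \<eta> \<in> closure S" by (rule subsetD[OF closure_subset])
    qed
  qed
  then have pD: "?p (map_prod b b \<xi>) = map_prod b b (?p \<xi>)" if "b \<in> B" for b \<xi>
    using commutantD(3)[of ?p "D ` B" "D b" \<xi>] that by (simp add: D_def)
  note p = bounded_clinear_proj[OF K]
  \<comment> \<open>The four entries of the 2 by 2 operator matrix of \<open>?p\<close> at once:
    \<open>\<iota>\<close> stands for either embedding of a summand and \<open>\<pi>\<close> for
    either coordinate map.\<close>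
  have entry: "(\<lambda>\<xi>. \<pi> (?p (\<iota> \<xi>))) \<in> commutant B"
    if \<iota>: "\<And>x y. \<iota> (x + y) = \<iota> x + \<iota> y" "\<And>c x. \<iota> (c *\<^sub>C x) = c *\<^sub>C \<iota> x" "\<And>x. norm (\<iota> x) = norm x"
      "\<And>b x. b \<in> B \<Longrightarrow> \<iota> (b x) = map_prod b b (\<iota> x)"
    and \<pi>: "\<And>x y. \<pi> (x + y) = \<pi> x + \<pi> y" "\<And>c x. \<pi> (c *\<^sub>C x) = c *\<^sub>C \<pi> x" "\<And>x. norm (\<pi> x) \<le> norm x"
      "\<And>b x. \<pi> (map_prod b b x) = b (\<pi> x)"
    for \<iota> :: "'a \<Rightarrow> 'a \<times> 'a" and \<pi> :: "'a \<times> 'a \<Rightarrow> 'a"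
  proof (rule commutantI)
    show "bounded_clinear (\<lambda>\<xi>. \<pi> (?p (\<iota> \<xi>)))"
    proof (rule bounded_clinear_intro[where K = 1])
      show "norm (\<pi> (?p (\<iota> \<xi>))) \<le> norm \<xi> * 1" for \<xi>
        using \<pi>(3)[of "?p (\<iota> \<xi>)"] norm_proj_le[OF K, of "\<iota> \<xi>"] by (simp add: \<iota>(3))
    qed (simp_all add: \<iota> \<pi> bounded_clinear_add[OF p] bounded_clinear_scaleC_apply[OF p])
  qed (simp add: \<iota>(4) pD \<pi>(4))
  have b0: "b \<in> B \<Longrightarrow> b 0 = 0" for b using B bounded_clinear_zero by blast
  have sc0: "c *\<^sub>C (x, 0) = (c *\<^sub>C x, 0)" "c *\<^sub>C (0, x) = (0, c *\<^sub>C x)" for c and x :: 'a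
    by (simp_all add: scaleC_prod_def)
  have \<iota>: "norm (x, 0::'a) = norm x" "norm (0::'a, x) = norm x" for x :: 'a
    by simp_all
  have \<pi>: "fst (c *\<^sub>C z) = c *\<^sub>C fst z" "snd (c *\<^sub>C z) = c *\<^sub>C snd z"
    "norm (fst z) \<le> norm z" "norm (snd z) \<le> norm z" for c and z :: "'a \<times> 'a"
    using norm_fst_le[of "fst z" "snd z"] norm_snd_le[of "snd z" "fst z"] by (simp_all add: scaleC_prod_def)
  have "(\<lambda>\<xi>. fst (?p (\<xi>, 0))) \<in> commutant B" "(\<lambda>\<xi>. snd (?p (\<xi>, 0))) \<in> commutant B"
    "(\<lambda>\<xi>. fst (?p (0, \<xi>))) \<in> commutant B" "(\<lambda>\<xi>. snd (?p (0, \<xi>))) \<in> commutant B"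
    by (rule entry; simp add: b0 sc0 \<iota> \<pi>)+
  note e = this[THEN commutantD(3)[OF a], symmetric]
  have a_add: "a (x + y) = a x + a y" for x y by (rule bounded_clinear_add[OF commutantD(1)[OF a]])
  have split: "?p (x, y) = ?p (x, 0) + ?p (0, y)" for x y
    using bounded_clinear_add[OF p, of "(x, 0)" "(0, y)"] by simp
  \<comment> \<open>Since \<open>a\<close> commutes with each matrix entry, the diagonal action of
    \<open>a\<close> commutes with \<open>?p\<close>.\<close>
  have ap: "?p (a x, a y) = (a (fst (?p (x, y))), a (snd (?p (x, y))))" for x y
    unfolding split[of x y] split[of "a x" "a y"] by (simp add: prod_eq_iff e a_add)
  have "(\<xi>1, \<xi>2) \<in> S" unfolding S_def by (rule image_eqI[OF _ id]) simp
  then have "?p (\<xi>1, \<xi>2) = (\<xi>1, \<xi>2)" by (intro proj_id[OF K] subsetD[OF closure_subset])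
  then have "?p (a \<xi>1, a \<xi>2) = (a \<xi>1, a \<xi>2)" by (simp add: ap)
  moreover have "?p (a \<xi>1, a \<xi>2) \<in> closure S" by (rule proj_mem[OF K])
  ultimately have mem: "(a \<xi>1, a \<xi>2) \<in> closure S" by (rule subst)
  have "closure S \<subseteq> {v. cinner (\<zeta>1, \<zeta>2) v = 0}"
  proof (rule closure_minimal)
    show "S \<subseteq> {v. cinner (\<zeta>1, \<zeta>2) v = 0}"
      using van by (auto simp: S_def cinner_prod_def)
    show "closed {v. cinner (\<zeta>1, \<zeta>2) v = 0}"
      by (intro closed_Collect_eq linear_continuous_on cinner.bounded_linear_right continuous_on_const)
  qed
  with mem show ?thesis by (auto simp: cinner_prod_def)
qed

section \<open>The vacuum is cyclic and separating for an algebra with a modular group\<close>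

context
  fixes E :: "'p::topological_space set \<Rightarrow> 'a::complex_hilbert \<Rightarrow> 'a"
  assumes E: "projection_valued_measure E"
begin

lemma projection_valued_measureD:
  assumes "B \<in> sets borel"
  shows "bounded_clinear (E B)" "E B (E B \<xi>) = E B \<xi>" "cadjoint (E B) = E B"
  using E assms unfolding projection_valued_measure_def by (auto simp: fun_eq_iff)

lemma projection_valued_measure_sums:
  fixes B :: "nat \<Rightarrow> 'p set"
  shows "range B \<subseteq> sets borel \<Longrightarrow> disjoint_family B \<Longrightarrow> (\<lambda>n. E (B n) \<xi>) sums E (\<Union>n. B n) \<xi>"
  using E unfolding projection_valued_measure_def by blast

lemma projection_valued_measure_UNIV: "E UNIV \<xi> = \<xi>"
  using E by (simp add: projection_valued_measure_def)

text \<open>The constant sequence of empty sets is disjoint, and a convergent series with constant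
  terms has zero terms.\<close>

lemma projection_valued_measure_empty: "E {} \<xi> = 0"
proof -
  have "(\<lambda>n::nat. E {} \<xi>) sums E {} \<xi>"
    using projection_valued_measure_sums[of "\<lambda>_. {}" \<xi>] by (simp add: disjoint_family_on_def)
  then show ?thesis
    using summable_LIMSEQ_zero[of "\<lambda>n::nat. E {} \<xi>"] by (auto simp: summable_def LIMSEQ_const_iff)
qed

lemma projection_valued_measure_Un:
  assumes "A \<in> sets borel" "B \<in> sets borel" "A \<inter> B = {}"
  shows "E (A \<union> B) \<xi> = E A \<xi> + E B \<xi>"
proof -
  have "disjoint_family (binaryset A B)"
    using assms(3) by (auto simp: disjoint_family_on_def binaryset_def)
  then have "(\<lambda>n. E (binaryset A B n) \<xi>) sums E (A \<union> B) \<xi>"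
    using projection_valued_measure_sums[of "binaryset A B" \<xi>] assms
    by (simp add: range_binaryset_eq UN_binaryset_eq)
  moreover have "(\<lambda>n. E (binaryset A B n) \<xi>) sums (E A \<xi> + E B \<xi>)"
    using binaryset_sums[of "\<lambda>C. E C \<xi>" A B] by (simp add: projection_valued_measure_empty)
  ultimately show ?thesis by (rule sums_unique2)
qed

text \<open>Multiplicativity is not part of the definition. The sum of the two projections is again
  a projection, so they anticommute; multiplying that relation by \<open>E A\<close> from the left
  and from the right shows that they also commute, so the product is zero.\<close>

lemma projection_valued_measure_disjoint:
  assumes "A \<in> sets borel" "B \<in> sets borel" "A \<inter> B = {}"
  shows "E A (E B \<xi>) = 0"
proof -
  note p = projection_valued_measureD
  note add = bounded_clinear_add[OF p(1)]
  have U: "A \<union> B \<in> sets borel" using assms by simp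
  have anti: "E A (E B \<eta>) + E B (E A \<eta>) = 0" for \<eta>
  proof -
    have "E (A \<union> B) (E (A \<union> B) \<eta>) = E (A \<union> B) \<eta>" by (rule p(2)[OF U])
    then have "(E A \<eta> + E A (E B \<eta>)) + (E B (E A \<eta>) + E B \<eta>) = E A \<eta> + E B \<eta>"
      by (simp only: projection_valued_measure_Un[OF assms] add[OF assms(1)] add[OF assms(2)]
          p(2)[OF assms(1)] p(2)[OF assms(2)])
    moreover have "u + v = (x + u) + (v + y) - (x + y)" for u v x y :: 'a by simp
    ultimately show ?thesis by (metis right_minus_eq)
  qed
  have "E A (E A (E B \<xi>)) + E A (E B (E A \<xi>)) = 0"
    unfolding add[OF assms(1), symmetric] anti by (rule bounded_clinear_zero[OF p(1)[OF assms(1)]])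
  then have 1: "E A (E B \<xi>) = - E A (E B (E A \<xi>))"
    unfolding p(2)[OF assms(1)] by (rule eq_neg_iff_add_eq_0[THEN iffD2])
  have "E B (E A \<xi>) = - E A (E B (E A \<xi>))"
    using anti[of "E A \<xi>"] unfolding p(2)[OF assms(1)] by (rule neg_eq_iff_add_eq_0[THEN iffD2, symmetric])
  with 1 have "E A (E B \<xi>) = E B (E A \<xi>)" by (rule trans[OF _ sym])
  with anti[of \<xi>] have "2 *\<^sub>R E A (E B \<xi>) = 0" by (simp add: scaleR_2)
  then show ?thesis by simp
qed

lemma projection_valued_measure_quadratic:
  assumes "A \<in> sets borel"
  shows "Re (cinner \<xi> (E A \<xi>)) = (norm (E A \<xi>))\<^sup>2"
proof -
  have "cinner \<xi> (E A \<xi>) = cinner (E A \<xi>) (E A \<xi>)"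
    using cinner_cadjoint[OF projection_valued_measureD(1)[OF assms], of \<xi> "E A \<xi>"]
    by (simp add: projection_valued_measureD assms)
  then show ?thesis by (simp add: cinner_self)
qed

lemma sets_scalar_measure: "sets (scalar_measure E \<xi>) = sets borel"
  using sets.sigma_sets_eq[of "borel :: 'p measure"] by (simp add: scalar_measure_def sets_measure_of_conv)

lemma space_scalar_measure: "space (scalar_measure E \<xi>) = UNIV"
  using sets_eq_imp_space_eq[OF sets_scalar_measure] by simp

text \<open>\<open>measure_of\<close> falls back to the zero measure unless the given set function
  is a measure, so countable additivity must be proved before any value can be read off.\<close>

lemma emeasure_scalar_measure:
  assumes "A \<in> sets borel"
  shows "emeasure (scalar_measure E \<xi>) A = ennreal ((norm (E A \<xi>))\<^sup>2)"
proof -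
  have eq: "emeasure (scalar_measure E \<xi>) A = ennreal (Re (cinner \<xi> (E A \<xi>)))"
    unfolding scalar_measure_def
  proof (rule emeasure_measure_of_sigma)
    show "sigma_algebra UNIV (sets (borel :: 'p measure))"
      using sets.sigma_algebra_axioms[of "borel :: 'p measure"] by simp
    show "positive (sets borel) (\<lambda>B. ennreal (Re (cinner \<xi> (E B \<xi>))))"
      by (simp add: positive_def projection_valued_measure_empty)
    show "countably_additive (sets borel) (\<lambda>B. ennreal (Re (cinner \<xi> (E B \<xi>))))"
    proof (rule countably_additiveI)
      fix B :: "nat \<Rightarrow> 'p set"
      assume B: "range B \<subseteq> sets borel" "disjoint_family B"
      have "(\<lambda>n. Re (cinner \<xi> (E (B n) \<xi>))) sums Re (cinner \<xi> (E (\<Union>n. B n) \<xi>))"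
        by (intro sums_Re bounded_linear.sums[OF cinner.bounded_linear_right]
              projection_valued_measure_sums B)
      then show "(\<Sum>n. ennreal (Re (cinner \<xi> (E (B n) \<xi>)))) = ennreal (Re (cinner \<xi> (E (\<Union>n. B n) \<xi>)))"
        using B by (intro suminf_ennreal_eq) (auto simp: projection_valued_measure_quadratic)
    qed
  qed (use assms in auto)
  show ?thesis unfolding eq projection_valued_measure_quadratic[OF assms] ..
qed

lemma finite_measure_scalar_measure: "finite_measure (scalar_measure E \<xi>)"
  by (rule finite_measureI) (simp add: space_scalar_measure emeasure_scalar_measure)

lemma AE_scalar_measure_disjoint:
  assumes "A \<in> sets borel" "B \<in> sets borel" "A \<inter> B = {}"
  shows "AE l in scalar_measure E (E A \<xi>). l \<notin> B"
  by (rule AE_not_in)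
     (use assms in \<open>simp add: null_sets_def sets_scalar_measure emeasure_scalar_measure
        projection_valued_measure_disjoint Int_commute\<close>)

end

section \<open>Injectivity and single-valuedness of the spectral operator\<close>

text \<open>The truncated moments are nonnegative and increase with \<open>n\<close>, so an upper
  bound tending to 0 makes all of them 0. Then \<open>s * l\<close> is both zero and positive almost
  everywhere. The sign \<open>s\<close> lets one statement serve both half-lines.\<close>

lemma truncated_moment_null:
  fixes M :: "real measure"
  assumes "finite_measure M" and sets[simp, measurable_cong]: "sets M = sets borel"
    and pos: "AE l in M. 0 < s * l"
    and le: "\<And>n. (\<integral>l. indicator {- real n..real n} l * (s * l) \<partial>M) \<le> r n" and r: "r \<longlonglongrightarrow> 0"
  shows "emeasure M (space M) = 0"
proof -
  interpret finite_measure M by fact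
  define f where "f n l = indicator {- real n..real n} l * (s * l)" for n l
  have [measurable]: "f n \<in> borel_measurable M" for n unfolding f_def by measurable
  have int: "integrable M (f n)" for n
  proof (rule integrable_const_bound[where B = "\<bar>s\<bar> * real n"])
    show "AE l in M. norm (f n l) \<le> \<bar>s\<bar> * real n"
      by (rule AE_I2) (auto simp: f_def indicator_def abs_mult intro: mult_left_mono)
  qed simp
  have nn: "AE l in M. 0 \<le> f n l" for n
    using pos by eventually_elim (auto simp: f_def indicator_def)
  have mono: "integral\<^sup>L M (f n) \<le> integral\<^sup>L M (f m)" if "n \<le> m" for n m
    using pos that by (intro integral_mono_AE int) (auto simp: f_def indicator_def elim!: eventually_mono)
  have zero: "AE l in M. f n l = 0" for n
  proof -
    have "integral\<^sup>L M (f n) \<le> 0"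
    proof (rule LIMSEQ_le_const[OF r], intro exI allI impI)
      fix m assume "m \<ge> n"
      have "integral\<^sup>L M (f m) \<le> r m" unfolding f_def by (rule le)
      with mono[OF \<open>m \<ge> n\<close>] show "integral\<^sup>L M (f n) \<le> r m" by (rule order_trans)
    qed
    then have "integral\<^sup>L M (f n) = 0"
      using integral_nonneg_AE[OF nn, of n] by simp
    then show ?thesis using integral_nonneg_eq_0_iff_AE[OF int nn] by simp
  qed
  have "AE l in M. \<forall>n. f n l = 0" using zero by (simp add: AE_all_countable)
  then have "AE l in M. False"
    using pos
  proof eventually_elim
    case (elim l)
    obtain n where "\<bar>l\<bar> \<le> real n" using real_arch_simple by blast
    then have "f n l = s * l" by (simp add: f_def indicator_def abs_le_iff)
    with elim show False by (metis less_irrefl)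
  qed
  then show ?thesis using AE_iff_measurable[of "space M" M "\<lambda>_. False"] sets.top[of M] by simp
qed

text \<open>\<open>E\<close> may charge both half-lines, so \<open>\<eta>\<close> is split into its
  positive part \<open>a\<close> and negative part \<open>b\<close>. Pairing the truncations with
  \<open>a - b\<close> yields the truncated integral of the absolute value of \<open>l\<close>,
  which tends to 0, so both scalar measures vanish.\<close>

lemma spectral_graph_inj:
  fixes E :: "real set \<Rightarrow> 'a::complex_hilbert \<Rightarrow> 'a"
  assumes E: "projection_valued_measure E" and E0: "\<And>\<xi>. E {0} \<xi> = 0"
    and mem: "(\<eta>, 0) \<in> spectral_graph E"
  shows "\<eta> = 0"
proof -
  obtain x where x: "\<And>n. bounded_clinear (x n)"
    and xq: "\<And>n \<xi>. cinner \<xi> (x n \<xi>)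
               = (\<integral>l. complex_of_real (indicator {- real n..real n} l * l) \<partial>scalar_measure E \<xi>)"
    and lim: "(\<lambda>n. x n \<eta>) \<longlonglongrightarrow> 0"
    using mem unfolding spectral_graph_def has_spectral_integral_def by auto
  define q where "q n \<xi> = (\<integral>l. indicator {- real n..real n} l * l \<partial>scalar_measure E \<xi>)" for n \<xi>
  have xq: "cinner \<xi> (x n \<xi>) = complex_of_real (q n \<xi>)" for n \<xi>
    unfolding xq q_def by (rule integral_complex_of_real)
  define a b where "a = E {0<..} \<eta>" and "b = E {..<0} \<eta>"
  have AE_a: "AE l in scalar_measure E a. 0 < 1 * l"
  proof -
    have "AE l in scalar_measure E a. l \<notin> {..0}"
      unfolding a_def by (rule AE_scalar_measure_disjoint[OF E]) auto
    then show ?thesis by eventually_elim auto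
  qed
  have AE_b: "AE l in scalar_measure E b. 0 < (-1) * l"
  proof -
    have "AE l in scalar_measure E b. l \<notin> {0..}"
      unfolding b_def by (rule AE_scalar_measure_disjoint[OF E]) auto
    then show ?thesis by eventually_elim auto
  qed
  have \<eta>: "\<eta> = a + b"
  proof -
    have "\<eta> = E ({0<..} \<union> ({..<0} \<union> {0})) \<eta>"
    proof -
      have "{0<..} \<union> ({..<0} \<union> {0}) = (UNIV :: real set)" by auto
      then show ?thesis by (simp only: projection_valued_measure_UNIV[OF E])
    qed
    also have "\<dots> = a + b"
      unfolding a_def b_def
      by (subst projection_valued_measure_Un[OF E], simp, simp, force)+ (simp add: E0)
    finally show ?thesis .
  qed
  \<comment> \<open>Only the quadratic form of \<open>x n\<close> is known. Its reality at
    \<open>a + \<i> *\<^sub>C b\<close> kills the real part of exactly that combination of cross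
    terms which also occurs in the pairing with \<open>a - b\<close>.\<close>
  have Re_eq: "Re (cinner (a - b) (x n \<eta>)) = q n a - q n b" for n
  proof -
    note xn = x[of n]
    have "Im (cinner (a + \<i> *\<^sub>C b) (x n (a + \<i> *\<^sub>C b))) = 0" by (simp add: xq)
    moreover have "cinner (a + \<i> *\<^sub>C b) (x n (a + \<i> *\<^sub>C b)) =
        cinner a (x n a) + cinner b (x n b) + \<i> * (cinner a (x n b) - cinner b (x n a))"
      by (simp add: bounded_clinear_add[OF xn] bounded_clinear_scaleC_apply[OF xn] cinner_add_left
          cinner_add_right cinner_scaleC_left cinner_scaleC_right algebra_simps)
    ultimately have "Im (cinner a (x n a) + cinner b (x n b) + \<i> * (cinner a (x n b) - cinner b (x n a))) = 0"
      by (rule subst[rotated])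
    then have "Re (cinner a (x n b) - cinner b (x n a)) = 0" by (simp add: xq)
    moreover have "cinner (a - b) (x n \<eta>) =
        cinner a (x n a) - cinner b (x n b) + (cinner a (x n b) - cinner b (x n a))"
      unfolding \<eta> by (simp add: bounded_clinear_add[OF xn] cinner.diff_left cinner_add_right)
    ultimately show ?thesis by (simp add: xq)
  qed
  have "(\<lambda>n. Re (cinner (a - b) (x n \<eta>))) \<longlonglongrightarrow> Re (cinner (a - b) 0)"
    by (intro tendsto_Re cinner.tendsto tendsto_const lim)
  then have r: "(\<lambda>n. q n a - q n b) \<longlonglongrightarrow> 0" unfolding Re_eq by simp
  have qa: "0 \<le> q n a" for n
    unfolding q_def by (rule integral_nonneg_AE) (use AE_a in \<open>auto simp: indicator_def elim!: eventually_mono\<close>)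
  have qb: "(\<integral>l. indicator {- real n..real n} l * ((-1) * l) \<partial>scalar_measure E b) = - q n b" for n
    unfolding q_def by simp
  have qb': "0 \<le> - q n b" for n
    unfolding qb[symmetric]
    by (rule integral_nonneg_AE) (use AE_b in \<open>auto simp: indicator_def elim!: eventually_mono\<close>)
  have "emeasure (scalar_measure E a) (space (scalar_measure E a)) = 0"
  proof (rule truncated_moment_null[OF finite_measure_scalar_measure[OF E] sets_scalar_measure[OF E] AE_a _ r])
    show "(\<integral>l. indicator {- real n..real n} l * (1 * l) \<partial>scalar_measure E a) \<le> q n a - q n b" for n
      using qb'[of n] by (simp add: q_def[symmetric])
  qed
  then have "a = 0"
    by (simp add: emeasure_scalar_measure[OF E] projection_valued_measure_UNIV[OF E] space_scalar_measure[OF E])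
  have "emeasure (scalar_measure E b) (space (scalar_measure E b)) = 0"
  proof (rule truncated_moment_null[OF finite_measure_scalar_measure[OF E] sets_scalar_measure[OF E] AE_b _ r])
    show "(\<integral>l. indicator {- real n..real n} l * ((-1) * l) \<partial>scalar_measure E b) \<le> q n a - q n b" for n
      using qa[of n] unfolding qb by simp
  qed
  then have "b = 0"
    by (simp add: emeasure_scalar_measure[OF E] projection_valued_measure_UNIV[OF E] space_scalar_measure[OF E])
  with \<open>a = 0\<close> show ?thesis by (simp add: \<eta>)
qed

lemma spectral_graph_zero:
  assumes "(0, \<zeta>) \<in> spectral_graph E"
  shows "\<zeta> = 0"
proof -
  obtain x where "\<And>n. bounded_clinear (x n)" and lim: "(\<lambda>n::nat. x n 0) \<longlonglongrightarrow> \<zeta>"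
    using assms unfolding spectral_graph_def has_spectral_integral_def by auto
  then have "(\<lambda>n. x n 0) = (\<lambda>_. 0)" using bounded_clinear_zero by blast
  with lim show ?thesis by (simp add: LIMSEQ_const_iff)
qed

text \<open>In HOL \<open>0 powr w\<close> is 0 even for \<open>w = 0\<close>, so the integrand at
  time 0 is the indicator of the nonzero reals. That its spectral integral is the identity leaves no
  mass at 0.\<close>

lemma spectral_measure_zero_null:
  fixes E :: "real set \<Rightarrow> 'a::complex_hilbert \<Rightarrow> 'a"
  assumes E: "projection_valued_measure E"
    and int: "has_spectral_integral E (\<lambda>l. complex_of_real l powr (\<i> * complex_of_real 0)) id"
  shows "E {0} \<eta> = 0"
proof -
  let ?\<xi> = "E {0} \<eta>"
  have "AE l in scalar_measure E ?\<xi>. l \<notin> - {0}"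
    by (rule AE_scalar_measure_disjoint[OF E]) auto
  then have "(\<integral>l. complex_of_real l powr (\<i> * complex_of_real 0) \<partial>scalar_measure E ?\<xi>) = 0"
    by (intro integral_eq_zero_AE) (auto elim!: eventually_mono)
  moreover have "cinner ?\<xi> (id ?\<xi>) = (\<integral>l. complex_of_real l powr (\<i> * complex_of_real 0) \<partial>scalar_measure E ?\<xi>)"
    using int unfolding has_spectral_integral_def by blast
  ultimately show ?thesis by (simp add: cinner_self)
qed

section \<open>The Tomita operator of an algebra with a modular group\<close>

context
  fixes M :: "('a::complex_hilbert \<Rightarrow> 'a) set" and \<Omega> :: 'a and \<sigma> :: "real \<Rightarrow> 'a \<Rightarrow> 'a"
  assumes M: "von_neumann_algebra M" and mod: "is_modular_group M \<Omega> \<sigma>" and \<sigma>0: "\<sigma> 0 = id"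
begin

lemma modular_operator_inj:
  assumes "(\<eta>, 0) \<in> modular_operator M \<Omega>"
  shows "\<eta> = 0"
proof -
  obtain E where E: "projection_valued_measure E" "spectral_graph E = modular_operator M \<Omega>"
      "\<And>t. has_spectral_integral E (\<lambda>l. complex_of_real l powr (\<i> * complex_of_real t)) (\<sigma> t)"
    using mod unfolding is_modular_group_def by blast
  have "\<And>\<xi>. E {0} \<xi> = 0"
    using spectral_measure_zero_null[OF E(1)] E(3)[of 0] unfolding \<sigma>0 by blast
  then show ?thesis using spectral_graph_inj[OF E(1)] assms unfolding E(2) by blast
qed

lemma modular_operator_zero: "(0, \<zeta>) \<in> modular_operator M \<Omega> \<Longrightarrow> \<zeta> = 0"
  using mod spectral_graph_zero unfolding is_modular_group_def by metis

lemma tomita_mem: "x \<in> M \<Longrightarrow> (x \<Omega>, cadjoint x \<Omega>) \<in> tomita_operator M \<Omega>"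
  unfolding tomita_operator_def by (rule subsetD[OF closure_subset]) blast

text \<open>The generating graph is symmetric because taking adjoints is an involution on
  \<open>M\<close>, and swapping coordinates is continuous. This turns a failure of
  single-valuedness, a pair with first entry 0, into a kernel vector.\<close>

lemma tomita_swap:
  assumes "(\<xi>, \<eta>) \<in> tomita_operator M \<Omega>"
  shows "(\<eta>, \<xi>) \<in> tomita_operator M \<Omega>"
proof -
  let ?f = "\<lambda>p::'a \<times> 'a. (snd p, fst p)"
  have "?f (\<xi>, \<eta>) \<in> closure ((\<lambda>x. (x \<Omega>, cadjoint x \<Omega>)) ` M)"
  proof (rule closure_invariant[where f = ?f])
    fix p assume "p \<in> (\<lambda>x. (x \<Omega>, cadjoint x \<Omega>)) ` M"
    then obtain x where x: "x \<in> M" "p = (x \<Omega>, cadjoint x \<Omega>)" by blast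
    show "?f p \<in> closure ((\<lambda>x. (x \<Omega>, cadjoint x \<Omega>)) ` M)"
      using tomita_mem[OF von_neumann_algebra_cadjoint[OF M x(1)]]
      by (simp add: x tomita_operator_def cadjoint_cadjoint[OF von_neumann_algebra_bounded_clinear[OF M x(1)]])
  qed (use assms in \<open>auto simp: tomita_operator_def intro!: continuous_intros\<close>)
  then show ?thesis by (simp add: tomita_operator_def)
qed

lemma von_neumann_algebra_zero: "(\<lambda>_. 0) \<in> M"
  using von_neumann_algebra_scaleC[OF M von_neumann_algebra_id[OF M], of 0] by simp

lemma tomita_kernel:
  assumes "(\<eta>, 0) \<in> tomita_operator M \<Omega>"
  shows "\<eta> = 0"
proof (rule modular_operator_inj)
  have "(0, 0) \<in> antilinear_adjoint (tomita_operator M \<Omega>)"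
    by (auto simp: antilinear_adjoint_def)
  with assms show "(\<eta>, 0) \<in> modular_operator M \<Omega>" unfolding modular_operator_def by blast
qed

text \<open>A vector \<open>\<xi>\<close> orthogonal to M Omega makes the adjoint relation
  multivalued at 0: it contains \<open>(0, \<xi>)\<close>. Composed with the pair
  \<open>(0, 0)\<close> of the Tomita relation this puts \<open>(0, \<xi>)\<close> into the modular
  operator, whose graph, being a spectral one, is single-valued.\<close>

lemma modular_group_cyclic: "closure ((\<lambda>x. x \<Omega>) ` M) = UNIV"
proof (rule dense_if_orthogonal_zero[OF complex_subspace_orbit[OF M]])
  fix \<xi> assume orth: "\<And>k. k \<in> (\<lambda>x. x \<Omega>) ` M \<Longrightarrow> cinner k \<xi> = 0"
  have "tomita_operator M \<Omega> \<subseteq> {p. cinner (fst p) \<xi> = 0}"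
    unfolding tomita_operator_def
  proof (rule closure_minimal)
    show "closed {p. cinner (fst p :: 'a) \<xi> = 0}"
      by (intro closed_Collect_eq cinner.continuous_on continuous_on_fst continuous_on_const continuous_on_id)
  qed (use orth in auto)
  then have "\<forall>(\<eta>, \<eta>')\<in>tomita_operator M \<Omega>. cinner \<xi> \<eta> = 0"
    using cinner_commute[of \<xi>] by fastforce
  then have "(0, \<xi>) \<in> antilinear_adjoint (tomita_operator M \<Omega>)"
    by (auto simp: antilinear_adjoint_def)
  moreover have "(0, 0) \<in> tomita_operator M \<Omega>"
  proof -
    have "cadjoint (\<lambda>_. 0) = (\<lambda>_. 0 :: 'a)" by (rule cadjoint_eqI) simp
    then show ?thesis using tomita_mem[OF von_neumann_algebra_zero] by simp
  qed
  ultimately have "(0, \<xi>) \<in> modular_operator M \<Omega>" unfolding modular_operator_def by blast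
  then show "\<xi> = 0" by (rule modular_operator_zero)
qed

text \<open>If \<open>x\<close> kills Omega, so does \<open>cadjoint y \<circ> x\<close> for every
  \<open>y\<close> in \<open>M\<close>. Injectivity of the Tomita operator then kills the adjoint of
  this product at Omega, that is \<open>cadjoint x (y \<Omega>)\<close>; by cyclicity the adjoint of
  \<open>x\<close> is zero.\<close>

lemma modular_group_separating:
  assumes x: "x \<in> M" and x0: "x \<Omega> = 0"
  shows "x = (\<lambda>_. 0)"
proof -
  note bc = von_neumann_algebra_bounded_clinear[OF M] and adj = von_neumann_algebra_cadjoint[OF M]
  have xy: "cadjoint x (y \<Omega>) = 0" if y: "y \<in> M" for y
  proof -
    let ?w = "cadjoint y \<circ> x"
    have w: "?w \<in> M" using von_neumann_algebra_comp[OF M adj[OF y] x] .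
    have "?w \<Omega> = 0" by (simp add: x0 bounded_clinear_zero[OF bc[OF adj[OF y]]])
    then have "(0, cadjoint ?w \<Omega>) \<in> tomita_operator M \<Omega>" using tomita_mem[OF w] by simp
    then have "cadjoint ?w \<Omega> = 0" by (rule tomita_kernel[OF tomita_swap])
    moreover have "cadjoint ?w = cadjoint x \<circ> y"
      unfolding cadjoint_comp[OF bc[OF adj[OF y]] bc[OF x]] cadjoint_cadjoint[OF bc[OF y]] ..
    ultimately show ?thesis by simp
  qed
  have "closure ((\<lambda>x. x \<Omega>) ` M) \<subseteq> {\<xi>. cadjoint x \<xi> = 0}"
  proof (rule closure_minimal)
    show "closed {\<xi>. cadjoint x \<xi> = 0}"
      by (intro closed_Collect_eq bounded_clinear_continuous[OF bc[OF adj[OF x]]] continuous_on_const)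
  qed (use xy in auto)
  then have adj0: "cadjoint x \<xi> = 0" for \<xi> unfolding modular_group_cyclic by blast
  show ?thesis
  proof
    fix \<xi>
    have "cinner \<eta> (x \<xi>) = cinner \<eta> 0" for \<eta>
      using cinner_cadjoint_left[OF bc[OF x], of \<eta> \<xi>] by (simp add: adj0)
    then show "x \<xi> = 0" by (rule cinner_ext)
  qed
qed

end

section \<open>Averages along the rescaled functions\<close>

locale averaging =
  fixes h :: "real \<Rightarrow> real" and \<epsilon> :: real
  assumes averaging: "averaging_function h" and \<epsilon>: "0 < \<epsilon>" "\<epsilon> < 1"
begin

text \<open>The average over the window around \<open>T\<close> after substituting
  \<open>T + T powr \<epsilon> * u\<close> for the time. The weight no longer depends on
  \<open>T\<close>, which makes dominated convergence applicable; \<open>mean_rescaled\<close> gives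
  the agreement for positive \<open>T\<close>.\<close>

definition mean :: "(real \<Rightarrow> 'b::{banach, second_countable_topology}) \<Rightarrow> real \<Rightarrow> 'b" where
  "mean F T = (\<integral>u. h u *\<^sub>R F (T + T powr \<epsilon> * u) \<partial>lborel)"

lemma h_nonneg: "0 \<le> h u"
  and h_integrable: "integrable lborel h"
  and h_integral: "integral\<^sup>L lborel h = 1"
  using averaging by (auto simp: averaging_function_def has_bochner_integral_iff)

lemma h_measurable [measurable]: "h \<in> borel_measurable borel"
  using borel_measurable_integrable[OF h_integrable] by simp

lemma h_continuous: "isCont h t"
proof -
  obtain D where "D 0 = h" "\<And>t. (D 0 has_real_derivative D (Suc 0) t) (at t)"
    using averaging unfolding averaging_function_def smooth_function_def by blast
  then show ?thesis by (metis DERIV_isCont)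
qed

lemma mean_rescaled:
  fixes F :: "real \<Rightarrow> 'b::{banach, second_countable_topology}"
  assumes "T > 0"
  shows "(\<integral>t. rescaled h \<epsilon> T t *\<^sub>R F t \<partial>lborel) = mean F T"
proof -
  have c: "T powr \<epsilon> > 0" "T powr (- \<epsilon>) * T powr \<epsilon> = 1" using assms by (simp_all add: powr_add[symmetric])
  have resc: "rescaled h \<epsilon> T (T + T powr \<epsilon> * u) = T powr (- \<epsilon>) * h u" for u
    using assms c by (simp add: rescaled_def mult.assoc[symmetric])
  have cancel: "\<bar>T powr \<epsilon>\<bar> *\<^sub>R (T powr (- \<epsilon>) * r) *\<^sub>R x = r *\<^sub>R x" for r and x :: 'b
    using c by (simp add: mult.assoc[symmetric] mult.commute[of "T powr \<epsilon>"])
  have "(\<integral>t. rescaled h \<epsilon> T t *\<^sub>R F t \<partial>lborel) =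
        \<bar>T powr \<epsilon>\<bar> *\<^sub>R (\<integral>u. rescaled h \<epsilon> T (T + T powr \<epsilon> * u) *\<^sub>R F (T + T powr \<epsilon> * u) \<partial>lborel)"
    by (rule lborel_integral_real_affine) (use c in simp)
  then show ?thesis unfolding resc integral_scaleR_right[symmetric] cancel mean_def .
qed

lemma mean_integrable:
  fixes F :: "real \<Rightarrow> 'b::{banach, second_countable_topology}"
  assumes F: "continuous_on UNIV F" and bd: "\<And>t. norm (F t) \<le> C"
  shows "integrable lborel (\<lambda>u. h u *\<^sub>R F (T + c * u))"
proof (rule Bochner_Integration.integrable_bound[OF integrable_mult_right[OF h_integrable, of C]])
  have [measurable]: "F \<in> borel_measurable borel" by (rule borel_measurable_continuous_onI[OF F])
  show "(\<lambda>u. h u *\<^sub>R F (T + c * u)) \<in> borel_measurable lborel" by measurable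
  have "C \<ge> 0" using norm_ge_zero[of "F 0"] bd[of 0] by linarith
  then show "AE u in lborel. norm (h u *\<^sub>R F (T + c * u)) \<le> norm (C * h u)"
    using bd by (auto simp: h_nonneg mult.commute[of C] intro!: AE_I2 mult_left_mono)
qed

lemma mean_const: "mean (\<lambda>_. c) T = c" for c :: "'b::{banach, second_countable_topology}"
  using has_bochner_integral_scaleR_left[of c lborel h 1] h_integrable h_integral
  by (simp add: mean_def has_bochner_integral_iff)

lemma mean_norm_le:
  fixes F :: "real \<Rightarrow> 'b::{banach, second_countable_topology}"
  assumes F: "continuous_on UNIV F" and bd: "\<And>t. norm (F t) \<le> C"
  shows "norm (mean F T) \<le> C"
proof -
  have "norm (mean F T) \<le> (\<integral>u. C * h u \<partial>lborel)"
    unfolding mean_def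
  proof (rule Bochner_Integration.integral_norm_bound_integral)
    show "norm (h u *\<^sub>R F (T + T powr \<epsilon> * u)) \<le> C * h u" for u
      using mult_left_mono[OF bd h_nonneg] by (simp add: h_nonneg mult.commute[of C])
  qed (use mean_integrable[OF F bd] h_integrable in auto)
  then show ?thesis by (simp add: h_integral)
qed

lemma mean_diff:
  fixes F G :: "real \<Rightarrow> 'b::{banach, second_countable_topology}"
  assumes "continuous_on UNIV F" "\<And>t. norm (F t) \<le> C" "continuous_on UNIV G" "\<And>t. norm (G t) \<le> C'"
  shows "mean (\<lambda>t. F t - G t) T = mean F T - mean G T"
  unfolding mean_def scaleR_diff_right
  by (rule Bochner_Integration.integral_diff) (rule mean_integrable, fact+)+

lemma mean_bounded_linear:
  fixes F :: "real \<Rightarrow> 'b::{banach, second_countable_topology}"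
    and L :: "'b \<Rightarrow> 'c::{banach, second_countable_topology}"
  assumes L: "bounded_linear L" and F: "continuous_on UNIV F" "\<And>t. norm (F t) \<le> C"
  shows "mean (\<lambda>t. L (F t)) T = L (mean F T)"
  unfolding mean_def linear_cmul[OF bounded_linear.linear[OF L], symmetric]
  by (rule integral_bounded_linear[OF L mean_integrable[OF F]])

lemma mean_mono:
  fixes F G :: "real \<Rightarrow> real"
  assumes "continuous_on UNIV F" "\<And>t. norm (F t) \<le> C" "continuous_on UNIV G" "\<And>t. norm (G t) \<le> C'"
    and le: "\<And>t. F t \<le> G t"
  shows "mean F T \<le> mean G T"
  unfolding mean_def
proof (rule integral_mono)
  show "h u *\<^sub>R F (T + T powr \<epsilon> * u) \<le> h u *\<^sub>R G (T + T powr \<epsilon> * u)" for u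
    using mult_left_mono[OF le h_nonneg] by simp
qed (rule mean_integrable, fact+)+

text \<open>This is \<open>0 \<le> mean (F - mean F)\<^sup>2\<close>.\<close>

lemma mean_square_le:
  fixes F :: "real \<Rightarrow> real"
  assumes F: "continuous_on UNIV F" "\<And>t. norm (F t) \<le> C"
  shows "(mean F T)\<^sup>2 \<le> mean (\<lambda>t. (F t)\<^sup>2) T"
proof -
  define m where "m = mean F T"
  have F2: "continuous_on UNIV (\<lambda>t. (F t)\<^sup>2)" "norm ((F t)\<^sup>2) \<le> C\<^sup>2" for t
    using F(1) abs_le_square_iff[of "F t" C] F(2)[of t] by (auto intro!: continuous_intros)
  have m1: "continuous_on UNIV (\<lambda>t. 2 * m * F t)" "norm (2 * m * F t) \<le> \<bar>2 * m\<bar> * C" for t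
    using F(2)[of t] by (auto intro!: continuous_on_mult continuous_on_const F(1) mult_left_mono simp: abs_mult)
  have "mean (\<lambda>t. 2 * m * F t - m\<^sup>2) T = mean (\<lambda>t. 2 * m * F t) T - m\<^sup>2"
    using mean_diff[OF m1, of "\<lambda>_. m\<^sup>2" "m\<^sup>2" T] by (simp add: mean_const)
  also have "mean (\<lambda>t. 2 * m * F t) T = 2 * m * m"
    unfolding m_def by (rule mean_bounded_linear[OF bounded_linear_mult_right F])
  finally have eq: "mean (\<lambda>t. 2 * m * F t - m\<^sup>2) T = m\<^sup>2" by (simp add: power2_eq_square)
  have "mean (\<lambda>t. 2 * m * F t - m\<^sup>2) T \<le> mean (\<lambda>t. (F t)\<^sup>2) T"
  proof (rule mean_mono[OF _ _ F2])
    show "continuous_on UNIV (\<lambda>t. 2 * m * F t - m\<^sup>2)" by (intro continuous_on_diff m1(1) continuous_on_const)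
    show "norm (2 * m * F t - m\<^sup>2) \<le> \<bar>2 * m\<bar> * C + m\<^sup>2" for t
      using norm_triangle_ineq4[of "2 * m * F t" "m\<^sup>2"] m1(2)[of t] by simp
    show "2 * m * F t - m\<^sup>2 \<le> (F t)\<^sup>2" for t
      using zero_le_power2[of "F t - m"] by (simp add: power2_eq_square algebra_simps)
  qed
  then show ?thesis unfolding eq by (simp only: m_def)
qed

text \<open>Here \<open>\<epsilon> < 1\<close> enters: factoring out \<open>T\<close> leaves
  \<open>1 + T powr (\<epsilon> - 1) * u\<close>, which tends to 1, so the window moves away faster
  than it widens.\<close>

lemma filterlim_mean_time: "filterlim (\<lambda>T. T + T powr \<epsilon> * u) at_top at_top"
proof -
  have "((\<lambda>T. T powr (\<epsilon> - 1)) \<longlongrightarrow> 0) at_top"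
    using \<epsilon> by (intro tendsto_neg_powr filterlim_ident) auto
  then have "((\<lambda>T. 1 + T powr (\<epsilon> - 1) * u) \<longlongrightarrow> 1 + 0 * u) at_top"
    by (intro tendsto_intros)
  then have "filterlim (\<lambda>T. (1 + T powr (\<epsilon> - 1) * u) * T) at_top at_top"
    by (intro filterlim_tendsto_pos_mult_at_top[where c = 1]) (auto simp: filterlim_ident)
  moreover have "\<forall>\<^sub>F T in at_top. (1 + T powr (\<epsilon> - 1) * u) * T = T + T powr \<epsilon> * u"
    using eventually_gt_at_top[of 0]
    by eventually_elim (simp add: powr_diff field_simps)
  ultimately show ?thesis by (rule filterlim_cong[OF refl refl, THEN iffD1, rotated])
qed

lemma mean_tendsto:
  fixes F :: "real \<Rightarrow> 'b::{banach, second_countable_topology}"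
  assumes F: "continuous_on UNIV F" "\<And>t. norm (F t) \<le> C" and lim: "(F \<longlongrightarrow> L) at_top"
  shows "(mean F \<longlongrightarrow> L) at_top"
proof -
  have [measurable]: "F \<in> borel_measurable borel" by (rule borel_measurable_continuous_onI[OF F(1)])
  have "((\<lambda>T. \<integral>u. h u *\<^sub>R F (T + T powr \<epsilon> * u) \<partial>lborel) \<longlongrightarrow> (\<integral>u. h u *\<^sub>R L \<partial>lborel)) at_top"
  proof (rule integral_dominated_convergence_at_top)
    show "integrable lborel (\<lambda>u. C * h u)" using h_integrable by simp
    show "AE u in lborel. ((\<lambda>T. h u *\<^sub>R F (T + T powr \<epsilon> * u)) \<longlongrightarrow> h u *\<^sub>R L) at_top"
      by (intro AE_I2 tendsto_intros filterlim_compose[OF lim filterlim_mean_time])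
    show "\<forall>\<^sub>F T in at_top. AE u in lborel. norm (h u *\<^sub>R F (T + T powr \<epsilon> * u)) \<le> C * h u"
      using mult_left_mono[OF F(2) h_nonneg]
      by (intro always_eventually allI AE_I2) (simp add: h_nonneg mult.commute[of C])
  qed measurable
  then show ?thesis
    using mean_const[of L] by (simp add: mean_def[abs_def])
qed

text \<open>Scheffe's lemma: as \<open>h(\<cdot> - \<delta>)\<close> and \<open>h\<close> have equal integrals, the \<open>L\<^sup>1\<close>-distance is twice the
  integral of the positive part of the difference, which is dominated by \<open>h\<close>.\<close>

lemma h_shift_tendsto:
  assumes \<delta>: "(\<delta> \<longlongrightarrow> 0) at_top"
  shows "((\<lambda>T::real. \<integral>u. \<bar>h (u - \<delta> T) - h u\<bar> \<partial>lborel) \<longlongrightarrow> 0) at_top"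
proof -
  have int: "integrable lborel (\<lambda>u. h (u - d))" and eq: "(\<integral>u. h (u - d) \<partial>lborel) = 1" for d
    using lborel_integrable_real_affine[OF h_integrable, of 1 "- d"]
      lborel_integral_real_affine[of 1 h "- d"] h_integral by simp_all
  have pos: "integrable lborel (\<lambda>u. max 0 (h u - h (u - d)))" for d
    by (rule Bochner_Integration.integrable_bound[OF h_integrable])
       (auto simp: h_nonneg intro!: AE_I2)
  have split: "(\<integral>u. \<bar>h (u - d) - h u\<bar> \<partial>lborel) = 2 * (\<integral>u. max 0 (h u - h (u - d)) \<partial>lborel)" for d
  proof -
    have "(\<integral>u. \<bar>h (u - d) - h u\<bar> \<partial>lborel) =
          (\<integral>u. (h (u - d) - h u) + 2 * max 0 (h u - h (u - d)) \<partial>lborel)"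
      by (rule Bochner_Integration.integral_cong) (auto simp: max_def)
    also have "\<dots> = (\<integral>u. h (u - d) - h u \<partial>lborel) + (\<integral>u. 2 * max 0 (h u - h (u - d)) \<partial>lborel)"
      using int h_integrable pos by (intro Bochner_Integration.integral_add) auto
    also have "(\<integral>u. h (u - d) - h u \<partial>lborel) = 0"
      using int h_integrable by (simp add: eq h_integral)
    finally show ?thesis by simp
  qed
  have "((\<lambda>T. \<integral>u. max 0 (h u - h (u - \<delta> T)) \<partial>lborel) \<longlongrightarrow> integral\<^sup>L lborel (\<lambda>u::real. 0)) at_top"
  proof (rule integral_dominated_convergence_at_top[where w = h])
    show "integrable lborel h" by (rule h_integrable)
    show "AE u in lborel. ((\<lambda>T. max 0 (h u - h (u - \<delta> T))) \<longlongrightarrow> 0) at_top"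
    proof (rule AE_I2)
      fix u
      have "((\<lambda>T. h (u - \<delta> T)) \<longlongrightarrow> h (u - 0)) at_top"
        by (intro isCont_tendsto_compose[OF h_continuous] tendsto_intros \<delta>)
      then have "((\<lambda>T. max 0 (h u - h (u - \<delta> T))) \<longlongrightarrow> max 0 (h u - h (u - 0))) at_top"
        by (intro tendsto_intros)
      then show "((\<lambda>T. max 0 (h u - h (u - \<delta> T))) \<longlongrightarrow> 0) at_top" by simp
    qed
    show "\<forall>\<^sub>F T in at_top. AE u in lborel. norm (max 0 (h u - h (u - \<delta> T))) \<le> h u"
      by (intro always_eventually allI AE_I2) (auto simp: h_nonneg)
  qed measurable
  then have "((\<lambda>T. 2 * (\<integral>u. max 0 (h u - h (u - \<delta> T)) \<partial>lborel)) \<longlongrightarrow> 2 * 0) at_top"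
    by (intro tendsto_intros) simp
  then show ?thesis unfolding split by simp
qed

text \<open>A shift of time by \<open>s\<close> is a shift of \<open>u\<close> by
  \<open>s * T powr (- \<epsilon>)\<close>, which can be moved onto the weight. It tends to 0
  because \<open>\<epsilon> > 0\<close>, and translates of \<open>h\<close> depend continuously on
  the shift in the L1 norm.\<close>

lemma mean_shift_tendsto:
  fixes F :: "real \<Rightarrow> 'b::{banach, second_countable_topology}"
  assumes F: "continuous_on UNIV F" "\<And>t. norm (F t) \<le> C"
  shows "((\<lambda>T. mean (\<lambda>t. F (t + s) - F t) T) \<longlongrightarrow> 0) at_top"
proof (rule Lim_null_comparison)
  have [measurable]: "F \<in> borel_measurable borel" by (rule borel_measurable_continuous_onI[OF F(1)])
  have "((\<lambda>T. s * T powr (- \<epsilon>)) \<longlongrightarrow> s * 0) at_top"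
    using \<epsilon> by (intro tendsto_intros tendsto_neg_powr filterlim_ident) auto
  then have "((\<lambda>T. \<integral>u. \<bar>h (u - s * T powr (- \<epsilon>)) - h u\<bar> \<partial>lborel) \<longlongrightarrow> 0) at_top"
    by (intro h_shift_tendsto) simp
  then show "((\<lambda>T. C * (\<integral>u. \<bar>h (u - s * T powr (- \<epsilon>)) - h u\<bar> \<partial>lborel)) \<longlongrightarrow> 0) at_top"
    by (rule tendsto_mult_right_zero)
  show "\<forall>\<^sub>F T in at_top. norm (mean (\<lambda>t. F (t + s) - F t) T)
          \<le> C * (\<integral>u. \<bar>h (u - s * T powr (- \<epsilon>)) - h u\<bar> \<partial>lborel)"
    using eventually_gt_at_top[of 0]
  proof eventually_elim
    case (elim T)
    define d where "d = s * T powr (- \<epsilon>)"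
    have Td: "T powr \<epsilon> * d = s"
      using elim by (simp add: d_def mult.left_commute powr_add[symmetric])
    have int: "integrable lborel (\<lambda>u. h (u - d))"
      using lborel_integrable_real_affine[OF h_integrable, of 1 "- d"] by simp
    have intF: "integrable lborel (\<lambda>u. h u *\<^sub>R F (T + T powr \<epsilon> * u))" by (rule mean_integrable[OF F])
    have Fs: "continuous_on UNIV (\<lambda>t. F (t + s))"
      by (rule continuous_on_compose2[OF F(1)]) (auto intro!: continuous_intros)
    have shift: "T + T powr \<epsilon> * (u - d) + s = T + T powr \<epsilon> * u" for u
      using Td by (simp add: algebra_simps)
    have "integrable lborel (\<lambda>u. h u *\<^sub>R F (T + T powr \<epsilon> * u + s))"
      by (rule mean_integrable[OF Fs F(2)])
    from lborel_integrable_real_affine[OF this, of 1 "- d"]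
    have intFs: "integrable lborel (\<lambda>u. h (u - d) *\<^sub>R F (T + T powr \<epsilon> * u))" by (simp add: shift)
    have "mean (\<lambda>t. F (t + s) - F t) T = mean (\<lambda>t. F (t + s)) T - mean F T"
      by (rule mean_diff[OF Fs F(2) F])
    also have "mean (\<lambda>t. F (t + s)) T = (\<integral>u. h (u - d) *\<^sub>R F (T + T powr \<epsilon> * u) \<partial>lborel)"
      using lborel_integral_real_affine[of 1 "\<lambda>u. h u *\<^sub>R F (T + T powr \<epsilon> * u + s)" "- d"]
      by (simp add: mean_def shift)
    also have "\<dots> - mean F T = (\<integral>u. (h (u - d) - h u) *\<^sub>R F (T + T powr \<epsilon> * u) \<partial>lborel)"
      unfolding mean_def scaleR_diff_left
      by (rule Bochner_Integration.integral_diff[OF intFs intF, symmetric])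
    finally have eq: "mean (\<lambda>t. F (t + s) - F t) T = \<dots>" .
    have "norm (mean (\<lambda>t. F (t + s) - F t) T) \<le> (\<integral>u. C * \<bar>h (u - d) - h u\<bar> \<partial>lborel)"
      unfolding eq
    proof (rule Bochner_Integration.integral_norm_bound_integral)
      show "integrable lborel (\<lambda>u. (h (u - d) - h u) *\<^sub>R F (T + T powr \<epsilon> * u))"
        unfolding scaleR_diff_left by (rule Bochner_Integration.integrable_diff[OF intFs intF])
      show "integrable lborel (\<lambda>u. C * \<bar>h (u - d) - h u\<bar>)" using int h_integrable by simp
      show "norm ((h (u - d) - h u) *\<^sub>R F (T + T powr \<epsilon> * u)) \<le> C * \<bar>h (u - d) - h u\<bar>" for u
        using mult_left_mono[OF F(2), of "\<bar>h (u - d) - h u\<bar>"] by (simp add: mult.commute[of C])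
    qed
    then show ?case by (simp add: d_def)
  qed
qed

end

section \<open>Limits of equi-Lipschitz families\<close>

lemma tendsto_if_approximable:
  fixes A :: "real \<Rightarrow> 'a::real_normed_vector \<Rightarrow> 'b::real_normed_vector"
  assumes lip: "\<And>T \<zeta>. norm (A T \<xi> - A T \<zeta>) \<le> C * norm (\<xi> - \<zeta>)"
    and approx: "\<And>e. e > 0 \<Longrightarrow> \<exists>\<zeta> l. ((\<lambda>T. A T \<zeta>) \<longlongrightarrow> l) at_top \<and> norm (\<xi> - \<zeta>) < e \<and> norm (l - L) < e"
  shows "((\<lambda>T. A T \<xi>) \<longlongrightarrow> L) at_top"
proof (rule tendstoI)
  fix e :: real assume e: "e > 0"
  \<comment> \<open>The first bound controls the distance of the limits, the second the Lipschitz
    error; \<open>\<bar>C\<bar> + 1\<close> keeps the denominator positive when \<open>C\<close> is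
    zero.\<close>
  define d where "d = min (e / 3) (e / (3 * (\<bar>C\<bar> + 1)))"
  have d: "d > 0" "d \<le> e / 3" "\<bar>C\<bar> * d \<le> e / 3"
  proof -
    show "d > 0" using e by (simp add: d_def)
    show "d \<le> e / 3" unfolding d_def by (rule min.cobounded1)
    have "\<bar>C\<bar> * d \<le> \<bar>C\<bar> * (e / (3 * (\<bar>C\<bar> + 1)))" 
      unfolding d_def by (intro mult_left_mono min.cobounded2) simp
    also have "\<dots> \<le> e / 3" using e by (simp add: field_simps)
    finally show "\<bar>C\<bar> * d \<le> e / 3" .
  qed
  obtain \<zeta> l where \<zeta>: "((\<lambda>T. A T \<zeta>) \<longlongrightarrow> l) at_top" "norm (\<xi> - \<zeta>) < d" "norm (l - L) < d"
    using approx[OF d(1)] by blast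
  have C: "norm (A T \<xi> - A T \<zeta>) \<le> e / 3" for T
  proof -
    have "C * norm (\<xi> - \<zeta>) \<le> \<bar>C\<bar> * d" using \<zeta>(2) by (intro mult_mono) auto
    with lip[of T \<zeta>] d(3) show ?thesis by linarith
  qed
  have "\<forall>\<^sub>F T in at_top. dist (A T \<zeta>) l < e / 3" using \<zeta>(1) e by (intro tendstoD) auto
  then show "\<forall>\<^sub>F T in at_top. dist (A T \<xi>) L < e"
  proof eventually_elim
    case (elim T)
    have "norm (A T \<xi> - L) \<le> norm (A T \<xi> - A T \<zeta>) + norm (A T \<zeta> - l) + norm (l - L)"
      using norm_triangle_ineq[of "A T \<xi> - A T \<zeta>" "A T \<zeta> - l"]
        norm_triangle_ineq[of "A T \<xi> - l" "l - L"] by simp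
    with elim C[of T] \<zeta>(3) d(2) show ?case by (simp add: dist_norm)
  qed
qed

text \<open>The Lipschitz bound passes to the limits at the points of \<open>D\<close>, so these
  limits form a Cauchy sequence along any sequence in \<open>D\<close> converging to
  \<open>\<xi>\<close>; completeness supplies the candidate.\<close>

lemma convergent_if_dense:
  fixes A :: "real \<Rightarrow> 'a::real_normed_vector \<Rightarrow> 'b::banach"
  assumes lip: "\<And>T \<xi> \<zeta>. norm (A T \<xi> - A T \<zeta>) \<le> C * norm (\<xi> - \<zeta>)"
    and dense: "closure D = UNIV" and conv: "\<And>\<zeta>. \<zeta> \<in> D \<Longrightarrow> \<exists>l. ((\<lambda>T. A T \<zeta>) \<longlongrightarrow> l) at_top"
  shows "\<exists>L. ((\<lambda>T. A T \<xi>) \<longlongrightarrow> L) at_top"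
proof -
  have "\<xi> \<in> closure D" using dense by simp
  then obtain y where y: "\<And>n. y n \<in> D" "y \<longlonglongrightarrow> \<xi>" using closure_sequential by blast
  obtain l where l: "\<And>n. ((\<lambda>T. A T (y n)) \<longlongrightarrow> l n) at_top" using conv[OF y(1)] by metis
  have le: "norm (l m - l n) \<le> C * norm (y m - y n)" for m n
    by (rule tendsto_upperbound[OF tendsto_norm[OF tendsto_diff[OF l l]]])
       (auto intro: always_eventually lip)
  have "Cauchy l"
  proof (rule metric_CauchyI)
    fix e :: real assume e: "e > 0"
    have "Cauchy y" using y(2) by (rule LIMSEQ_imp_Cauchy)
    then obtain N where N: "\<And>m n. m \<ge> N \<Longrightarrow> n \<ge> N \<Longrightarrow> dist (y m) (y n) < e / (\<bar>C\<bar> + 1)"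
      using e metric_CauchyD[of y "e / (\<bar>C\<bar> + 1)"] by auto
    have "dist (l m) (l n) < e" if "m \<ge> N" "n \<ge> N" for m n
    proof -
      have "norm (y m - y n) < e / (\<bar>C\<bar> + 1)" using N[OF that] by (simp add: dist_norm)
      then have "(\<bar>C\<bar> + 1) * norm (y m - y n) < e" by (simp add: field_simps)
      moreover have "C * norm (y m - y n) \<le> (\<bar>C\<bar> + 1) * norm (y m - y n)" by (intro mult_right_mono) auto
      ultimately show ?thesis using le[of m n] by (simp add: dist_norm)
    qed
    then show "\<exists>M. \<forall>m\<ge>M. \<forall>n\<ge>M. dist (l m) (l n) < e" by blast
  qed
  then obtain L where L: "l \<longlonglongrightarrow> L" using Cauchy_convergent_iff convergent_def by blast
  have "((\<lambda>T. A T \<xi>) \<longlongrightarrow> L) at_top"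
  proof (rule tendsto_if_approximable[OF lip])
    fix e :: real assume e: "e > 0"
    have "\<forall>\<^sub>F n in sequentially. dist (y n) \<xi> < e \<and> dist (l n) L < e"
      using tendstoD[OF y(2) e] tendstoD[OF L e] by (rule eventually_conj)
    then obtain n where "dist (y n) \<xi> < e" "dist (l n) L < e"
      using eventually_happens by fastforce
    then show "\<exists>\<zeta> k. ((\<lambda>T. A T \<zeta>) \<longlongrightarrow> k) at_top \<and> norm (\<xi> - \<zeta>) < e \<and> norm (k - L) < e"
      using l[of n] by (intro exI[of _ "y n"] exI[of _ "l n"]) (auto simp: dist_norm norm_minus_commute)
  qed
  then show ?thesis by blast
qed

section \<open>The mean ergodic theorem\<close>

locale unitary_flow =
  fixes V :: "real \<Rightarrow> 'a::{complex_hilbert, second_countable_topology} \<Rightarrow> 'a"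
  assumes V_bounded_clinear: "bounded_clinear (V t)"
    and V_add: "V (s + t) \<xi> = V s (V t \<xi>)"
    and V_zero: "V 0 \<xi> = \<xi>"
    and V_adjoint: "cinner (V t \<xi>) \<eta> = cinner \<xi> (V (- t) \<eta>)"
    and V_continuous: "continuous_on UNIV (\<lambda>t. V t \<xi>)"
begin

lemma V_inverse [simp]: "V (- t) (V t \<xi>) = \<xi>" "V t (V (- t) \<xi>) = \<xi>"
  using V_add[of "- t" t \<xi>] V_add[of t "- t" \<xi>] by (simp_all add: V_zero)

lemma V_norm [simp]: "norm (V t \<xi>) = norm \<xi>"
proof -
  have "complex_of_real ((norm (V t \<xi>))\<^sup>2) = complex_of_real ((norm \<xi>)\<^sup>2)"
    unfolding cinner_self[symmetric] by (simp add: V_adjoint)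
  then have "(norm (V t \<xi>))\<^sup>2 = (norm \<xi>)\<^sup>2" by (simp only: of_real_eq_iff)
  then show ?thesis by (rule power2_eq_imp_eq) auto
qed

lemma V_diff: "V t (\<xi> - \<eta>) = V t \<xi> - V t \<eta>"
  by (rule bounded_clinear_diff[OF V_bounded_clinear])

text \<open>The flow is only strongly continuous, but every \<open>V t\<close> is isometric:
  replacing \<open>g t\<close> by \<open>g s\<close> under \<open>V t\<close> costs no more than the
  distance of these two vectors.\<close>

lemma V_continuous_compose:
  fixes g :: "real \<Rightarrow> 'a"
  assumes g: "continuous_on UNIV g"
  shows "continuous_on UNIV (\<lambda>t. V t (g t))"
  unfolding continuous_on_def
proof
  fix s
  have "((\<lambda>t. V t (g t) - V t (g s)) \<longlongrightarrow> 0) (at s)"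
  proof (rule tendsto_norm_zero_cancel)
    have "((\<lambda>t. norm (g t - g s)) \<longlongrightarrow> norm (g s - g s)) (at s)"
      using g by (intro tendsto_intros) (simp add: continuous_on_def)
    then show "((\<lambda>t. norm (V t (g t) - V t (g s))) \<longlongrightarrow> 0) (at s)"
      by (simp add: V_diff[symmetric])
  qed
  moreover have "((\<lambda>t. V t (g s)) \<longlongrightarrow> V s (g s)) (at s)"
    using V_continuous[of "g s"] by (simp add: continuous_on_def)
  ultimately have "((\<lambda>t. (V t (g t) - V t (g s)) + V t (g s)) \<longlongrightarrow> 0 + V s (g s)) (at s)"
    by (rule tendsto_add)
  then show "((\<lambda>t. V t (g t)) \<longlongrightarrow> V s (g s)) (at s within UNIV)" by simp
qed

definition invariants :: "'a set" where
  "invariants = {\<xi>. \<forall>t. V t \<xi> = \<xi>}"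

abbreviation P :: "'a \<Rightarrow> 'a" where
  "P \<equiv> proj invariants"

lemma invariants_subspace: "complex_subspace invariants"
  unfolding complex_subspace_def invariants_def
  by (auto simp: bounded_clinear_zero[OF V_bounded_clinear] bounded_clinear_add[OF V_bounded_clinear]
      bounded_clinear_scaleC_apply[OF V_bounded_clinear])

lemma invariants_closed: "closed invariants"
proof -
  have "closed {\<xi>. V t \<xi> = \<xi>}" for t
    by (intro closed_Collect_eq bounded_clinear_continuous[OF V_bounded_clinear] continuous_on_id)
  then show ?thesis unfolding invariants_def Collect_all_eq by (intro closed_INT) auto
qed

lemmas P_mem = proj_mem[OF invariants_subspace invariants_closed]
lemmas P_id = proj_id[OF invariants_subspace invariants_closed]
lemmas P_bounded_clinear = bounded_clinear_proj[OF invariants_subspace invariants_closed]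
lemmas P_selfadjoint = proj_selfadjoint[OF invariants_subspace invariants_closed]

lemma V_P: "V t (P \<xi>) = P \<xi>"
  using P_mem[of \<xi>] by (simp add: invariants_def)

end

locale averaged_flow = averaging h \<epsilon> + unitary_flow V
  for h :: "real \<Rightarrow> real" and \<epsilon> :: real
    and V :: "real \<Rightarrow> 'a::{complex_hilbert, second_countable_topology} \<Rightarrow> 'a"
begin

text \<open>Von Neumann's argument: the vectors with means tending to 0 form a closed subspace
  \<open>K\<close> that contains every coboundary \<open>V s \<eta> - \<eta>\<close>. A vector
  orthogonal to all coboundaries is invariant, so the residual \<open>q\<close> of the projection
  onto \<open>K\<close> is invariant and is its own mean.\<close>

lemma mean_ergodic: "(mean (\<lambda>t. V t \<xi>) \<longlongrightarrow> P \<xi>) at_top"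
proof -
  define K where "K = {\<xi>. (mean (\<lambda>t. V t \<xi>) \<longlongrightarrow> 0) at_top}"
  have Vb: "norm (V t \<xi>) \<le> norm \<xi>" for t \<xi> by simp
  have Vd: "mean (\<lambda>t. V t (\<xi> - \<eta>)) T = mean (\<lambda>t. V t \<xi>) T - mean (\<lambda>t. V t \<eta>) T" for \<xi> \<eta> T
    unfolding V_diff by (rule mean_diff[OF V_continuous Vb V_continuous Vb])
  have Vs: "mean (\<lambda>t. V t (c *\<^sub>C \<xi>)) T = c *\<^sub>C mean (\<lambda>t. V t \<xi>) T" for c \<xi> T
    unfolding bounded_clinear_scaleC_apply[OF V_bounded_clinear]
    by (rule mean_bounded_linear[OF bounded_linear_scaleC V_continuous Vb])
  have K: "complex_subspace K"
    unfolding complex_subspace_def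
  proof (intro conjI ballI allI)
    show zero: "0 \<in> K" by (simp add: K_def bounded_clinear_zero[OF V_bounded_clinear] mean_def[abs_def])
    have diff: "\<xi> - \<eta> \<in> K" if "\<xi> \<in> K" "\<eta> \<in> K" for \<xi> \<eta>
      using tendsto_diff[of "mean (\<lambda>t. V t \<xi>)" 0 at_top "mean (\<lambda>t. V t \<eta>)" 0] that
      by (simp add: K_def Vd[abs_def])
    show "\<xi> + \<eta> \<in> K" if "\<xi> \<in> K" "\<eta> \<in> K" for \<xi> \<eta>
      using diff[OF that(1) diff[OF zero that(2)]] by simp
    show "c *\<^sub>C \<xi> \<in> K" if "\<xi> \<in> K" for c \<xi>
      using bounded_linear.tendsto[OF bounded_linear_scaleC, of "mean (\<lambda>t. V t \<xi>)" 0 at_top c] that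
      by (simp add: K_def Vs[abs_def])
  qed
  have "closed K"
    unfolding closed_sequential_limits
  proof (intro allI impI, elim conjE)
    fix y \<xi> assume y: "\<forall>n. y n \<in> K" "y \<longlonglongrightarrow> \<xi>"
    have "((\<lambda>T. mean (\<lambda>t. V t \<xi>) T) \<longlongrightarrow> 0) at_top"
    proof (rule tendsto_if_approximable[where C = 1])
      show "norm (mean (\<lambda>t. V t \<xi>) T - mean (\<lambda>t. V t \<zeta>) T) \<le> 1 * norm (\<xi> - \<zeta>)" for T \<zeta>
        unfolding Vd[symmetric] using mean_norm_le[OF V_continuous Vb] by simp
      fix e :: real assume e: "e > 0"
      obtain n where "dist (y n) \<xi> < e" using tendstoD[OF y(2) e] eventually_happens by fastforce
      then show "\<exists>\<zeta> l. ((\<lambda>T. mean (\<lambda>t. V t \<zeta>) T) \<longlongrightarrow> l) at_top \<and> norm (\<xi> - \<zeta>) < e \<and> norm (l - 0) < e"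
        using y(1) e by (intro exI[of _ "y n"] exI[of _ 0]) (auto simp: K_def dist_norm norm_minus_commute)
    qed
    then show "\<xi> \<in> K" by (simp add: K_def)
  qed
  define p q where "p = proj K \<xi>" and "q = \<xi> - proj K \<xi>"
  have pK: "p \<in> K" unfolding p_def by (rule proj_mem[OF K \<open>closed K\<close>])
  have q: "cinner k q = 0" if "k \<in> K" for k
    unfolding q_def by (rule proj_orthogonal[OF K \<open>closed K\<close> that])
  have cob: "V s \<eta> - \<eta> \<in> K" for s \<eta>
    using mean_shift_tendsto[OF V_continuous[of \<eta>] Vb, of s] by (simp add: K_def V_diff V_add[symmetric])
  have q_inv: "q \<in> invariants"
    unfolding invariants_def
  proof safe
    fix s
    show "V s q = q"
    proof (rule cinner_ext)
      fix \<eta>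
      have "cinner (V (- s) \<eta> - \<eta>) q = 0" by (rule q[OF cob])
      then show "cinner \<eta> (V s q) = cinner \<eta> q" by (simp add: cinner.diff_left V_adjoint)
    qed
  qed
  \<comment> \<open>What remains is that the part \<open>p\<close> in \<open>K\<close> is orthogonal
    to the invariant vectors: pairing its mean with such a vector gives a constant in
    \<open>T\<close>, yet the mean tends to 0.\<close>
  have "P \<xi> = q"
  proof (rule proj_eqI[OF invariants_subspace invariants_closed q_inv])
    fix k assume "k \<in> invariants"
    then have Vk: "V t k = k" for t by (simp add: invariants_def)
    have "mean (\<lambda>t. cinner k (V t p)) T = cinner k (mean (\<lambda>t. V t p) T)" for T
      by (rule mean_bounded_linear[OF cinner.bounded_linear_right V_continuous Vb])
    moreover have "cinner k (V t p) = cinner k p" for t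
      using V_adjoint[of "- t" k p] by (simp add: Vk)
    ultimately have c: "cinner k (mean (\<lambda>t. V t p) T) = cinner k p" for T by (simp add: mean_const)
    have "((\<lambda>T. cinner k (mean (\<lambda>t. V t p) T)) \<longlongrightarrow> cinner k 0) at_top"
      using pK by (intro cinner.tendsto tendsto_const) (simp add: K_def)
    then have "cinner k p = 0" unfolding c by (simp add: tendsto_const_iff)
    then show "cinner k (\<xi> - q) = 0" by (simp add: q_def p_def)
  qed
  moreover have "mean (\<lambda>t. V t \<xi>) = (\<lambda>T. mean (\<lambda>t. V t p) T + q)"
  proof
    fix T
    have "mean (\<lambda>t. V t (\<xi> - p)) T = q"
      using q_inv by (simp add: p_def q_def[symmetric] invariants_def mean_const)
    then show "mean (\<lambda>t. V t \<xi>) T = mean (\<lambda>t. V t p) T + q" by (simp add: Vd algebra_simps)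
  qed
  moreover have "((\<lambda>T. mean (\<lambda>t. V t p) T + q) \<longlongrightarrow> 0 + q) at_top"
    using pK by (intro tendsto_intros) (simp add: K_def)
  ultimately show ?thesis by simp
qed

end

section \<open>The conditional expectation of a half-sided translation\<close>

locale half_sided_translation = averaged_flow h \<epsilon> V
  for h :: "real \<Rightarrow> real" and \<epsilon> :: real
    and V :: "real \<Rightarrow> 'a::{complex_hilbert, second_countable_topology} \<Rightarrow> 'a" +
  fixes M :: "('a \<Rightarrow> 'a) set" and \<Omega> :: 'a
  assumes M: "von_neumann_algebra M"
    and commutant_cyclic: "closure ((\<lambda>y. y \<Omega>) ` commutant M) = UNIV"
    and V_vacuum: "V t \<Omega> = \<Omega>"
    and half_sided: "t \<ge> 0 \<Longrightarrow> x \<in> M \<Longrightarrow> V t \<circ> x \<circ> V (- t) \<in> M"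
begin

abbreviation orbit :: "('a \<Rightarrow> 'a) \<Rightarrow> 'a \<Rightarrow> real \<Rightarrow> 'a" where
  "orbit x \<xi> t \<equiv> V t (x (V (- t) \<xi>))"

definition fixed_points :: "('a \<Rightarrow> 'a) set" where
  "fixed_points = {x \<in> M. \<forall>t \<xi>. x (V t \<xi>) = V t (x \<xi>)}"

text \<open>\<open>Lim\<close> is total but informative only where the limit exists;
  \<open>expectation_tendsto\<close> supplies this for every \<open>x\<close> in \<open>M\<close>,
  local or not.\<close>

definition expectation :: "('a \<Rightarrow> 'a) \<Rightarrow> 'a \<Rightarrow> 'a" where
  "expectation x \<xi> = Lim at_top (mean (orbit x \<xi>))"

lemma M_bounded_clinear: "x \<in> M \<Longrightarrow> bounded_clinear x"
  by (rule von_neumann_algebra_bounded_clinear[OF M])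

lemma commutant_apply: "y \<in> commutant M \<Longrightarrow> x \<in> M \<Longrightarrow> y (x \<xi>) = x (y \<xi>)"
  by (rule commutantD(3))

lemma eq_if_eq_on_commutant_orbit:
  fixes f g :: "'a \<Rightarrow> 'b::t2_space"
  assumes "continuous_on UNIV f" "continuous_on UNIV g"
    and eq: "\<And>y. y \<in> commutant M \<Longrightarrow> f (y \<Omega>) = g (y \<Omega>)"
  shows "f \<xi> = g \<xi>"
proof -
  have "closure ((\<lambda>y. y \<Omega>) ` commutant M) \<subseteq> {\<xi>. f \<xi> = g \<xi>}"
    by (rule closure_minimal) (use eq in \<open>auto intro: closed_Collect_eq assms(1,2)\<close>)
  then show ?thesis unfolding commutant_cyclic by blast
qed

lemma eq_if_eq_vacuum:
  assumes a: "a \<in> M" and b: "b \<in> M" and eq: "a \<Omega> = b \<Omega>"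
  shows "a = b"
proof
  show "a \<xi> = b \<xi>" for \<xi>
  proof (rule eq_if_eq_on_commutant_orbit[of a b])
    show "a (y \<Omega>) = b (y \<Omega>)" if "y \<in> commutant M" for y
      using commutant_apply[OF that a, of \<Omega>] commutant_apply[OF that b, of \<Omega>] eq by simp
  qed (intro bounded_clinear_continuous M_bounded_clinear a b)+
qed

lemma orbit_continuous:
  assumes "bounded_clinear x"
  shows "continuous_on UNIV (orbit x \<xi>)"
proof (rule V_continuous_compose)
  have "continuous_on UNIV (\<lambda>t. V (- t) \<xi>)"
    by (rule continuous_on_compose2[OF V_continuous]) (auto intro!: continuous_intros)
  then show "continuous_on UNIV (\<lambda>t. x (V (- t) \<xi>))"
    by (rule continuous_on_compose2[OF bounded_clinear_continuous[OF assms]]) auto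
qed

lemma orbit_bounded:
  assumes "bounded_clinear x"
  obtains C where "\<And>\<xi> t. norm (orbit x \<xi> t) \<le> C * norm \<xi>"
proof -
  obtain K where "\<And>\<xi>. norm (x \<xi>) \<le> norm \<xi> * K" using bounded_clinear_bound[OF assms] by blast
  from this[of "V (- t) \<xi>" for t \<xi>] have "norm (orbit x \<xi> t) \<le> K * norm \<xi>" for \<xi> t
    by (simp add: mult.commute[of K])
  then show ?thesis by (rule that)
qed

lemma orbit_diff: "bounded_clinear x \<Longrightarrow> orbit x \<xi> t - orbit x \<zeta> t = orbit x (\<xi> - \<zeta>) t"
  by (simp add: V_diff bounded_clinear_diff)

lemma mean_orbit_diff:
  assumes x: "bounded_clinear x"
  shows "mean (orbit x \<xi>) T - mean (orbit x \<zeta>) T = mean (orbit x (\<xi> - \<zeta>)) T"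
proof -
  obtain C where C: "\<And>\<xi> t. norm (orbit x \<xi> t) \<le> C * norm \<xi>" using orbit_bounded[OF x] by blast
  show ?thesis
    unfolding orbit_diff[OF x, symmetric]
    by (rule mean_diff[symmetric, OF orbit_continuous[OF x] C orbit_continuous[OF x] C])
qed

text \<open>For \<open>t \<ge> 0\<close> the translate of \<open>x\<close> lies in \<open>M\<close> and commutes with \<open>y\<close>, so that the mean ergodic
  theorem for \<open>x \<Omega>\<close> controls the averages on the dense set of vectors \<open>y \<Omega>\<close>.\<close>

lemma mean_orbit_tendsto_commutant:
  assumes x: "x \<in> M" and y: "y \<in> commutant M"
  shows "(mean (orbit x (y \<Omega>)) \<longlongrightarrow> y (P (x \<Omega>))) at_top"
proof -
  note bx = M_bounded_clinear[OF x] and yb = commutantD(1)[OF y]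
  obtain C where C: "\<And>\<xi> t. norm (orbit x \<xi> t) \<le> C * norm \<xi>" using orbit_bounded[OF bx] by blast
  obtain K where K: "\<And>\<xi>. norm (y \<xi>) \<le> norm \<xi> * K" using bounded_clinear_bound[OF yb] by blast
  define G where "G t = y (V t (x \<Omega>))" for t
  have G: "continuous_on UNIV G" "norm (G t) \<le> norm (x \<Omega>) * K" for t
    using K[of "V t (x \<Omega>)"] unfolding G_def
    by (auto intro: continuous_on_compose2[OF bounded_clinear_continuous[OF yb] V_continuous])
  have G_mean: "mean G T = y (mean (\<lambda>t. V t (x \<Omega>)) T)" for T
    unfolding G_def
    by (rule mean_bounded_linear[OF bounded_clinear_imp_bounded_linear[OF yb] V_continuous,
          of _ "norm (x \<Omega>)"]) simp
  have limG: "(mean G \<longlongrightarrow> y (P (x \<Omega>))) at_top"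
    using bounded_clinear_tendsto[OF yb mean_ergodic[of "x \<Omega>"]] unfolding G_mean[symmetric] .
  have orbG: "orbit x (y \<Omega>) t = G t" if "t \<ge> 0" for t
    using commutant_apply[OF y half_sided[OF that x], of \<Omega>] V_vacuum by (simp add: G_def)
  have lim0: "((\<lambda>t. orbit x (y \<Omega>) t - G t) \<longlongrightarrow> 0) at_top"
    by (rule tendsto_eventually, rule eventually_mono[OF eventually_ge_at_top[of 0]]) (simp add: orbG)
  have "(mean (\<lambda>t. orbit x (y \<Omega>) t - G t) \<longlongrightarrow> 0) at_top"
  proof (rule mean_tendsto[OF _ _ lim0])
    show "continuous_on UNIV (\<lambda>t. orbit x (y \<Omega>) t - G t)"
      by (intro continuous_on_diff orbit_continuous bx G)
    show "norm (orbit x (y \<Omega>) t - G t) \<le> C * norm (y \<Omega>) + norm (x \<Omega>) * K" for t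
      using norm_triangle_ineq4[of "orbit x (y \<Omega>) t" "G t"] C[of t "y \<Omega>"] G(2)[of t] by linarith
  qed
  moreover have "mean (\<lambda>t. orbit x (y \<Omega>) t - G t) = (\<lambda>T. mean (orbit x (y \<Omega>)) T - mean G T)"
    by (rule ext) (rule mean_diff[OF orbit_continuous[OF bx] C G])
  ultimately have "((\<lambda>T. mean (orbit x (y \<Omega>)) T - mean G T) \<longlongrightarrow> 0) at_top" by simp
  from tendsto_add[OF this limG] show ?thesis by simp
qed

text \<open>Conjugation by the isometries \<open>V t\<close> keeps the operator bound of
  \<open>x\<close>, so the averages are Lipschitz uniformly in \<open>T\<close> and convergence on
  the dense set M'Omega spreads to every vector.\<close>

lemma expectation_tendsto:
  assumes x: "x \<in> M"
  shows "(mean (orbit x \<xi>) \<longlongrightarrow> expectation x \<xi>) at_top"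
proof -
  note bx = M_bounded_clinear[OF x]
  obtain C where C: "\<And>\<xi> t. norm (orbit x \<xi> t) \<le> C * norm \<xi>" using orbit_bounded[OF bx] by blast
  have "\<exists>L. ((\<lambda>T. mean (orbit x \<xi>) T) \<longlongrightarrow> L) at_top"
  proof (rule convergent_if_dense[OF _ commutant_cyclic])
    show "norm (mean (orbit x \<xi>) T - mean (orbit x \<zeta>) T) \<le> C * norm (\<xi> - \<zeta>)" for T \<xi> \<zeta>
      unfolding mean_orbit_diff[OF bx] by (rule mean_norm_le[OF orbit_continuous[OF bx] C])
    show "\<exists>l. ((\<lambda>T. mean (orbit x \<zeta>) T) \<longlongrightarrow> l) at_top" if "\<zeta> \<in> (\<lambda>y. y \<Omega>) ` commutant M" for \<zeta>
      using that mean_orbit_tendsto_commutant[OF x] by blast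
  qed
  then obtain L where "(mean (orbit x \<xi>) \<longlongrightarrow> L) at_top" by blast
  moreover from this have "expectation x \<xi> = L"
    unfolding expectation_def by (intro tendsto_Lim) auto
  ultimately show ?thesis by simp
qed

lemma expectation_eqI: "x \<in> M \<Longrightarrow> (mean (orbit x \<xi>) \<longlongrightarrow> l) at_top \<Longrightarrow> expectation x \<xi> = l"
  using expectation_tendsto by (rule tendsto_unique[rotated]) auto

lemma expectation_commutant:
  "x \<in> M \<Longrightarrow> y \<in> commutant M \<Longrightarrow> expectation x (y \<Omega>) = y (P (x \<Omega>))"
  by (intro expectation_eqI mean_orbit_tendsto_commutant)

lemma expectation_vacuum: "x \<in> M \<Longrightarrow> expectation x \<Omega> = P (x \<Omega>)"
  using expectation_commutant[OF _ von_neumann_algebra_id[OF von_neumann_algebra_commutant'[OF M]]]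
  by simp

lemma expectation_bounded_clinear:
  assumes x: "x \<in> M"
  shows "bounded_clinear (expectation x)"
proof -
  note bx = M_bounded_clinear[OF x]
  obtain C where C: "\<And>\<xi> t. norm (orbit x \<xi> t) \<le> C * norm \<xi>" using orbit_bounded[OF bx] by blast
  have diff: "expectation x (\<xi> - \<eta>) = expectation x \<xi> - expectation x \<eta>" for \<xi> \<eta>
    using tendsto_diff[OF expectation_tendsto[OF x, of \<xi>] expectation_tendsto[OF x, of \<eta>]]
    unfolding mean_orbit_diff[OF bx] by (rule expectation_eqI[OF x])
  show ?thesis
  proof (rule bounded_clinear_intro[where K = C])
    \<comment> \<open>Only compatibility with differences has been established, so a sum is written
      as two nested differences.\<close>
    have "expectation x (\<xi> - (0 - \<eta>)) = expectation x \<xi> - (expectation x 0 - expectation x \<eta>)" for \<xi> \<eta>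
      by (simp only: diff)
    moreover have "expectation x 0 = 0" using diff[of 0 0] by simp
    ultimately show "expectation x (\<xi> + \<eta>) = expectation x \<xi> + expectation x \<eta>" for \<xi> \<eta> by simp
    show "expectation x (c *\<^sub>C \<xi>) = c *\<^sub>C expectation x \<xi>" for c \<xi>
    proof (rule expectation_eqI[OF x])
      have "mean (orbit x (c *\<^sub>C \<xi>)) = (\<lambda>T. c *\<^sub>C mean (orbit x \<xi>) T)"
        by (simp add: fun_eq_iff bounded_clinear_scaleC_apply[OF V_bounded_clinear]
            bounded_clinear_scaleC_apply[OF bx]
            mean_bounded_linear[OF bounded_linear_scaleC orbit_continuous[OF bx] C])
      then show "(mean (orbit x (c *\<^sub>C \<xi>)) \<longlongrightarrow> c *\<^sub>C expectation x \<xi>) at_top"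
        using bounded_linear.tendsto[OF bounded_linear_scaleC expectation_tendsto[OF x]] by simp
    qed
    show "norm (expectation x \<xi>) \<le> norm \<xi> * C" for \<xi>
      by (rule tendsto_upperbound[OF tendsto_norm[OF expectation_tendsto[OF x]]])
         (use mean_norm_le[OF orbit_continuous[OF bx] C] in \<open>auto simp: mult.commute[of _ C]\<close>)
  qed
qed

text \<open>The averages may involve translates at negative times, outside \<open>M\<close>, so
  closedness of \<open>M\<close> does not give this. Instead the limit formula
  \<open>y (P (x \<Omega>))\<close> on M'Omega visibly commutes with left multiplication by
  \<open>z\<close> in M'.\<close>

lemma expectation_mem:
  assumes x: "x \<in> M"
  shows "expectation x \<in> M"
proof (rule von_neumann_algebra_memI[OF M expectation_bounded_clinear[OF x]])
  fix z \<xi> assume z: "z \<in> commutant M"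
  note be = expectation_bounded_clinear[OF x] and bz = commutantD(1)[OF z]
  show "expectation x (z \<xi>) = z (expectation x \<xi>)"
  proof (rule eq_if_eq_on_commutant_orbit[of "\<lambda>\<xi>. expectation x (z \<xi>)" "\<lambda>\<xi>. z (expectation x \<xi>)"])
    show "continuous_on UNIV (\<lambda>\<xi>. expectation x (z \<xi>))"
      using bounded_clinear_continuous[OF bounded_clinear_comp[OF be bz]] by (simp add: comp_def)
    show "continuous_on UNIV (\<lambda>\<xi>. z (expectation x \<xi>))"
      using bounded_clinear_continuous[OF bounded_clinear_comp[OF bz be]] by (simp add: comp_def)
    fix y assume y: "y \<in> commutant M"
    show "expectation x (z (y \<Omega>)) = z (expectation x (y \<Omega>))"
      using expectation_commutant[OF x y]
        expectation_commutant[OF x von_neumann_algebra_comp[OF von_neumann_algebra_commutant'[OF M] z y]]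
      by simp
  qed
qed

text \<open>Turns operator identities into identities of vectors at Omega. Additivity and
  homogeneity in \<open>x\<close>, as well as invariance under the flow, are obtained this
  way.\<close>

lemma expectation_unique:
  assumes "x \<in> M" "b \<in> M" "b \<Omega> = P (x \<Omega>)"
  shows "expectation x = b"
  by (rule eq_if_eq_vacuum) (use assms in \<open>simp_all add: expectation_mem expectation_vacuum\<close>)

text \<open>For \<open>s \<ge> 0\<close> conjugation by \<open>V s\<close> keeps the expectation in
  \<open>M\<close> and does not change its vector at Omega, which is already invariant. Negative
  times follow by inverting the flow.\<close>

lemma expectation_fixed:
  assumes x: "x \<in> M"
  shows "expectation x \<in> fixed_points"
proof -
  have pos: "expectation x (V s \<xi>) = V s (expectation x \<xi>)" if s: "s \<ge> 0" for s \<xi>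
  proof -
    have "expectation x = V s \<circ> expectation x \<circ> V (- s)"
      by (rule expectation_unique[OF x half_sided[OF s expectation_mem[OF x]]])
         (simp add: V_vacuum expectation_vacuum[OF x] V_P)
    then have "expectation x (V s \<xi>) = (V s \<circ> expectation x \<circ> V (- s)) (V s \<xi>)" by (rule fun_cong)
    then show ?thesis by simp
  qed
  have "expectation x (V s \<xi>) = V s (expectation x \<xi>)" for s \<xi>
  proof (cases "s \<ge> 0")
    case False
    then have "expectation x (V (- s) (V s \<xi>)) = V (- s) (expectation x (V s \<xi>))" by (intro pos) simp
    then have "V s (expectation x \<xi>) = V s (V (- s) (expectation x (V s \<xi>)))" by simp
    then show ?thesis by (simp only: V_inverse)
  qed (rule pos)
  with expectation_mem[OF x] show ?thesis by (simp add: fixed_points_def)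
qed

lemma expectation_id:
  assumes "x \<in> fixed_points"
  shows "expectation x = x"
proof -
  have x: "x \<in> M" and xV: "V t (x \<xi>) = x (V t \<xi>)" for t \<xi> using assms by (auto simp: fixed_points_def)
  have "x \<Omega> \<in> invariants" by (simp add: invariants_def xV V_vacuum)
  then show ?thesis by (intro expectation_unique[OF x x]) (simp add: P_id)
qed

text \<open>Operators commuting with the flow can be pulled out of the orbit, and a bounded operator
  out of the average, before the limit is taken.\<close>

lemma expectation_bimodule:
  assumes x: "x \<in> fixed_points" and y: "y \<in> M" and z: "z \<in> fixed_points"
  shows "expectation (x \<circ> y \<circ> z) = x \<circ> expectation y \<circ> z"
proof
  fix \<xi>
  have xM: "x \<in> M" and zM: "z \<in> M"
    and xV: "V t (x \<xi>) = x (V t \<xi>)" and zV: "z (V t \<xi>) = V t (z \<xi>)" for t \<xi>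
    using x z by (auto simp: fixed_points_def)
  obtain C where C: "\<And>\<xi> t. norm (orbit y \<xi> t) \<le> C * norm \<xi>"
    using orbit_bounded[OF M_bounded_clinear[OF y]] by blast
  show "expectation (x \<circ> y \<circ> z) \<xi> = (x \<circ> expectation y \<circ> z) \<xi>"
  proof (rule expectation_eqI)
    show "x \<circ> y \<circ> z \<in> M" by (intro von_neumann_algebra_comp[OF M] xM y zM)
    have "mean (orbit (x \<circ> y \<circ> z) \<xi>) = (\<lambda>T. x (mean (orbit y (z \<xi>)) T))"
      using mean_bounded_linear[OF bounded_clinear_imp_bounded_linear[OF M_bounded_clinear[OF xM]]
          orbit_continuous[OF M_bounded_clinear[OF y]] C]
      by (simp add: xV zV fun_eq_iff)
    then show "(mean (orbit (x \<circ> y \<circ> z) \<xi>) \<longlongrightarrow> (x \<circ> expectation y \<circ> z) \<xi>) at_top"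
      using bounded_clinear_tendsto[OF M_bounded_clinear[OF xM] expectation_tendsto[OF y, of "z \<xi>"]]
      by simp
  qed
qed

lemma expectation_cadjoint:
  assumes x: "x \<in> M"
  shows "cadjoint (expectation x) = expectation (cadjoint x)"
proof (rule cadjoint_eqI)
  fix \<xi> \<eta>
  note bx = M_bounded_clinear[OF x] and x' = von_neumann_algebra_cadjoint[OF M x]
  note bx' = M_bounded_clinear[OF x']
  obtain C where C: "\<And>\<xi> t. norm (orbit x \<xi> t) \<le> C * norm \<xi>" using orbit_bounded[OF bx] by blast
  obtain C' where C': "\<And>\<xi> t. norm (orbit (cadjoint x) \<xi> t) \<le> C' * norm \<xi>" using orbit_bounded[OF bx'] by blast
  have adj: "cinner (orbit x \<xi> t) \<eta> = cinner \<xi> (orbit (cadjoint x) \<eta> t)" for t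
    by (simp add: V_adjoint cinner_cadjoint[OF bx])
  have "mean (\<lambda>t. cinner (orbit x \<xi> t) \<eta>) T = cinner (mean (orbit x \<xi>) T) \<eta>" for T
    by (rule mean_bounded_linear[OF cinner.bounded_linear_left orbit_continuous[OF bx] C])
  moreover have "mean (\<lambda>t. cinner \<xi> (orbit (cadjoint x) \<eta> t)) T = cinner \<xi> (mean (orbit (cadjoint x) \<eta>) T)" for T
    by (rule mean_bounded_linear[OF cinner.bounded_linear_right orbit_continuous[OF bx'] C'])
  ultimately have "cinner (mean (orbit x \<xi>) T) \<eta> = cinner \<xi> (mean (orbit (cadjoint x) \<eta>) T)" for T
    by (simp only: adj)
  then have "((\<lambda>T. cinner (mean (orbit x \<xi>) T) \<eta>) \<longlongrightarrow> cinner \<xi> (expectation (cadjoint x) \<eta>)) at_top"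
    using cinner.tendsto[OF tendsto_const[of \<xi>] expectation_tendsto[OF x', of \<eta>]] by simp
  moreover have "((\<lambda>T. cinner (mean (orbit x \<xi>) T) \<eta>) \<longlongrightarrow> cinner (expectation x \<xi>) \<eta>) at_top"
    by (intro cinner.tendsto tendsto_const expectation_tendsto[OF x])
  ultimately show "cinner (expectation x \<xi>) \<eta> = cinner \<xi> (expectation (cadjoint x) \<eta>)"
    using tendsto_unique[OF trivial_limit_at_top_linorder] by blast
qed

text \<open>Before the limit the squared norm of an average is at most the average of the squared
  norms, which is the quadratic form of the averaged \<open>cadjoint x \<circ> x\<close>. Strong
  convergence carries the inequality over.\<close>

lemma expectation_schwarz:
  assumes x: "x \<in> M"
  shows "op_le (cadjoint (expectation x) \<circ> expectation x) (expectation (cadjoint x \<circ> x))"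
  unfolding op_le_def
proof
  fix \<xi>
  note bx = M_bounded_clinear[OF x] and be = expectation_bounded_clinear[OF x]
  have xx: "cadjoint x \<circ> x \<in> M" by (intro von_neumann_algebra_comp[OF M] von_neumann_algebra_cadjoint[OF M] x)
  note bxx = M_bounded_clinear[OF xx]
  obtain C where C: "\<And>\<xi> t. norm (orbit x \<xi> t) \<le> C * norm \<xi>" using orbit_bounded[OF bx] by blast
  obtain D where D: "\<And>\<xi> t. norm (orbit (cadjoint x \<circ> x) \<xi> t) \<le> D * norm \<xi>" using orbit_bounded[OF bxx] by blast
  define r where "r = mean (\<lambda>t. (norm (orbit x \<xi> t))\<^sup>2)"
  have cont: "continuous_on UNIV (\<lambda>t. norm (orbit x \<xi> t))"
    by (intro continuous_on_norm orbit_continuous bx)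
  have bd: "norm (norm (orbit x \<xi> t)) \<le> C * norm \<xi>" for t using C[of t \<xi>] by simp
  have r_ge: "(norm (mean (orbit x \<xi>) T))\<^sup>2 \<le> r T" for T
  proof -
    have "norm (mean (orbit x \<xi>) T) \<le> mean (\<lambda>t. norm (orbit x \<xi> t)) T"
      unfolding mean_def
      by (rule Bochner_Integration.integral_norm_bound_integral)
         (use mean_integrable[OF orbit_continuous[OF bx] C] mean_integrable[OF cont bd] in \<open>auto simp: h_nonneg\<close>)
    then have "(norm (mean (orbit x \<xi>) T))\<^sup>2 \<le> (mean (\<lambda>t. norm (orbit x \<xi> t)) T)\<^sup>2"
      by (intro power_mono) auto
    also have "\<dots> \<le> r T" unfolding r_def by (rule mean_square_le[OF cont bd])
    finally show ?thesis .
  qed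
  have r_eq: "cinner \<xi> (mean (orbit (cadjoint x \<circ> x) \<xi>) T) = of_real (r T)" for T
  proof -
    have "cinner \<xi> (orbit (cadjoint x \<circ> x) \<xi> t) = of_real ((norm (orbit x \<xi> t))\<^sup>2)" for t
      using V_adjoint[of "- t" \<xi> "cadjoint x (x (V (- t) \<xi>))"] cinner_cadjoint[OF bx, symmetric]
        cinner_self[of "x (V (- t) \<xi>)"] by simp
    moreover have "mean (\<lambda>t. cinner \<xi> (orbit (cadjoint x \<circ> x) \<xi> t)) T
        = cinner \<xi> (mean (orbit (cadjoint x \<circ> x) \<xi>) T)"
      by (rule mean_bounded_linear[OF cinner.bounded_linear_right orbit_continuous[OF bxx] D])
    ultimately have "cinner \<xi> (mean (orbit (cadjoint x \<circ> x) \<xi>) T)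
        = mean (\<lambda>t. complex_of_real ((norm (orbit x \<xi> t))\<^sup>2)) T"
      by simp
    also have "\<dots> = of_real (r T)"
      unfolding r_def
    proof (rule mean_bounded_linear[OF bounded_linear_of_real])
      show "norm ((norm (orbit x \<xi> t))\<^sup>2) \<le> (C * norm \<xi>)\<^sup>2" for t
        using power_mono[OF C[of t \<xi>], of 2] by simp
    qed (use cont in \<open>auto intro: continuous_on_power\<close>)
    finally show ?thesis .
  qed
  have lim: "((\<lambda>T. complex_of_real (r T)) \<longlongrightarrow> cinner \<xi> (expectation (cadjoint x \<circ> x) \<xi>)) at_top"
    unfolding r_eq[symmetric] by (intro cinner.tendsto tendsto_const expectation_tendsto[OF xx])
  \<comment> \<open>\<open>op_le\<close> asks for a nonnegative real number, so the imaginary part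
    has to be seen to vanish as well.\<close>
  have Im: "Im (cinner \<xi> (expectation (cadjoint x \<circ> x) \<xi>)) = 0"
    using tendsto_Im[OF lim] by (simp add: tendsto_const_iff)
  have Re: "(norm (expectation x \<xi>))\<^sup>2 \<le> Re (cinner \<xi> (expectation (cadjoint x \<circ> x) \<xi>))"
  proof (rule tendsto_le[OF trivial_limit_at_top_linorder _ tendsto_power[OF tendsto_norm[OF expectation_tendsto[OF x]]]])
    show "(r \<longlongrightarrow> Re (cinner \<xi> (expectation (cadjoint x \<circ> x) \<xi>))) at_top"
      using tendsto_Re[OF lim] by simp
  qed (simp add: r_ge)
  have "cinner \<xi> ((cadjoint (expectation x) \<circ> expectation x) \<xi>) = of_real ((norm (expectation x \<xi>))\<^sup>2)"
    using cinner_cadjoint[OF be, of \<xi> "expectation x \<xi>"] by (simp add: cinner_self)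
  then show "cinner \<xi> (expectation (cadjoint x \<circ> x) \<xi> - (cadjoint (expectation x) \<circ> expectation x) \<xi>) \<in> \<real>\<^sub>\<ge>\<^sub>0"
    using Im Re by (simp add: complex_nonneg_Reals_iff cinner.diff_right)
qed

text \<open>Written as the commutant of a self-adjoint set, the fixed point set is at once a von
  Neumann algebra.\<close>

lemma fixed_points_eq_commutant: "fixed_points = commutant (commutant M \<union> range V)"
proof (intro equalityI subsetI)
  fix x assume "x \<in> fixed_points"
  then have x: "x \<in> M" and xV: "x (V t \<xi>) = V t (x \<xi>)" for t \<xi> by (auto simp: fixed_points_def)
  show "x \<in> commutant (commutant M \<union> range V)"
  proof (rule commutantI[OF M_bounded_clinear[OF x]])
    show "x (y \<xi>) = y (x \<xi>)" if "y \<in> commutant M \<union> range V" for y \<xi>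
      using that commutant_apply[OF _ x, of y \<xi>] xV by auto
  qed
next
  fix x assume x: "x \<in> commutant (commutant M \<union> range V)"
  have "x \<in> commutant (commutant M)"
    using x commutant_antimono[of "commutant M" "commutant M \<union> range V"] by blast
  then have "x \<in> M" by (simp add: von_neumann_algebra_bicommutant[OF M])
  moreover have "x (V t \<xi>) = V t (x \<xi>)" for t \<xi> by (rule commutantD(3)[OF x]) simp
  ultimately show "x \<in> fixed_points" by (simp add: fixed_points_def)
qed

lemma von_neumann_algebra_fixed_points: "von_neumann_algebra fixed_points"
  unfolding fixed_points_eq_commutant
proof (rule von_neumann_algebra_commutant)
  note M' = von_neumann_algebra_commutant'[OF M]
  have "cadjoint (V t) = V (- t)" for t by (rule cadjoint_eqI) (rule V_adjoint)
  then show "bounded_clinear y \<and> cadjoint y \<in> commutant M \<union> range V" if "y \<in> commutant M \<union> range V" for y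
    using that von_neumann_algebra_bounded_clinear[OF M'] von_neumann_algebra_cadjoint[OF M'] V_bounded_clinear
    by auto
qed

lemma conditional_expectation_fixed_points: "conditional_expectation M fixed_points expectation"
  unfolding conditional_expectation_def
proof (intro conjI ballI allI)
  note plus = von_neumann_algebra_plus[OF M] and scale = von_neumann_algebra_scaleC[OF M]
  show "expectation ` M = fixed_points"
    using expectation_fixed expectation_id by (force simp: fixed_points_def)
  show "expectation (\<lambda>\<xi>. x \<xi> + y \<xi>) = (\<lambda>\<xi>. expectation x \<xi> + expectation y \<xi>)"
    if "x \<in> M" "y \<in> M" for x y
    by (rule expectation_unique[OF plus plus])
       (simp_all add: that expectation_mem expectation_vacuum bounded_clinear_add[OF P_bounded_clinear])
  show "expectation (\<lambda>\<xi>. c *\<^sub>C x \<xi>) = (\<lambda>\<xi>. c *\<^sub>C expectation x \<xi>)" if "x \<in> M" for c x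
    by (rule expectation_unique[OF scale scale])
       (simp_all add: that expectation_mem expectation_vacuum bounded_clinear_scaleC_apply[OF P_bounded_clinear])
qed (use M von_neumann_algebra_fixed_points expectation_id expectation_bimodule expectation_schwarz
      in \<open>auto simp: fixed_points_def\<close>)

lemma expectation_preserves_vacuum:
  assumes "x \<in> M"
  shows "cinner \<Omega> (expectation x \<Omega>) = cinner \<Omega> (x \<Omega>)"
proof -
  have "P \<Omega> = \<Omega>" by (rule P_id) (simp add: invariants_def V_vacuum)
  then show ?thesis using assms P_selfadjoint[of \<Omega> "x \<Omega>"] by (simp add: expectation_vacuum)
qed

text \<open>For \<open>z\<close> commuting with the images of \<open>B\<close>, the matrix elements of \<open>[z, E(a)]\<close> between vectors
  \<open>y \<Omega>\<close> depend on \<open>a\<close> only through \<open>a \<Omega>\<close> and \<open>a\<^sup>* \<Omega>\<close>, hence are weakly continuous in \<open>a\<close>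
  and vanish on all of \<open>M\<close>, without any appeal to Kaplansky's theorem.\<close>

lemma vn_generated_expectation:
  assumes B: "\<And>b. b \<in> B \<Longrightarrow> bounded_clinear b \<and> cadjoint b \<in> B"
    and id: "id \<in> B"
    and comp: "\<And>b c. b \<in> B \<Longrightarrow> c \<in> B \<Longrightarrow> b \<circ> c \<in> B"
    and plus: "\<And>b c. b \<in> B \<Longrightarrow> c \<in> B \<Longrightarrow> (\<lambda>\<xi>. b \<xi> + c \<xi>) \<in> B"
    and scaleC: "\<And>b c. b \<in> B \<Longrightarrow> (\<lambda>\<xi>. c *\<^sub>C b \<xi>) \<in> B"
    and gen: "commutant (commutant B) = M"
  shows "vn_generated (expectation ` B) = fixed_points"
proof
  have BM: "B \<subseteq> M" unfolding gen[symmetric] by (rule subset_bicommutant) (use B in blast)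
  show "vn_generated (expectation ` B) \<subseteq> fixed_points"
    by (rule vn_generated_subset[OF von_neumann_algebra_fixed_points]) (use BM expectation_fixed in blast)
  show "fixed_points \<subseteq> vn_generated (expectation ` B)"
    unfolding vn_generated_def
  proof
    fix x assume x: "x \<in> fixed_points"
    then have xM: "x \<in> M" by (simp add: fixed_points_def)
    note bx = M_bounded_clinear[OF xM]
    show "x \<in> commutant (commutant (expectation ` B \<union> cadjoint ` expectation ` B))"
    proof (rule commutantI[OF bx])
      fix z \<xi> assume z: "z \<in> commutant (expectation ` B \<union> cadjoint ` expectation ` B)"
      note bz = commutantD(1)[OF z]
      have matrix: "cinner (y1 \<Omega>) (z (expectation a (y2 \<Omega>)) - expectation a (z (y2 \<Omega>))) =
          cinner (P (cadjoint y2 (cadjoint z (y1 \<Omega>)))) (a \<Omega>) + cinner \<Omega> (a (- P (cadjoint y1 (z (y2 \<Omega>)))))"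
        if y1: "y1 \<in> commutant M" and y2: "y2 \<in> commutant M" and a: "a \<in> M" for y1 y2 a
      proof -
        note by1 = commutantD(1)[OF y1] and by2 = commutantD(1)[OF y2] and ba = M_bounded_clinear[OF a]
        have "cinner (y1 \<Omega>) (z (expectation a (y2 \<Omega>))) = cinner (P (cadjoint y2 (cadjoint z (y1 \<Omega>)))) (a \<Omega>)"
          unfolding expectation_commutant[OF a y2] P_selfadjoint
            cinner_cadjoint_left[OF by2] cinner_cadjoint_left[OF bz] ..
        moreover have "cinner (y1 \<Omega>) (expectation a (z (y2 \<Omega>))) = cinner \<Omega> (a (P (cadjoint y1 (z (y2 \<Omega>)))))"
        proof -
          have "cinner (y1 \<Omega>) (expectation a (z (y2 \<Omega>))) = cinner (expectation (cadjoint a) (y1 \<Omega>)) (z (y2 \<Omega>))"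
            unfolding expectation_cadjoint[OF a, symmetric]
              cinner_cadjoint_left[OF expectation_bounded_clinear[OF a]] ..
          also have "\<dots> = cinner \<Omega> (a (P (cadjoint y1 (z (y2 \<Omega>)))))"
            unfolding expectation_commutant[OF von_neumann_algebra_cadjoint[OF M a] y1]
              cinner_cadjoint[OF by1] P_selfadjoint cinner_cadjoint_left[OF ba] ..
          finally show ?thesis .
        qed
        moreover have "a (- v) = - a v" for v
          using bounded_clinear_diff[OF ba, of 0 v] bounded_clinear_zero[OF ba] by simp
        ultimately show ?thesis by (simp add: cinner.diff_right cinner_minus_right)
      qed
      have zero: "cinner (y1 \<Omega>) (z (x (y2 \<Omega>)) - x (z (y2 \<Omega>))) = 0"
        if y: "y1 \<in> commutant M" "y2 \<in> commutant M" for y1 y2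
      proof -
        \<comment> \<open>The two orbit vectors are Omega, seen from the left vector of the first
          term, and the argument of \<open>x\<close> in the second; the minus sign of the commutator
          sits inside that vector because the bicommutant lemma is stated for a sum.\<close>
        have "cinner (P (cadjoint y2 (cadjoint z (y1 \<Omega>)))) (x \<Omega>)
              + cinner \<Omega> (x (- P (cadjoint y1 (z (y2 \<Omega>))))) = 0"
        proof (rule bicommutant_two_vectors[where a = x, OF B id comp plus scaleC])
          show "x \<in> commutant (commutant B)" using xM by (simp add: gen)
          fix b assume b: "b \<in> B"
          then have "z (expectation b (y2 \<Omega>)) = expectation b (z (y2 \<Omega>))"
            by (intro commutantD(3)[OF z]) simp
          then show "cinner (P (cadjoint y2 (cadjoint z (y1 \<Omega>)))) (b \<Omega>)
              + cinner \<Omega> (b (- P (cadjoint y1 (z (y2 \<Omega>))))) = 0"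
            using matrix[OF y, of b] b BM by auto
        qed
        then show ?thesis using matrix[OF y xM] unfolding expectation_id[OF x] by simp
      qed
      have "z (x (y2 \<Omega>)) - x (z (y2 \<Omega>)) = 0" if y2: "y2 \<in> commutant M" for y2
      proof (rule cinner_ext)
        fix \<eta>
        show "cinner \<eta> (z (x (y2 \<Omega>)) - x (z (y2 \<Omega>))) = cinner \<eta> 0"
          by (rule eq_if_eq_on_commutant_orbit)
             (use zero[OF _ y2] in \<open>auto intro: linear_continuous_on cinner.bounded_linear_left\<close>)
      qed
      then have "z (x (y2 \<Omega>)) = x (z (y2 \<Omega>))" if "y2 \<in> commutant M" for y2
        using that by auto
      then show "x (z \<xi>) = z (x \<xi>)"
        using eq_if_eq_on_commutant_orbit[of "x \<circ> z" "z \<circ> x" \<xi>]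
          bounded_clinear_continuous[OF bounded_clinear_comp[OF bx bz]]
          bounded_clinear_continuous[OF bounded_clinear_comp[OF bz bx]] by simp
    qed
  qed
qed

end

section \<open>Lightlike translations of a Poincare covariant net\<close>

locale covariant_net =
  fixes \<A> :: "point set \<Rightarrow> ('a::{complex_hilbert, second_countable_topology} \<Rightarrow> 'a) set"
    and U :: "poincare \<Rightarrow> 'a \<Rightarrow> 'a"
    and \<Omega> :: 'a
  assumes net: "poincare_net \<A> U \<Omega>"
begin

abbreviation V :: "real \<Rightarrow> 'a \<Rightarrow> 'a" where
  "V t \<equiv> translation U (t, t)"

definition wedge_local :: "('a \<Rightarrow> 'a) set" where
  "wedge_local = (\<Union>D\<in>{D. region D \<and> D \<subseteq> right_wedge}. \<A> D)"

lemma local_algebra: "region D \<Longrightarrow> von_neumann_algebra (\<A> D)"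
  and isotony: "region D \<Longrightarrow> region D' \<Longrightarrow> D \<subseteq> D' \<Longrightarrow> \<A> D \<subseteq> \<A> D'"
  and covariance: "region D \<Longrightarrow> (\<lambda>x. U g \<circ> x \<circ> cadjoint (U g)) ` \<A> D = \<A> (poincare_act g ` D)"
  and U_vacuum: "U g \<Omega> = \<Omega>"
  and U_unitary: "unitary_op (U g)"
  and U_mult: "U (poincare_mult g g') = U g \<circ> U g'"
  and U_continuous: "continuous_on UNIV (\<lambda>g. U g \<xi>)"
  using net unfolding poincare_net_def unitary_representation_def by (simp_all del: split_paired_All)

lemma boost_zero: "boost 0 a = a"
  by (simp add: boost_def)

lemma U_zero: "U (0, 0) = id"
proof -
  have "U (0, 0) \<circ> U (0, 0) = U (0, 0)"
    using U_mult[of "(0, 0)" "(0, 0)"] by (simp add: poincare_mult_def boost_zero)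
  then have "cadjoint (U (0, 0)) \<circ> U (0, 0) \<circ> U (0, 0) = cadjoint (U (0, 0)) \<circ> U (0, 0)"
    by (simp only: comp_assoc)
  then show ?thesis using U_unitary[of "(0, 0)"] by (simp add: unitary_op_def)
qed

lemma unitary_flow_V: "unitary_flow V"
proof
  have bc: "bounded_clinear (V t)" for t
    using U_unitary by (simp add: unitary_op_def translation_def)
  then show "bounded_clinear (V t)" for t .
  have add: "V (s + t) \<xi> = V s (V t \<xi>)" for s t \<xi>
    using U_mult[of "(0, (s, s))" "(0, (t, t))"]
    by (simp add: translation_def poincare_mult_def boost_zero)
  then show "V (s + t) \<xi> = V s (V t \<xi>)" for s t \<xi> .
  show zero: "V 0 \<xi> = \<xi>" for \<xi> using U_zero by (simp add: translation_def zero_prod_def)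
  show "cinner (V t \<xi>) \<eta> = cinner \<xi> (V (- t) \<eta>)" for t \<xi> \<eta>
  proof -
    have "cadjoint (V t) \<circ> V t = id" using U_unitary by (simp add: unitary_op_def translation_def)
    then have "cadjoint (V t) (V t (V (- t) \<eta>)) = V (- t) \<eta>" by (metis comp_apply id_apply)
    moreover have "V t (V (- t) \<eta>) = \<eta>" using add[of t "- t" \<eta>] zero by simp
    ultimately show ?thesis using cinner_cadjoint[OF bc, of t \<xi> \<eta>] by simp
  qed
  show "continuous_on UNIV (\<lambda>t. V t \<xi>)" for \<xi>
    unfolding translation_def
    by (rule continuous_on_compose2[OF U_continuous]) (auto intro!: continuous_intros)
qed

sublocale unitary_flow V
  by (rule unitary_flow_V)

lemma cadjoint_V: "cadjoint (V t) = V (- t)"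
  by (rule cadjoint_eqI) (rule V_adjoint)

lemma wedge_localE:
  assumes "x \<in> wedge_local"
  obtains D where "region D" "D \<subseteq> right_wedge" "x \<in> \<A> D"
  using assms by (auto simp: wedge_local_def)

lemma wedge_localI: "region D \<Longrightarrow> D \<subseteq> right_wedge \<Longrightarrow> x \<in> \<A> D \<Longrightarrow> x \<in> wedge_local"
  by (auto simp: wedge_local_def)

text \<open>Regions need not be connected, so the union of two regions in the wedge is again one.
  This directedness is why the union of the local algebras is closed under sums and
  products.\<close>

lemma wedge_local_common:
  assumes "x \<in> wedge_local" "y \<in> wedge_local"
  obtains D where "region D" "D \<subseteq> right_wedge" "x \<in> \<A> D" "y \<in> \<A> D"
proof -
  obtain D where D: "region D" "D \<subseteq> right_wedge" "x \<in> \<A> D" using assms(1) by (rule wedge_localE)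
  obtain D' where D': "region D'" "D' \<subseteq> right_wedge" "y \<in> \<A> D'" using assms(2) by (rule wedge_localE)
  have R: "region (D \<union> D')" using D D' by (auto simp: region_def)
  show ?thesis
  proof (rule that[OF R])
    show "D \<union> D' \<subseteq> right_wedge" using D D' by blast
    show "x \<in> \<A> (D \<union> D')" using isotony[OF D(1) R] D(3) by blast
    show "y \<in> \<A> (D \<union> D')" using isotony[OF D'(1) R] D'(3) by blast
  qed
qed

lemma wedge_local_cadjoint:
  assumes "x \<in> wedge_local"
  shows "bounded_clinear x \<and> cadjoint x \<in> wedge_local"
proof -
  obtain D where D: "region D" "D \<subseteq> right_wedge" "x \<in> \<A> D" using assms by (rule wedge_localE)
  show ?thesis
    using von_neumann_algebra_bounded_clinear[OF local_algebra[OF D(1)] D(3)]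
      wedge_localI[OF D(1,2) von_neumann_algebra_cadjoint[OF local_algebra[OF D(1)] D(3)]] by simp
qed

text \<open>The empty set counts as a region, and its algebra, being a von Neumann algebra, contains
  the identity.\<close>

lemma wedge_local_id: "id \<in> wedge_local"
proof -
  have "region {}" by (simp add: region_def)
  then show ?thesis by (intro wedge_localI[of "{}"] von_neumann_algebra_id local_algebra) simp_all
qed

lemma wedge_local_comp:
  assumes "x \<in> wedge_local" "y \<in> wedge_local"
  shows "x \<circ> y \<in> wedge_local"
proof -
  obtain D where D: "region D" "D \<subseteq> right_wedge" "x \<in> \<A> D" "y \<in> \<A> D"
    using assms by (rule wedge_local_common)
  show ?thesis by (rule wedge_localI[OF D(1,2) von_neumann_algebra_comp[OF local_algebra[OF D(1)] D(3,4)]])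
qed

lemma wedge_local_plus:
  assumes "x \<in> wedge_local" "y \<in> wedge_local"
  shows "(\<lambda>\<xi>. x \<xi> + y \<xi>) \<in> wedge_local"
proof -
  obtain D where D: "region D" "D \<subseteq> right_wedge" "x \<in> \<A> D" "y \<in> \<A> D"
    using assms by (rule wedge_local_common)
  show ?thesis by (rule wedge_localI[OF D(1,2) von_neumann_algebra_plus[OF local_algebra[OF D(1)] D(3,4)]])
qed

lemma wedge_local_scaleC:
  assumes "x \<in> wedge_local"
  shows "(\<lambda>\<xi>. c *\<^sub>C x \<xi>) \<in> wedge_local"
proof -
  obtain D where D: "region D" "D \<subseteq> right_wedge" "x \<in> \<A> D" using assms by (rule wedge_localE)
  show ?thesis by (rule wedge_localI[OF D(1,2) von_neumann_algebra_scaleC[OF local_algebra[OF D(1)] D(3)]])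
qed

lemma wedge_algebra_bicommutant: "wedge_algebra \<A> = commutant (commutant wedge_local)"
proof -
  have "wedge_local \<union> cadjoint ` wedge_local = wedge_local" using wedge_local_cadjoint by blast
  then show ?thesis by (simp add: wedge_algebra_def vn_generated_def wedge_local_def[symmetric])
qed

lemma von_neumann_algebra_wedge: "von_neumann_algebra (wedge_algebra \<A>)"
  unfolding wedge_algebra_def wedge_local_def[symmetric]
  by (rule von_neumann_algebra_vn_generated) (use wedge_local_cadjoint in blast)

lemma wedge_local_subset: "wedge_local \<subseteq> wedge_algebra \<A>"
  unfolding wedge_algebra_bicommutant by (rule subset_bicommutant) (use wedge_local_cadjoint in blast)

text \<open>Translation by \<open>(t, t)\<close> fixes \<open>a\<^sub>0 - a\<^sub>1 < 0\<close> and increases \<open>a\<^sub>0 + a\<^sub>1 > 0\<close> by \<open>2 t\<close>.\<close>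

lemma wedge_local_translate:
  assumes t: "t \<ge> 0" and x: "x \<in> wedge_local"
  shows "V t \<circ> x \<circ> V (- t) \<in> wedge_local"
proof -
  obtain D where D: "region D" "D \<subseteq> right_wedge" "x \<in> \<A> D" using x by (rule wedge_localE)
  let ?g = "(0, (t, t)) :: poincare"
  have act: "poincare_act ?g ` D = (+) (t, t) ` D"
    by (rule image_cong) (simp_all add: poincare_act_def boost_zero add.commute)
  have "region (poincare_act ?g ` D)"
    unfolding act using D(1) by (simp add: region_def open_translation bounded_translation)
  moreover have "poincare_act ?g ` D \<subseteq> right_wedge"
    unfolding act using D(2) t by (fastforce simp: right_wedge_def)
  moreover have "V t \<circ> x \<circ> V (- t) \<in> \<A> (poincare_act ?g ` D)"
    unfolding covariance[OF D(1), symmetric] cadjoint_V[symmetric]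
    by (rule image_eqI[OF _ D(3)]) (simp add: translation_def)
  ultimately show ?thesis by (rule wedge_localI)
qed

text \<open>Localization is lost in the bicommutant, so the argument is dual: conjugation by
  \<open>V (- t)\<close> maps the commutant of the local operators into itself because conjugation
  by \<open>V t\<close> preserves the local operators.\<close>

lemma wedge_algebra_translate:
  assumes t: "t \<ge> 0" and x: "x \<in> wedge_algebra \<A>"
  shows "V t \<circ> x \<circ> V (- t) \<in> wedge_algebra \<A>"
  unfolding wedge_algebra_bicommutant
proof (rule commutantI)
  note x' = x[unfolded wedge_algebra_bicommutant]
  show "bounded_clinear (V t \<circ> x \<circ> V (- t))"
    by (intro bounded_clinear_comp V_bounded_clinear commutantD(1)[OF x'])
  fix z \<xi> assume z: "z \<in> commutant wedge_local"
  have "V (- t) \<circ> z \<circ> V t \<in> commutant wedge_local"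
  proof (rule commutantI)
    show "bounded_clinear (V (- t) \<circ> z \<circ> V t)"
      by (intro bounded_clinear_comp V_bounded_clinear commutantD(1)[OF z])
    fix y \<eta> assume y: "y \<in> wedge_local"
    have "z ((V t \<circ> y \<circ> V (- t)) (V t \<eta>)) = (V t \<circ> y \<circ> V (- t)) (z (V t \<eta>))"
      by (rule commutantD(3)[OF z wedge_local_translate[OF t y]])
    then have "V (- t) (z (V t (y \<eta>))) = V (- t) (V t (y (V (- t) (z (V t \<eta>)))))" by simp
    then show "(V (- t) \<circ> z \<circ> V t) (y \<eta>) = y ((V (- t) \<circ> z \<circ> V t) \<eta>)" by simp
  qed
  from commutantD(3)[OF x' this, of "V (- t) \<xi>"]
  have "x (V (- t) (z \<xi>)) = V (- t) (z (V t (x (V (- t) \<xi>))))" by simp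
  then show "(V t \<circ> x \<circ> V (- t)) (z \<xi>) = z ((V t \<circ> x \<circ> V (- t)) \<xi>)" by simp
qed

end

theorem lemma5p1:
  fixes \<A> :: "point set \<Rightarrow> ('a::{complex_hilbert, second_countable_topology} \<Rightarrow> 'a) set"
    and U :: "poincare \<Rightarrow> 'a \<Rightarrow> 'a"
    and \<Omega> :: 'a
    and h :: "real \<Rightarrow> real"
    and \<epsilon> :: real
  assumes "poincare_net \<A> U \<Omega>"
    and "bisognano_wichmann \<A> U \<Omega>"
    and "0 < \<epsilon>" and "\<epsilon> < 1"
    and "averaging_function h"
  shows "\<exists>E. conditional_expectation (wedge_algebra \<A>) (asymptotic_algebra \<A> U h \<epsilon>) E \<and>
             (\<forall>D x. region D \<and> D \<subseteq> right_wedge \<and> x \<in> \<A> D \<longrightarrow> has_asymptotic_field U h \<epsilon> x (E x)) \<and>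
             (\<forall>x\<in>wedge_algebra \<A>. cinner \<Omega> (E x \<Omega>) = cinner \<Omega> (x \<Omega>))"
proof -
  interpret net: covariant_net \<A> U \<Omega> by unfold_locales fact
  let ?M = "wedge_algebra \<A>"
  note M = net.von_neumann_algebra_wedge
  have mod: "is_modular_group ?M \<Omega> (\<lambda>t. U (- 2 * pi * t, 0))"
    using assms(2) by (simp add: bisognano_wichmann_def)
  have "closure ((\<lambda>y. y \<Omega>) ` commutant ?M) = UNIV"
    by (rule cyclic_commutant_if_separating[OF M modular_group_separating[OF M mod]])
       (simp_all add: net.U_zero)
  then interpret half_sided_translation h \<epsilon> net.V ?M \<Omega>
    using assms M net.wedge_algebra_translate
    by unfold_locales (auto simp: translation_def net.U_vacuum)
  have asym: "has_asymptotic_field U h \<epsilon> x y \<longleftrightarrow> (\<forall>\<xi>. (mean (orbit x \<xi>) \<longlongrightarrow> y \<xi>) at_top)" for x y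
  proof -
    have "translated U (t, t) x \<xi> = orbit x \<xi> t" for t \<xi>
      by (simp add: translated_def net.cadjoint_V)
    then have "((\<lambda>T. \<integral>t. rescaled h \<epsilon> T t *\<^sub>R translated U (t, t) x \<xi> \<partial>lborel) \<longlongrightarrow> y \<xi>) at_top
        \<longleftrightarrow> (mean (orbit x \<xi>) \<longlongrightarrow> y \<xi>) at_top" for \<xi>
      by (intro filterlim_cong refl eventually_mono[OF eventually_gt_at_top[of 0]]) (simp add: mean_rescaled)
    then show ?thesis by (simp add: has_asymptotic_field_def)
  qed
  have field: "has_asymptotic_field U h \<epsilon> x (expectation x)" if "x \<in> ?M" for x
    unfolding asym using expectation_tendsto[OF that] by blast
  have unique: "y = expectation x" if "x \<in> ?M" "has_asymptotic_field U h \<epsilon> x y" for x y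
  proof
    show "y \<xi> = expectation x \<xi>" for \<xi>
      by (rule expectation_eqI[OF that(1), symmetric]) (rule that(2)[unfolded asym, THEN spec])
  qed
  have sub: "x \<in> net.wedge_local \<Longrightarrow> x \<in> ?M" for x using net.wedge_local_subset by blast
  have "{y. \<exists>D x. region D \<and> D \<subseteq> right_wedge \<and> x \<in> \<A> D \<and> has_asymptotic_field U h \<epsilon> x y}
      = {y. \<exists>x\<in>net.wedge_local. has_asymptotic_field U h \<epsilon> x y}"
    unfolding net.wedge_local_def by blast
  \<comment> \<open>Existence of the strong limit gives one inclusion and its uniqueness the other,
    so the generators of the asymptotic algebra are exactly the expectations of local
    operators.\<close>
  also have "\<dots> = expectation ` net.wedge_local"
  proof safe
    show "y \<in> expectation ` net.wedge_local"
      if "x \<in> net.wedge_local" "has_asymptotic_field U h \<epsilon> x y" for x y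
      using unique[OF sub[OF that(1)] that(2)] that(1) by (rule image_eqI)
    show "\<exists>z\<in>net.wedge_local. has_asymptotic_field U h \<epsilon> z (expectation x)"
      if "x \<in> net.wedge_local" for x
      using field[OF sub[OF that]] that by (rule bexI)
  qed
  finally have "asymptotic_algebra \<A> U h \<epsilon> = vn_generated (expectation ` net.wedge_local)"
    by (simp add: asymptotic_algebra_def)
  also have "\<dots> = fixed_points"
    by (rule vn_generated_expectation)
       (simp_all add: net.wedge_local_cadjoint net.wedge_local_id net.wedge_local_comp net.wedge_local_plus
         net.wedge_local_scaleC net.wedge_algebra_bicommutant)
  finally have "conditional_expectation ?M (asymptotic_algebra \<A> U h \<epsilon>) expectation"
    using conditional_expectation_fixed_points by simp
  moreover have "\<forall>D x. region D \<and> D \<subseteq> right_wedge \<and> x \<in> \<A> D \<longrightarrow> has_asymptotic_field U h \<epsilon> x (expectation x)"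
    by (intro allI impI field sub) (auto intro: net.wedge_localI)
  moreover have "\<forall>x\<in>?M. cinner \<Omega> (expectation x \<Omega>) = cinner \<Omega> (x \<Omega>)"
    by (intro ballI expectation_preserves_vacuum)
  ultimately show ?thesis by (intro exI[of _ expectation] conjI)
qed

end
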